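(* Let $A$ be a $\mathbb{Z}$-graded $k$-algebra, $\{e_1,\dots,e_n\}$ a complete set of primitive orthogonal idempotents of $A_0$, $1\le i_0\le n$, and $m$ a positive integer. Let $P$ be the graded $A$-module $(A/e_{i_0}A)\oplus e_{i_0}A(1)$ and $B$ its graded endomorphism algebra. Then the $\mathbb{Z}$-graded algebra $B^{[m]}$ is isomorphic to the graded endomorphism algebra of the graded $A^{[m]}$-module $(A^{[m]}/e_{i_0,m-1}A^{[m]})\oplus e_{i_0,m-1}A^{[m]}(1)$.
   Context: $k$ is a field; modules are right modules; for a $\mathbb{Z}$-graded vector space $M$, $M(1)_n=M_{n+1}$. The graded endomorphism algebra of a graded module $M$ is $\bigoplus_{l\in\mathbb{Z}}\mathrm{Hom}(M,M(l))$, where $\mathrm{Hom}$ denotes degree-$0$ homomorphisms. For a $\mathbb{Z}$-graded ring $A$ and $m\ge1$, the $m$-th covering $A^{[m]}$ is the subring of $\mathrm{M}_m(A)$ of matrices whose $(a,b)$ entry ($0\le a,b\le m-1$) lies in $A_{m\mathbb{Z}+b-a}=\bigoplus_{l\in\mathbb{Z}}A_{ml+b-a}$, graded so that the $(a,b)$ entry of its degree-$l$ part is $A_{ml+b-a}$. For $0\le j\le m-1$, $e_{i,j}\in A^{[m]}$ denotes the idempotent $e_i$ placed in the diagonal position $(j,j)$. *)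

theory Defs
  imports
    "HOL-Algebra.QuotRing"
    "Jordan_Normal_Form.Matrix"
begin

section \<open>Graded vector spaces, algebras and right modules\<close>

text \<open>
  As for the record \<open>module\<close> of HOL-Algebra, the fields \<open>mult\<close> and \<open>one\<close> are meaningless when the
  structure is only a vector space or a module.
\<close>

record ('k, 'v) graded_space = "('k, 'v) module" +
  hcomp :: "int \<Rightarrow> 'v set"

record ('k, 'a, 'v) graded_module = "('k, 'v) graded_space" +
  ract :: "'v \<Rightarrow> 'a \<Rightarrow> 'v"  (infixl \<open>\<triangleleft>\<index>\<close> 70)

locale graded_vector_space = field K + module K V
  for K :: "('k, 'b) ring_scheme" (structure)
  and V :: "('k, 'v, 'c) graded_space_scheme" (structure) +
  assumes hcomp_submodule: "submodule (hcomp V n) K V"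
    and decomposition: "v \<in> carrier V \<Longrightarrow>
      \<exists>!f. (\<forall>n. f n \<in> hcomp V n) \<and> finite {n. f n \<noteq> \<zero>\<^bsub>V\<^esub>} \<and>
           v = (\<Oplus>\<^bsub>V\<^esub>n\<in>{n. f n \<noteq> \<zero>\<^bsub>V\<^esub>}. f n)"

text \<open>Associative and unital, not necessarily commutative (unlike the locale \<open>algebra\<close>).\<close>

locale graded_algebra = graded_vector_space K A + alg: ring A
  for K :: "('k, 'b) ring_scheme" (structure)
  and A :: "('k, 'a, 'c) graded_space_scheme" (structure) +
  assumes smult_mult_left: "\<lbrakk>c \<in> carrier K; x \<in> carrier A; y \<in> carrier A\<rbrakk> \<Longrightarrow>
      (c \<odot>\<^bsub>A\<^esub> x) \<otimes>\<^bsub>A\<^esub> y = c \<odot>\<^bsub>A\<^esub> (x \<otimes>\<^bsub>A\<^esub> y)"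
    and smult_mult_right: "\<lbrakk>c \<in> carrier K; x \<in> carrier A; y \<in> carrier A\<rbrakk> \<Longrightarrow>
      x \<otimes>\<^bsub>A\<^esub> (c \<odot>\<^bsub>A\<^esub> y) = c \<odot>\<^bsub>A\<^esub> (x \<otimes>\<^bsub>A\<^esub> y)"
    and hcomp_one: "\<one>\<^bsub>A\<^esub> \<in> hcomp A 0"
    and hcomp_mult: "\<lbrakk>x \<in> hcomp A i; y \<in> hcomp A j\<rbrakk> \<Longrightarrow> x \<otimes>\<^bsub>A\<^esub> y \<in> hcomp A (i + j)"

definition graded_algebra_iso ::
  "('k, 'b) ring_scheme \<Rightarrow> ('k, 'v, 'c) graded_space_scheme \<Rightarrow>
   ('k, 'w, 'd) graded_space_scheme \<Rightarrow> ('v \<Rightarrow> 'w) set" where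
  "graded_algebra_iso K A B = {h \<in> ring_iso A B.
     (\<forall>c\<in>carrier K. \<forall>x\<in>carrier A. h (c \<odot>\<^bsub>A\<^esub> x) = c \<odot>\<^bsub>B\<^esub> h x) \<and>
     (\<forall>n. h ` hcomp A n = hcomp B n)}"


section \<open>Idempotents\<close>

definition orthogonal_idempotents :: "('a, 'b) ring_scheme \<Rightarrow> 'a \<Rightarrow> 'a \<Rightarrow> bool" where
  "orthogonal_idempotents R x y \<longleftrightarrow> x \<otimes>\<^bsub>R\<^esub> y = \<zero>\<^bsub>R\<^esub> \<and> y \<otimes>\<^bsub>R\<^esub> x = \<zero>\<^bsub>R\<^esub>"

definition idempotent_elem :: "('a, 'b) ring_scheme \<Rightarrow> 'a \<Rightarrow> bool" where
  "idempotent_elem R x \<longleftrightarrow> x \<in> carrier R \<and> x \<otimes>\<^bsub>R\<^esub> x = x"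

definition primitive_idempotent :: "('a, 'b) ring_scheme \<Rightarrow> 'a \<Rightarrow> bool" where
  "primitive_idempotent R x \<longleftrightarrow> idempotent_elem R x \<and> x \<noteq> \<zero>\<^bsub>R\<^esub> \<and>
     (\<forall>y z. idempotent_elem R y \<and> idempotent_elem R z \<and> orthogonal_idempotents R y z \<and>
            x = y \<oplus>\<^bsub>R\<^esub> z \<longrightarrow> y = \<zero>\<^bsub>R\<^esub> \<or> z = \<zero>\<^bsub>R\<^esub>)"

definition complete_primitive_orthogonal_idempotents ::
  "('a, 'b) ring_scheme \<Rightarrow> nat \<Rightarrow> (nat \<Rightarrow> 'a) \<Rightarrow> bool" where
  "complete_primitive_orthogonal_idempotents R n e \<longleftrightarrow>
     (\<forall>i\<in>{1..n}. primitive_idempotent R (e i)) \<and>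
     (\<forall>i\<in>{1..n}. \<forall>j\<in>{1..n}. i \<noteq> j \<longrightarrow> orthogonal_idempotents R (e i) (e j)) \<and>
     (\<Oplus>\<^bsub>R\<^esub>i\<in>{1..n}. e i) = \<one>\<^bsub>R\<^esub>"

definition degree_zero_part ::
  "('k, 'a, 'c) graded_space_scheme \<Rightarrow> ('k, 'a, 'c) graded_space_scheme" where
  "degree_zero_part A = A\<lparr>carrier := hcomp A 0\<rparr>"


section \<open>Constructions on graded right modules\<close>

definition regular_module ::
  "('k, 'a, 'c) graded_space_scheme \<Rightarrow> ('k, 'a, 'a) graded_module" where
  "regular_module A =
     \<lparr>carrier = carrier A, monoid.mult = undefined, one = undefined, zero = \<zero>\<^bsub>A\<^esub>, add = add A,
      smult = smult A, hcomp = hcomp A, ract = monoid.mult A\<rparr>"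

definition principal_right_ideal :: "('a, 'b) ring_scheme \<Rightarrow> 'a \<Rightarrow> 'a set" where
  "principal_right_ideal A x = {x \<otimes>\<^bsub>A\<^esub> a | a. a \<in> carrier A}"

definition graded_submodule ::
  "('k, 'a, 'v) graded_module \<Rightarrow> 'v set \<Rightarrow> ('k, 'a, 'v) graded_module" where
  "graded_submodule M N = M\<lparr>carrier := N, hcomp := \<lambda>n. hcomp M n \<inter> N\<rparr>"

text \<open>Elements are cosets; the operations on cosets follow \<open>FactRing\<close>.\<close>

definition graded_quotient ::
  "('k, 'a, 'v) graded_module \<Rightarrow> 'v set \<Rightarrow> ('k, 'a, 'v set) graded_module" where
  "graded_quotient M N =
     \<lparr>carrier = a_rcosets\<^bsub>M\<^esub> N, monoid.mult = undefined, one = undefined,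
      zero = N, add = set_add M,
      smult = \<lambda>c X. \<Union>x\<in>X. N +>\<^bsub>M\<^esub> (c \<odot>\<^bsub>M\<^esub> x),
      hcomp = \<lambda>n. (\<lambda>x. N +>\<^bsub>M\<^esub> x) ` hcomp M n,
      ract = \<lambda>X a. \<Union>x\<in>X. N +>\<^bsub>M\<^esub> (x \<triangleleft>\<^bsub>M\<^esub> a)\<rparr>"

definition graded_direct_sum ::
  "('k, 'a, 'v) graded_module \<Rightarrow> ('k, 'a, 'w) graded_module \<Rightarrow>
   ('k, 'a, 'v \<times> 'w) graded_module" where
  "graded_direct_sum M N =
     \<lparr>carrier = carrier M \<times> carrier N, monoid.mult = undefined, one = undefined,
      zero = (\<zero>\<^bsub>M\<^esub>, \<zero>\<^bsub>N\<^esub>),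
      add = \<lambda>p q. (fst p \<oplus>\<^bsub>M\<^esub> fst q, snd p \<oplus>\<^bsub>N\<^esub> snd q),
      smult = \<lambda>c p. (c \<odot>\<^bsub>M\<^esub> fst p, c \<odot>\<^bsub>N\<^esub> snd p),
      hcomp = \<lambda>n. hcomp M n \<times> hcomp N n,
      ract = \<lambda>p a. (fst p \<triangleleft>\<^bsub>M\<^esub> a, snd p \<triangleleft>\<^bsub>N\<^esub> a)\<rparr>"

text \<open>The shift \<open>M(s)\<close>, with \<open>M(s)\<^sub>n = M\<^sub>n\<^sub>+\<^sub>s\<close>.\<close>

definition shift ::
  "int \<Rightarrow> ('k, 'a, 'v) graded_module \<Rightarrow> ('k, 'a, 'v) graded_module" where
  "shift s M = M\<lparr>hcomp := \<lambda>n. hcomp M (n + s)\<rparr>"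

text \<open>The graded right module \<open>(A / xA) \<oplus> xA(1)\<close>, for \<open>x\<close> homogeneous of degree \<open>0\<close>.\<close>

definition quotient_plus_shifted_ideal ::
  "('k, 'a, 'c) graded_space_scheme \<Rightarrow> 'a \<Rightarrow> ('k, 'a, 'a set \<times> 'a) graded_module" where
  "quotient_plus_shifted_ideal A x =
     graded_direct_sum
       (graded_quotient (regular_module A) (principal_right_ideal A x))
       (shift 1 (graded_submodule (regular_module A) (principal_right_ideal A x)))"


section \<open>The graded endomorphism algebra\<close>

text \<open>Module homomorphisms of degree \<open>0\<close>, as extensional functions on the carrier.\<close>

definition graded_hom ::
  "('k, 'a, 'c) graded_space_scheme \<Rightarrow> ('k, 'a, 'v) graded_module \<Rightarrow>
   ('k, 'a, 'w) graded_module \<Rightarrow> ('v \<Rightarrow> 'w) set" where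
  "graded_hom A M N = {f \<in> carrier M \<rightarrow>\<^sub>E carrier N.
     (\<forall>v\<in>carrier M. \<forall>w\<in>carrier M. f (v \<oplus>\<^bsub>M\<^esub> w) = f v \<oplus>\<^bsub>N\<^esub> f w) \<and>
     (\<forall>v\<in>carrier M. \<forall>a\<in>carrier A. f (v \<triangleleft>\<^bsub>M\<^esub> a) = f v \<triangleleft>\<^bsub>N\<^esub> a) \<and>
     (\<forall>n. f ` hcomp M n \<subseteq> hcomp N n)}"

definition zero_map ::
  "('k, 'a, 'v) graded_module \<Rightarrow> ('k, 'a, 'w) graded_module \<Rightarrow> 'v \<Rightarrow> 'w" where
  "zero_map M N = (\<lambda>v\<in>carrier M. \<zero>\<^bsub>N\<^esub>)"

text \<open>
  An element of the external direct sum of the spaces \<open>Hom(M, M(l))\<close> is a finitely supported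
  family \<open>F\<close> with \<open>F l \<in> Hom(M, M(l))\<close>.  The product of \<open>f \<in> Hom(M, M(i))\<close> and \<open>g \<in> Hom(M, M(j))\<close>
  is \<open>f(j) \<circ> g \<in> Hom(M, M(i + j))\<close>, whose underlying map is \<open>f \<circ> g\<close>: endomorphisms act on the
  left of the right module \<open>M\<close>.
\<close>

definition graded_End ::
  "('k, 'a, 'c) graded_space_scheme \<Rightarrow> ('k, 'a, 'v) graded_module \<Rightarrow>
   ('k, int \<Rightarrow> 'v \<Rightarrow> 'v) graded_space" where
  "graded_End A M =
     \<lparr>carrier = {F. (\<forall>l. F l \<in> graded_hom A M (shift l M)) \<and> finite {l. F l \<noteq> zero_map M M}},
      monoid.mult = \<lambda>F G l. \<lambda>v\<in>carrier M. \<Oplus>\<^bsub>M\<^esub>i\<in>{i. F i \<noteq> zero_map M M}. F i (G (l - i) v),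
      one = \<lambda>l. if l = 0 then (\<lambda>v\<in>carrier M. v) else zero_map M M,
      zero = \<lambda>l. zero_map M M,
      add = \<lambda>F G l. \<lambda>v\<in>carrier M. F l v \<oplus>\<^bsub>M\<^esub> G l v,
      smult = \<lambda>c F l. \<lambda>v\<in>carrier M. c \<odot>\<^bsub>M\<^esub> F l v,
      hcomp = \<lambda>n. {F. F n \<in> graded_hom A M (shift n M) \<and> (\<forall>l. l \<noteq> n \<longrightarrow> F l = zero_map M M)}\<rparr>"


section \<open>Coverings\<close>

text \<open>The sum of the homogeneous components of \<open>A\<close> with degree in \<open>D\<close>.\<close>

definition hcomp_sum :: "('k, 'a, 'c) graded_space_scheme \<Rightarrow> int set \<Rightarrow> 'a set" where
  "hcomp_sum A D =
     {(\<Oplus>\<^bsub>A\<^esub>n\<in>I. f n) | I f. finite I \<and> I \<subseteq> D \<and> (\<forall>n\<in>I. f n \<in> hcomp A n)}"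

text \<open>
  Only the type \<open>'a mat\<close> is taken from the matrix library: its own ring operations are based on
  type classes, whereas the entries here live in an algebra given by a record.
\<close>

definition covering ::
  "nat \<Rightarrow> ('k, 'a, 'c) graded_space_scheme \<Rightarrow> ('k, 'a mat) graded_space" where
  "covering m A =
     \<lparr>carrier = {X \<in> carrier_mat m m. \<forall>a<m. \<forall>b<m.
        X $$ (a, b) \<in> hcomp_sum A {int m * l + int b - int a | l. True}},
      monoid.mult = \<lambda>X Y. mat m m (\<lambda>(a, b). \<Oplus>\<^bsub>A\<^esub>c\<in>{..<m}. X $$ (a, c) \<otimes>\<^bsub>A\<^esub> Y $$ (c, b)),
      one = mat m m (\<lambda>(a, b). if a = b then \<one>\<^bsub>A\<^esub> else \<zero>\<^bsub>A\<^esub>),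
      zero = mat m m (\<lambda>(a, b). \<zero>\<^bsub>A\<^esub>),
      add = \<lambda>X Y. mat m m (\<lambda>(a, b). X $$ (a, b) \<oplus>\<^bsub>A\<^esub> Y $$ (a, b)),
      smult = \<lambda>c X. mat m m (\<lambda>(a, b). c \<odot>\<^bsub>A\<^esub> X $$ (a, b)),
      hcomp = \<lambda>l. {X \<in> carrier_mat m m. \<forall>a<m. \<forall>b<m.
        X $$ (a, b) \<in> hcomp A (int m * l + int b - int a)}\<rparr>"

text \<open>The \<open>m \<times> m\<close> matrix with \<open>x\<close> in the diagonal position \<open>(j, j)\<close> and zeros elsewhere.\<close>

definition diagonal_entry :: "('a, 'b) ring_scheme \<Rightarrow> nat \<Rightarrow> nat \<Rightarrow> 'a \<Rightarrow> 'a mat" where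
  "diagonal_entry A m j x = mat m m (\<lambda>(a, b). if a = j \<and> b = j then x else \<zero>\<^bsub>A\<^esub>)"

end

theory Submission
  imports Defs "HOL-Algebra.Subrings"
begin

text \<open>Write \<open>e = e\<^bsub>i0\<^esub>\<close> and \<open>f = 1 - e\<close>.  As \<open>A / e A \<cong> f A\<close>, the module \<open>P = (A / e A) \<oplus> e A(1)\<close> is the free
  module \<open>A = f A \<oplus> e A\<close> of rank one with another grading.  Its endomorphisms are therefore the left
  multiplications by elements of \<open>A\<close>, and \<open>B\<close> is the algebra \<open>A\<close> itself with another grading: an element
  \<open>x\<close> has degree \<open>n\<close> if \<open>f x f\<close> and \<open>e x e\<close> have degree \<open>n\<close> in \<open>A\<close>, \<open>f x e\<close> has degree \<open>n - 1\<close>, and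
  \<open>e x f\<close> has degree \<open>n + 1\<close>.  This is \<open>regrade A e\<close>, and the isomorphism is
  \<open>graded_End_quotient_plus_shifted_ideal\<close>.

  The covering \<open>C\<close> of \<open>A\<close> is again a graded algebra (\<open>graded_algebra_covering\<close>), and \<open>e\<close> placed in the
  last diagonal position is an idempotent \<open>\<epsilon>\<close> of degree \<open>0\<close> in it.  So the same result identifies the
  second endomorphism algebra with \<open>regrade C \<epsilon>\<close>.  What is left is an isomorphism between the covering
  of \<open>regrade A e\<close> and \<open>regrade C \<epsilon>\<close> (\<open>covering_regrade_iso\<close>).  Both consist of \<open>m \<times> m\<close> matrices over
  \<open>A\<close> with the usual multiplication, subject to different degree conditions, and conjugation by
  the matrix \<open>f I + e S\<close>, where \<open>S\<close> is the matrix of a cyclic permutation, takes one to the other: it rotates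
  the \<open>e\<close> components by one position, which compensates the shift of \<open>e A(1)\<close>, except that one
  component passes from the first position to the last, where it meets the shift by one in the
  covering.\<close>

section \<open>Homogeneous parts\<close>

lemma finsum_additive_map:
  assumes G: "abelian_group G" and H: "abelian_group H"
    and closed: "\<And>x. x \<in> carrier G \<Longrightarrow> h x \<in> carrier H"
    and add: "\<And>x y. \<lbrakk>x \<in> carrier G; y \<in> carrier G\<rbrakk> \<Longrightarrow> h (x \<oplus>\<^bsub>G\<^esub> y) = h x \<oplus>\<^bsub>H\<^esub> h y"
  shows "h \<zero>\<^bsub>G\<^esub> = \<zero>\<^bsub>H\<^esub>"
    and "\<lbrakk>finite I; \<And>i. i \<in> I \<Longrightarrow> f i \<in> carrier G\<rbrakk> \<Longrightarrow>
      h (\<Oplus>\<^bsub>G\<^esub>i\<in>I. f i) = (\<Oplus>\<^bsub>H\<^esub>i\<in>I. h (f i))"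
proof -
  interpret G: abelian_group G by fact
  interpret H: abelian_group H by fact
  have "h \<zero>\<^bsub>G\<^esub> \<oplus>\<^bsub>H\<^esub> h \<zero>\<^bsub>G\<^esub> = h \<zero>\<^bsub>G\<^esub>"
    using add[of "\<zero>\<^bsub>G\<^esub>" "\<zero>\<^bsub>G\<^esub>"] by simp
  then show zero: "h \<zero>\<^bsub>G\<^esub> = \<zero>\<^bsub>H\<^esub>"
    using H.add.r_cancel_one' closed by (metis G.zero_closed)
  show "h (\<Oplus>\<^bsub>G\<^esub>i\<in>I. f i) = (\<Oplus>\<^bsub>H\<^esub>i\<in>I. h (f i))"
    if "finite I" "\<And>i. i \<in> I \<Longrightarrow> f i \<in> carrier G"
    using that
  proof (induction I rule: finite_induct)
    case empty
    then show ?case by (simp add: zero)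
  next
    case (insert i I)
    then show ?case by (simp add: add closed Pi_def)
  qed
qed

definition hpart :: "('k, 'v, 'c) graded_space_scheme \<Rightarrow> 'v \<Rightarrow> int \<Rightarrow> 'v" where
  "hpart V v = (THE f. (\<forall>n. f n \<in> hcomp V n) \<and> finite {n. f n \<noteq> \<zero>\<^bsub>V\<^esub>} \<and>
     v = (\<Oplus>\<^bsub>V\<^esub>n\<in>{n. f n \<noteq> \<zero>\<^bsub>V\<^esub>}. f n))"

context graded_vector_space
begin

lemma hcomp_closed: "x \<in> hcomp V n \<Longrightarrow> x \<in> carrier V"
  using submoduleE(1)[OF hcomp_submodule] by blast

lemma hcomp_add: "\<lbrakk>x \<in> hcomp V n; y \<in> hcomp V n\<rbrakk> \<Longrightarrow> x \<oplus>\<^bsub>V\<^esub> y \<in> hcomp V n"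
  using submoduleE(5)[OF hcomp_submodule] by blast

lemma hcomp_minus: "x \<in> hcomp V n \<Longrightarrow> \<ominus>\<^bsub>V\<^esub> x \<in> hcomp V n"
  using submoduleE(3)[OF hcomp_submodule] by blast

lemma hcomp_smult: "\<lbrakk>c \<in> carrier K; x \<in> hcomp V n\<rbrakk> \<Longrightarrow> c \<odot>\<^bsub>V\<^esub> x \<in> hcomp V n"
  using submoduleE(4)[OF hcomp_submodule] by blast

lemma hcomp_zero: "\<zero>\<^bsub>V\<^esub> \<in> hcomp V n"
  using hcomp_submodule[of n] by (simp add: submodule_def subgroup_def)

lemma hpart_decomposition:
  assumes "v \<in> carrier V"
  shows hpart_hcomp: "hpart V v n \<in> hcomp V n"
    and hpart_finite: "finite {n. hpart V v n \<noteq> \<zero>\<^bsub>V\<^esub>}"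
    and hpart_sum: "(\<Oplus>\<^bsub>V\<^esub>n\<in>{n. hpart V v n \<noteq> \<zero>\<^bsub>V\<^esub>}. hpart V v n) = v"
  using theI'[OF decomposition[OF assms], folded hpart_def] by auto

lemma hpart_closed [simp]: "v \<in> carrier V \<Longrightarrow> hpart V v n \<in> carrier V"
  using hpart_hcomp hcomp_closed by blast

lemma hpart_sum_superset:
  assumes "v \<in> carrier V" "finite I" "\<And>n. n \<notin> I \<Longrightarrow> hpart V v n = \<zero>\<^bsub>V\<^esub>"
  shows "(\<Oplus>\<^bsub>V\<^esub>n\<in>I. hpart V v n) = v"
proof -
  have "(\<Oplus>\<^bsub>V\<^esub>n\<in>{n. hpart V v n \<noteq> \<zero>\<^bsub>V\<^esub>}. hpart V v n) = (\<Oplus>\<^bsub>V\<^esub>n\<in>I. hpart V v n)"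
    by (rule M.add.finprod_mono_neutral_cong_left) (use assms in auto)
  then show ?thesis using hpart_sum[OF assms(1)] by simp
qed

lemma hpart_sum_shift:
  assumes v: "v \<in> carrier V" and I: "finite I" "\<And>n. n \<notin> I \<Longrightarrow> hpart V v (n - d) = \<zero>\<^bsub>V\<^esub>"
  shows "(\<Oplus>\<^bsub>V\<^esub>n\<in>I. hpart V v (n - d)) = v"
proof -
  have "(\<Oplus>\<^bsub>V\<^esub>n\<in>I. hpart V v (n - d)) = (\<Oplus>\<^bsub>V\<^esub>n\<in>(\<lambda>n. n - d) ` I. hpart V v n)"
    by (subst M.finsum_reindex) (use v in \<open>auto simp: inj_on_def\<close>)
  also have "\<dots> = v"
  proof (rule hpart_sum_superset[OF v])
    show "hpart V v n = \<zero>\<^bsub>V\<^esub>" if "n \<notin> (\<lambda>n. n - d) ` I" for n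
      using I(2)[of "n + d"] that by force
  qed (use I in simp)
  finally show ?thesis .
qed

lemma hpart_unique:
  assumes f: "\<And>n. f n \<in> hcomp V n" and I: "finite I" "\<And>n. n \<notin> I \<Longrightarrow> f n = \<zero>\<^bsub>V\<^esub>"
    and v: "v = (\<Oplus>\<^bsub>V\<^esub>n\<in>I. f n)"
  shows "hpart V v = f"
proof -
  have supp: "finite {n. f n \<noteq> \<zero>\<^bsub>V\<^esub>}"
    by (rule finite_subset[OF _ I(1)]) (use I(2) in auto)
  have closed: "f n \<in> carrier V" for n using f hcomp_closed by blast
  have "(\<Oplus>\<^bsub>V\<^esub>n\<in>{n. f n \<noteq> \<zero>\<^bsub>V\<^esub>}. f n) = (\<Oplus>\<^bsub>V\<^esub>n\<in>I. f n)"
    by (rule M.add.finprod_mono_neutral_cong_left) (use I closed in auto)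
  moreover have "v \<in> carrier V" using v closed by (simp add: M.finsum_closed)
  ultimately show ?thesis
    unfolding hpart_def by (intro the1_equality[OF decomposition]) (use f supp v in simp_all)
qed

lemma hpart_homogeneous:
  assumes "v \<in> hcomp V n"
  shows "hpart V v k = (if k = n then v else \<zero>\<^bsub>V\<^esub>)"
proof -
  have "hpart V v = (\<lambda>k. if k = n then v else \<zero>\<^bsub>V\<^esub>)"
    by (rule hpart_unique[where I = "{n}"]) (use assms hcomp_zero hcomp_closed in auto)
  then show ?thesis by simp
qed

text \<open>The compatibility of homogeneous parts with scalars and negation, and their behaviour under
  multiplication by a homogeneous element on either side, are all instances of this: an additive map that raises
  degrees by \<open>d\<close> carries the decomposition of \<open>v\<close> to a decomposition of \<open>h v\<close>, and decompositions
  are unique.\<close>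

lemma hpart_additive_map:
  assumes closed: "\<And>x. x \<in> carrier V \<Longrightarrow> h x \<in> carrier V"
    and add: "\<And>x y. \<lbrakk>x \<in> carrier V; y \<in> carrier V\<rbrakk> \<Longrightarrow> h (x \<oplus>\<^bsub>V\<^esub> y) = h x \<oplus>\<^bsub>V\<^esub> h y"
    and deg: "\<And>n x. x \<in> hcomp V n \<Longrightarrow> h x \<in> hcomp V (n + d)"
    and v: "v \<in> carrier V"
  shows "hpart V (h v) n = h (hpart V v (n - d))"
proof -
  let ?S = "{n. hpart V v n \<noteq> \<zero>\<^bsub>V\<^esub>}"
  note hom = finsum_additive_map[OF M.abelian_group_axioms M.abelian_group_axioms closed add]
  have "hpart V (h v) = (\<lambda>n. h (hpart V v (n - d)))"
  proof (rule hpart_unique)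
    show "h (hpart V v (n - d)) \<in> hcomp V n" for n
      using deg[OF hpart_hcomp[OF v], of "n - d"] by simp
    show "finite ((\<lambda>i. i + d) ` ?S)" using hpart_finite[OF v] by simp
    show "h (hpart V v (n - d)) = \<zero>\<^bsub>V\<^esub>" if "n \<notin> (\<lambda>i. i + d) ` ?S" for n
    proof -
      have "hpart V v (n - d) = \<zero>\<^bsub>V\<^esub>"
      proof (rule ccontr)
        assume "hpart V v (n - d) \<noteq> \<zero>\<^bsub>V\<^esub>"
        then have "n \<in> (\<lambda>i. i + d) ` ?S" by (intro image_eqI[of _ _ "n - d"]) auto
        with that show False by simp
      qed
      then show ?thesis by (simp add: hom(1))
    qed
    have "h v = h (\<Oplus>\<^bsub>V\<^esub>n\<in>?S. hpart V v n)" using hpart_sum[OF v] by simp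
    also have "\<dots> = (\<Oplus>\<^bsub>V\<^esub>n\<in>?S. h (hpart V v n))"
      by (rule hom(2)) (use v hpart_finite in auto)
    also have "\<dots> = (\<Oplus>\<^bsub>V\<^esub>n\<in>(\<lambda>i. i + d) ` ?S. h (hpart V v (n - d)))"
      by (subst M.finsum_reindex) (use closed v in \<open>auto simp: inj_on_def\<close>)
    finally show "h v = (\<Oplus>\<^bsub>V\<^esub>n\<in>(\<lambda>i. i + d) ` ?S. h (hpart V v (n - d)))" .
  qed
  then show ?thesis by simp
qed

lemma hpart_add:
  assumes "v \<in> carrier V" "w \<in> carrier V"
  shows "hpart V (v \<oplus>\<^bsub>V\<^esub> w) n = hpart V v n \<oplus>\<^bsub>V\<^esub> hpart V w n"
proof -
  let ?I = "{n. hpart V v n \<noteq> \<zero>\<^bsub>V\<^esub>} \<union> {n. hpart V w n \<noteq> \<zero>\<^bsub>V\<^esub>}"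
  have fin: "finite ?I" using assms hpart_finite by simp
  have "hpart V (v \<oplus>\<^bsub>V\<^esub> w) = (\<lambda>n. hpart V v n \<oplus>\<^bsub>V\<^esub> hpart V w n)"
  proof (rule hpart_unique[OF _ fin])
    have "v \<oplus>\<^bsub>V\<^esub> w = (\<Oplus>\<^bsub>V\<^esub>n\<in>?I. hpart V v n) \<oplus>\<^bsub>V\<^esub> (\<Oplus>\<^bsub>V\<^esub>n\<in>?I. hpart V w n)"
      using hpart_sum_superset[OF assms(1) fin] hpart_sum_superset[OF assms(2) fin] by simp
    then show "v \<oplus>\<^bsub>V\<^esub> w = (\<Oplus>\<^bsub>V\<^esub>n\<in>?I. hpart V v n \<oplus>\<^bsub>V\<^esub> hpart V w n)"
      using assms by (simp add: M.finsum_addf Pi_def)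
  qed (use assms hpart_hcomp hcomp_add in auto)
  then show ?thesis by simp
qed

lemma hpart_smult:
  assumes "c \<in> carrier K" "v \<in> carrier V"
  shows "hpart V (c \<odot>\<^bsub>V\<^esub> v) n = c \<odot>\<^bsub>V\<^esub> hpart V v n"
  using hpart_additive_map[of "\<lambda>v. c \<odot>\<^bsub>V\<^esub> v" 0 v n] assms
  by (simp add: hcomp_smult smult_r_distr)

lemma hpart_zero: "hpart V \<zero>\<^bsub>V\<^esub> n = \<zero>\<^bsub>V\<^esub>"
  using hpart_homogeneous[OF hcomp_zero] by simp

lemma hpart_minus:
  assumes "v \<in> carrier V"
  shows "hpart V (\<ominus>\<^bsub>V\<^esub> v) n = \<ominus>\<^bsub>V\<^esub> hpart V v n"
  using hpart_additive_map[of "\<lambda>v. \<ominus>\<^bsub>V\<^esub> v" 0 v n] assms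
  by (simp add: hcomp_minus M.minus_add)

lemma hpart_finsum:
  assumes "finite I" "\<And>i. i \<in> I \<Longrightarrow> f i \<in> carrier V"
  shows "hpart V (\<Oplus>\<^bsub>V\<^esub>i\<in>I. f i) n = (\<Oplus>\<^bsub>V\<^esub>i\<in>I. hpart V (f i) n)"
  by (rule finsum_additive_map(2)[OF M.abelian_group_axioms M.abelian_group_axioms])
    (use assms hpart_add in auto)

lemma hpart_eqI:
  assumes "v \<in> carrier V" "w \<in> carrier V" "\<And>n. hpart V v n = hpart V w n"
  shows "v = w"
proof -
  have "hpart V v = hpart V w" using assms(3) by blast
  then show ?thesis using hpart_sum[OF assms(1)] hpart_sum[OF assms(2)] by metis
qed

text \<open>The sums that occur in coverings become conditions on homogeneous parts; in this form their
  closure properties are immediate.\<close>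

lemma hcomp_sum_iff_hpart:
  "v \<in> hcomp_sum V D \<longleftrightarrow> v \<in> carrier V \<and> (\<forall>n. n \<notin> D \<longrightarrow> hpart V v n = \<zero>\<^bsub>V\<^esub>)"
proof
  assume "v \<in> hcomp_sum V D"
  then obtain I f where I: "finite I" "I \<subseteq> D" and f: "\<forall>n\<in>I. f n \<in> hcomp V n"
    and v: "v = (\<Oplus>\<^bsub>V\<^esub>n\<in>I. f n)"
    unfolding hcomp_sum_def by blast
  have closed: "f n \<in> carrier V" if "n \<in> I" for n using f that hcomp_closed by blast
  have "hpart V v n = \<zero>\<^bsub>V\<^esub>" if "n \<notin> D" for n
  proof -
    have "hpart V v n = (\<Oplus>\<^bsub>V\<^esub>i\<in>I. hpart V (f i) n)"
      unfolding v by (rule hpart_finsum) (use I closed in auto)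
    also have "\<dots> = \<zero>\<^bsub>V\<^esub>"
    proof (rule M.add.finprod_one_eqI)
      show "hpart V (f i) n = \<zero>\<^bsub>V\<^esub>" if "i \<in> I" for i
        using hpart_homogeneous[of "f i" i n] f that \<open>n \<notin> D\<close> I by auto
    qed
    finally show ?thesis .
  qed
  moreover have "v \<in> carrier V" unfolding v using closed by (simp add: M.finsum_closed)
  ultimately show "v \<in> carrier V \<and> (\<forall>n. n \<notin> D \<longrightarrow> hpart V v n = \<zero>\<^bsub>V\<^esub>)" by blast
next
  assume *: "v \<in> carrier V \<and> (\<forall>n. n \<notin> D \<longrightarrow> hpart V v n = \<zero>\<^bsub>V\<^esub>)"
  then show "v \<in> hcomp_sum V D"
    unfolding hcomp_sum_def mem_Collect_eq
    by (intro exI[of _ "{n. hpart V v n \<noteq> \<zero>\<^bsub>V\<^esub>}"] exI[of _ "hpart V v"] conjI)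
      (use hpart_sum[of v] hpart_finite[of v] hpart_hcomp[of v] in auto)
qed

lemma hcomp_finsum:
  assumes "finite I" "\<And>i. i \<in> I \<Longrightarrow> f i \<in> hcomp V n"
  shows "(\<Oplus>\<^bsub>V\<^esub>i\<in>I. f i) \<in> hcomp V n"
  using assms
proof (induction I rule: finite_induct)
  case (insert i I)
  then have "f j \<in> carrier V" if "j \<in> insert i I" for j using hcomp_closed that by blast
  with insert show ?case by (simp add: hcomp_add Pi_def)
qed (simp add: hcomp_zero)

lemma hcomp_sum_closed: "x \<in> hcomp_sum V D \<Longrightarrow> x \<in> carrier V"
  by (simp add: hcomp_sum_iff_hpart)

lemma hcomp_subset_hcomp_sum: "\<lbrakk>x \<in> hcomp V n; n \<in> D\<rbrakk> \<Longrightarrow> x \<in> hcomp_sum V D"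
  using hcomp_closed by (auto simp: hcomp_sum_iff_hpart hpart_homogeneous)

lemma hcomp_sum_zero: "\<zero>\<^bsub>V\<^esub> \<in> hcomp_sum V D"
  by (simp add: hcomp_sum_iff_hpart hpart_zero)

lemma hcomp_sum_add: "\<lbrakk>x \<in> hcomp_sum V D; y \<in> hcomp_sum V D\<rbrakk> \<Longrightarrow> x \<oplus>\<^bsub>V\<^esub> y \<in> hcomp_sum V D"
  by (simp add: hcomp_sum_iff_hpart hpart_add)

lemma hcomp_sum_minus: "x \<in> hcomp_sum V D \<Longrightarrow> \<ominus>\<^bsub>V\<^esub> x \<in> hcomp_sum V D"
  by (simp add: hcomp_sum_iff_hpart hpart_minus)

lemma hcomp_sum_smult: "\<lbrakk>c \<in> carrier K; x \<in> hcomp_sum V D\<rbrakk> \<Longrightarrow> c \<odot>\<^bsub>V\<^esub> x \<in> hcomp_sum V D"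
  by (simp add: hcomp_sum_iff_hpart hpart_smult)

lemma hcomp_sum_finsum:
  assumes "finite I" "\<And>i. i \<in> I \<Longrightarrow> f i \<in> hcomp_sum V D"
  shows "(\<Oplus>\<^bsub>V\<^esub>i\<in>I. f i) \<in> hcomp_sum V D"
  using assms
proof (induction I rule: finite_induct)
  case (insert i I)
  then have "f j \<in> carrier V" if "j \<in> insert i I" for j using hcomp_sum_closed that by blast
  with insert show ?case by (simp add: hcomp_sum_add Pi_def)
qed (simp add: hcomp_sum_zero)

end

text \<open>A grading may be given by candidate projections \<open>p v n\<close>.  The existence of decompositions is then
  assumed; uniqueness follows by applying the additive maps \<open>\<lambda>v. p v k\<close> to a decomposition, since
  they are the identity in degree \<open>k\<close> and vanish in the other degrees.\<close>

lemma graded_vector_spaceI: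
  assumes "field K" and "module K V"
    and sub: "\<And>n. submodule (hcomp V n) K V"
    and p: "\<And>v n. v \<in> carrier V \<Longrightarrow> p v n \<in> hcomp V n"
    and sum: "\<And>v. v \<in> carrier V \<Longrightarrow>
      \<exists>I. finite I \<and> (\<forall>n. n \<notin> I \<longrightarrow> p v n = \<zero>\<^bsub>V\<^esub>) \<and> (\<Oplus>\<^bsub>V\<^esub>n\<in>I. p v n) = v"
    and add: "\<And>v w n. \<lbrakk>v \<in> carrier V; w \<in> carrier V\<rbrakk> \<Longrightarrow> p (v \<oplus>\<^bsub>V\<^esub> w) n = p v n \<oplus>\<^bsub>V\<^esub> p w n"
    and hom: "\<And>v n k. v \<in> hcomp V n \<Longrightarrow> p v k = (if k = n then v else \<zero>\<^bsub>V\<^esub>)"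
  shows "graded_vector_space K V"
proof -
  interpret module K V by fact
  have sub_closed: "x \<in> carrier V" if "x \<in> hcomp V n" for x n
    using submoduleE(1)[OF sub] that by blast
  have p_closed: "p v n \<in> carrier V" if "v \<in> carrier V" for v n
    using p sub_closed that by blast
  have uniq: "f = p v" if f: "\<forall>n. f n \<in> hcomp V n" "finite {n. f n \<noteq> \<zero>\<^bsub>V\<^esub>}"
    "v = (\<Oplus>\<^bsub>V\<^esub>n\<in>{n. f n \<noteq> \<zero>\<^bsub>V\<^esub>}. f n)" for f v
  proof
    fix k
    have f_closed: "f n \<in> carrier V" for n using f(1) sub_closed by blast
    have "p v k = (\<Oplus>\<^bsub>V\<^esub>n\<in>{n. f n \<noteq> \<zero>\<^bsub>V\<^esub>}. p (f n) k)"
      unfolding f(3)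
      by (rule finsum_additive_map(2)[OF M.abelian_group_axioms M.abelian_group_axioms])
        (simp_all add: f(2) add p_closed f_closed)
    also have "\<dots> = (\<Oplus>\<^bsub>V\<^esub>n\<in>{n. f n \<noteq> \<zero>\<^bsub>V\<^esub>}. if k = n then f n else \<zero>\<^bsub>V\<^esub>)"
      by (intro M.finsum_cong') (use f(1) f_closed hom in auto)
    also have "\<dots> = f k"
    proof (cases "f k = \<zero>\<^bsub>V\<^esub>")
      case True
      then show ?thesis by (auto intro!: M.add.finprod_one_eqI)
    next
      case False
      then show ?thesis
        using M.finsum_singleton[of k "{n. f n \<noteq> \<zero>\<^bsub>V\<^esub>}" f] f(2) f_closed by auto
    qed
    finally show "f k = p v k" by simp
  qed
  have "\<exists>!f. (\<forall>n. f n \<in> hcomp V n) \<and> finite {n. f n \<noteq> \<zero>\<^bsub>V\<^esub>} \<and>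
      v = (\<Oplus>\<^bsub>V\<^esub>n\<in>{n. f n \<noteq> \<zero>\<^bsub>V\<^esub>}. f n)" if v: "v \<in> carrier V" for v
  proof (rule ex1I[of _ "p v"])
    show "(\<forall>n. p v n \<in> hcomp V n) \<and> finite {n. p v n \<noteq> \<zero>\<^bsub>V\<^esub>} \<and>
      v = (\<Oplus>\<^bsub>V\<^esub>n\<in>{n. p v n \<noteq> \<zero>\<^bsub>V\<^esub>}. p v n)"
    proof -
      obtain I where I: "finite I" "\<forall>n. n \<notin> I \<longrightarrow> p v n = \<zero>\<^bsub>V\<^esub>" "(\<Oplus>\<^bsub>V\<^esub>n\<in>I. p v n) = v"
        using sum[OF v] by blast
      have "(\<Oplus>\<^bsub>V\<^esub>n\<in>{n. p v n \<noteq> \<zero>\<^bsub>V\<^esub>}. p v n) = (\<Oplus>\<^bsub>V\<^esub>n\<in>I. p v n)"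
        by (rule M.add.finprod_mono_neutral_cong_left) (use I p_closed v in auto)
      moreover have "finite {n. p v n \<noteq> \<zero>\<^bsub>V\<^esub>}"
        by (rule finite_subset[OF _ I(1)]) (use I(2) in auto)
      ultimately show ?thesis using p[OF v] I(3) by simp
    qed
    show "f = p v" if "(\<forall>n. f n \<in> hcomp V n) \<and> finite {n. f n \<noteq> \<zero>\<^bsub>V\<^esub>} \<and>
      v = (\<Oplus>\<^bsub>V\<^esub>n\<in>{n. f n \<noteq> \<zero>\<^bsub>V\<^esub>}. f n)" for f
      using uniq[of f v] that by blast
  qed
  then show ?thesis
    using assms(1,2) sub by (intro graded_vector_space.intro graded_vector_space_axioms.intro)
qed

context graded_algebra
begin

lemma hpart_mult_left:
  assumes "x \<in> hcomp A d" "y \<in> carrier A"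
  shows "hpart A (x \<otimes>\<^bsub>A\<^esub> y) n = x \<otimes>\<^bsub>A\<^esub> hpart A y (n - d)"
  by (rule hpart_additive_map[of "\<lambda>y. x \<otimes>\<^bsub>A\<^esub> y"])
    (use assms hcomp_closed alg.r_distr hcomp_mult[OF assms(1)] in \<open>auto simp: add.commute\<close>)

lemma hpart_mult_right:
  assumes "x \<in> hcomp A d" "y \<in> carrier A"
  shows "hpart A (y \<otimes>\<^bsub>A\<^esub> x) n = hpart A y (n - d) \<otimes>\<^bsub>A\<^esub> x"
  by (rule hpart_additive_map[of "\<lambda>y. y \<otimes>\<^bsub>A\<^esub> x"])
    (use assms hcomp_closed alg.l_distr hcomp_mult[OF _ assms(1)] in auto)

lemma hpart_mult:
  assumes x: "x \<in> carrier A" and y: "y \<in> carrier A"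
    and I: "finite I" "\<And>i. i \<notin> I \<Longrightarrow> hpart A x i = \<zero>\<^bsub>A\<^esub>"
  shows "hpart A (x \<otimes>\<^bsub>A\<^esub> y) n = (\<Oplus>\<^bsub>A\<^esub>i\<in>I. hpart A x i \<otimes>\<^bsub>A\<^esub> hpart A y (n - i))"
proof -
  have "hpart A (x \<otimes>\<^bsub>A\<^esub> y) n = hpart A ((\<Oplus>\<^bsub>A\<^esub>i\<in>I. hpart A x i) \<otimes>\<^bsub>A\<^esub> y) n"
    using hpart_sum_superset[OF x I] by simp
  also have "\<dots> = hpart A (\<Oplus>\<^bsub>A\<^esub>i\<in>I. hpart A x i \<otimes>\<^bsub>A\<^esub> y) n"
    using x y I by (simp add: alg.finsum_ldistr Pi_def)
  also have "\<dots> = (\<Oplus>\<^bsub>A\<^esub>i\<in>I. hpart A (hpart A x i \<otimes>\<^bsub>A\<^esub> y) n)"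
    using x y I by (intro hpart_finsum) auto
  also have "\<dots> = (\<Oplus>\<^bsub>A\<^esub>i\<in>I. hpart A x i \<otimes>\<^bsub>A\<^esub> hpart A y (n - i))"
    by (intro M.finsum_cong') (use x y hpart_mult_left[OF hpart_hcomp] in auto)
  finally show ?thesis .
qed

lemma hcomp_sum_mult:
  assumes x: "x \<in> hcomp_sum A D" and y: "y \<in> hcomp_sum A E"
    and deg: "\<And>i j. \<lbrakk>i \<in> D; j \<in> E\<rbrakk> \<Longrightarrow> i + j \<in> F"
  shows "x \<otimes>\<^bsub>A\<^esub> y \<in> hcomp_sum A F"
proof -
  have closed: "x \<in> carrier A" "y \<in> carrier A" using x y hcomp_sum_closed by auto
  have "hpart A (x \<otimes>\<^bsub>A\<^esub> y) n = \<zero>\<^bsub>A\<^esub>" if "n \<notin> F" for n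
  proof -
    have "hpart A x i \<otimes>\<^bsub>A\<^esub> hpart A y (n - i) = \<zero>\<^bsub>A\<^esub>" for i
      using x y deg[of i "n - i"] that closed
      by (cases "i \<in> D"; cases "n - i \<in> E") (auto simp: hcomp_sum_iff_hpart)
    then show ?thesis
      using hpart_mult[OF closed hpart_finite[OF closed(1)]] by simp
  qed
  then show ?thesis using closed by (simp add: hcomp_sum_iff_hpart)
qed

end

section \<open>Regrading along the Peirce decomposition\<close>

locale graded_algebra_idempotent = graded_algebra K A
  for K :: "('k, 'b) ring_scheme" (structure)
  and A :: "('k, 'a, 'c) graded_space_scheme" (structure) +
  fixes e :: 'a
  assumes e_hcomp: "e \<in> hcomp A 0"
    and e_idem: "e \<otimes>\<^bsub>A\<^esub> e = e"
begin

text \<open>The complementary idempotent; the two together cut \<open>x\<close> into the corners \<open>f x f\<close>, \<open>f x e\<close>, \<open>e x f\<close>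
  and \<open>e x e\<close>.\<close>

abbreviation f :: 'a where "f \<equiv> \<one>\<^bsub>A\<^esub> \<ominus>\<^bsub>A\<^esub> e"

lemma f_hcomp: "f \<in> hcomp A 0"
  unfolding a_minus_def by (intro hcomp_add hcomp_one hcomp_minus e_hcomp)

lemma e_closed [simp]: "e \<in> carrier A"
  using e_hcomp hcomp_closed by blast

lemma f_closed [simp]: "f \<in> carrier A"
  by simp

lemma peirce_idempotents:
  "f \<otimes>\<^bsub>A\<^esub> f = f" "f \<otimes>\<^bsub>A\<^esub> e = \<zero>\<^bsub>A\<^esub>" "e \<otimes>\<^bsub>A\<^esub> f = \<zero>\<^bsub>A\<^esub>" "f \<oplus>\<^bsub>A\<^esub> e = \<one>\<^bsub>A\<^esub>"
proof -
  show fe: "f \<otimes>\<^bsub>A\<^esub> e = \<zero>\<^bsub>A\<^esub>" and "e \<otimes>\<^bsub>A\<^esub> f = \<zero>\<^bsub>A\<^esub>" and "f \<oplus>\<^bsub>A\<^esub> e = \<one>\<^bsub>A\<^esub>"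
    by (simp_all add: a_minus_def alg.l_distr alg.r_distr alg.l_minus alg.r_minus e_idem
        M.r_neg M.a_assoc M.l_neg)
  have "f \<otimes>\<^bsub>A\<^esub> f = f \<otimes>\<^bsub>A\<^esub> \<one>\<^bsub>A\<^esub> \<ominus>\<^bsub>A\<^esub> f \<otimes>\<^bsub>A\<^esub> e"
    by (simp only: a_minus_def alg.r_distr alg.r_minus f_closed[unfolded a_minus_def] alg.one_closed
        e_closed M.a_inv_closed)
  then show "f \<otimes>\<^bsub>A\<^esub> f = f" unfolding fe by (simp add: a_minus_def)
qed

lemma peirce_cancel:
  assumes "x \<in> carrier A"
  shows "f \<otimes>\<^bsub>A\<^esub> (f \<otimes>\<^bsub>A\<^esub> x) = f \<otimes>\<^bsub>A\<^esub> x" "f \<otimes>\<^bsub>A\<^esub> (e \<otimes>\<^bsub>A\<^esub> x) = \<zero>\<^bsub>A\<^esub>"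
    "e \<otimes>\<^bsub>A\<^esub> (f \<otimes>\<^bsub>A\<^esub> x) = \<zero>\<^bsub>A\<^esub>" "e \<otimes>\<^bsub>A\<^esub> (e \<otimes>\<^bsub>A\<^esub> x) = e \<otimes>\<^bsub>A\<^esub> x"
  using assms by (simp_all only: alg.m_assoc[symmetric] peirce_idempotents e_idem f_closed e_closed
      alg.l_null)

lemmas peirce_simps = peirce_idempotents(1-3) e_idem peirce_cancel

lemma peirce_left: "x \<in> carrier A \<Longrightarrow> f \<otimes>\<^bsub>A\<^esub> x \<oplus>\<^bsub>A\<^esub> e \<otimes>\<^bsub>A\<^esub> x = x"
  using alg.l_distr[of f e x] peirce_idempotents(4) by (metis alg.l_one e_closed f_closed)

lemma peirce_right: "x \<in> carrier A \<Longrightarrow> x \<otimes>\<^bsub>A\<^esub> f \<oplus>\<^bsub>A\<^esub> x \<otimes>\<^bsub>A\<^esub> e = x"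
  using alg.r_distr[of f e x] peirce_idempotents(4) by (metis alg.r_one e_closed f_closed)

lemma peirce_decomposition:
  assumes "x \<in> carrier A"
  shows "(f \<otimes>\<^bsub>A\<^esub> x \<otimes>\<^bsub>A\<^esub> f \<oplus>\<^bsub>A\<^esub> f \<otimes>\<^bsub>A\<^esub> x \<otimes>\<^bsub>A\<^esub> e) \<oplus>\<^bsub>A\<^esub>
    (e \<otimes>\<^bsub>A\<^esub> x \<otimes>\<^bsub>A\<^esub> f \<oplus>\<^bsub>A\<^esub> e \<otimes>\<^bsub>A\<^esub> x \<otimes>\<^bsub>A\<^esub> e) = x"
  using assms peirce_left[of x] peirce_right[of "f \<otimes>\<^bsub>A\<^esub> x"] peirce_right[of "e \<otimes>\<^bsub>A\<^esub> x"]
  by (metis alg.m_closed e_closed f_closed)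

lemma peirce_mult:
  assumes "x \<in> carrier A" "y \<in> carrier A" "p \<in> carrier A" "q \<in> carrier A"
  shows "p \<otimes>\<^bsub>A\<^esub> (x \<otimes>\<^bsub>A\<^esub> y) \<otimes>\<^bsub>A\<^esub> q =
    (p \<otimes>\<^bsub>A\<^esub> x \<otimes>\<^bsub>A\<^esub> f) \<otimes>\<^bsub>A\<^esub> (f \<otimes>\<^bsub>A\<^esub> y \<otimes>\<^bsub>A\<^esub> q) \<oplus>\<^bsub>A\<^esub> (p \<otimes>\<^bsub>A\<^esub> x \<otimes>\<^bsub>A\<^esub> e) \<otimes>\<^bsub>A\<^esub> (e \<otimes>\<^bsub>A\<^esub> y \<otimes>\<^bsub>A\<^esub> q)"
proof -
  have "p \<otimes>\<^bsub>A\<^esub> (x \<otimes>\<^bsub>A\<^esub> y) \<otimes>\<^bsub>A\<^esub> q = (p \<otimes>\<^bsub>A\<^esub> x) \<otimes>\<^bsub>A\<^esub> (f \<otimes>\<^bsub>A\<^esub> (y \<otimes>\<^bsub>A\<^esub> q) \<oplus>\<^bsub>A\<^esub> e \<otimes>\<^bsub>A\<^esub> (y \<otimes>\<^bsub>A\<^esub> q))"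
    using assms by (subst peirce_left) (simp_all add: alg.m_assoc)
  also have "\<dots> = (p \<otimes>\<^bsub>A\<^esub> x) \<otimes>\<^bsub>A\<^esub> (f \<otimes>\<^bsub>A\<^esub> (f \<otimes>\<^bsub>A\<^esub> (y \<otimes>\<^bsub>A\<^esub> q))) \<oplus>\<^bsub>A\<^esub> (p \<otimes>\<^bsub>A\<^esub> x) \<otimes>\<^bsub>A\<^esub> (e \<otimes>\<^bsub>A\<^esub> (e \<otimes>\<^bsub>A\<^esub> (y \<otimes>\<^bsub>A\<^esub> q)))"
    using assms by (simp add: peirce_cancel alg.r_distr)
  finally show ?thesis using assms by (simp add: alg.m_assoc)
qed

lemma hcomp_corner:
  assumes "x \<in> hcomp A n" "p \<in> hcomp A 0" "q \<in> hcomp A 0"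
  shows "p \<otimes>\<^bsub>A\<^esub> x \<otimes>\<^bsub>A\<^esub> q \<in> hcomp A n"
  using hcomp_mult[OF hcomp_mult[OF assms(2,1)] assms(3)] by simp

lemma hcomp_iff_corners:
  assumes "x \<in> carrier A"
  shows "x \<in> hcomp A n \<longleftrightarrow> f \<otimes>\<^bsub>A\<^esub> x \<otimes>\<^bsub>A\<^esub> f \<in> hcomp A n \<and> f \<otimes>\<^bsub>A\<^esub> x \<otimes>\<^bsub>A\<^esub> e \<in> hcomp A n \<and>
    e \<otimes>\<^bsub>A\<^esub> x \<otimes>\<^bsub>A\<^esub> f \<in> hcomp A n \<and> e \<otimes>\<^bsub>A\<^esub> x \<otimes>\<^bsub>A\<^esub> e \<in> hcomp A n"
  using peirce_decomposition[OF assms] hcomp_add hcomp_corner e_hcomp f_hcomp by metis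

lemma hpart_corner:
  assumes "x \<in> carrier A" "p \<in> hcomp A 0" "q \<in> hcomp A 0"
  shows "hpart A (p \<otimes>\<^bsub>A\<^esub> x \<otimes>\<^bsub>A\<^esub> q) n = p \<otimes>\<^bsub>A\<^esub> hpart A x n \<otimes>\<^bsub>A\<^esub> q"
  using assms hpart_mult_right[OF assms(3), of "p \<otimes>\<^bsub>A\<^esub> x" n] hpart_mult_left[OF assms(2,1), of n]
    hcomp_closed by simp

end

text \<open>The grading that the endomorphism algebra of \<open>(1 - e) A \<oplus> e A(1)\<close> induces on \<open>A\<close>.  Left
  multiplication by the corner \<open>f x e\<close> maps \<open>e A(1)\<close>, whose degree \<open>k\<close> part is \<open>e A\<^sub>k\<^sub>+\<^sub>1\<close>, into
  \<open>f A\<close>; it raises degrees by \<open>n\<close> exactly when it lies in \<open>A\<^sub>n\<^sub>-\<^sub>1\<close>.  The other three conditions arise in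
  the same way.\<close>

definition regrade :: "('k, 'a, 'c) graded_space_scheme \<Rightarrow> 'a \<Rightarrow> ('k, 'a, 'c) graded_space_scheme" where
  "regrade A e = (let f = \<one>\<^bsub>A\<^esub> \<ominus>\<^bsub>A\<^esub> e in
     A\<lparr>hcomp := \<lambda>n. {x \<in> carrier A.
       f \<otimes>\<^bsub>A\<^esub> x \<otimes>\<^bsub>A\<^esub> f \<in> hcomp A n \<and> f \<otimes>\<^bsub>A\<^esub> x \<otimes>\<^bsub>A\<^esub> e \<in> hcomp A (n - 1) \<and>
       e \<otimes>\<^bsub>A\<^esub> x \<otimes>\<^bsub>A\<^esub> f \<in> hcomp A (n + 1) \<and> e \<otimes>\<^bsub>A\<^esub> x \<otimes>\<^bsub>A\<^esub> e \<in> hcomp A n}\<rparr>)"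

lemma hcomp_update_structure:
  fixes A :: "('k, 'a, 'c) graded_space_scheme"
  shows "finsum (A\<lparr>hcomp := H\<rparr>) = finsum A" "a_inv (A\<lparr>hcomp := H\<rparr>) = a_inv A"
    "ring (A\<lparr>hcomp := H\<rparr>) = ring A" "module K (A\<lparr>hcomp := H\<rparr>) = module K A"
    "submodule S K (A\<lparr>hcomp := H\<rparr>) = submodule S K A"
proof -
  have fields: "carrier (A\<lparr>hcomp := H\<rparr>) = carrier A" "monoid.mult (A\<lparr>hcomp := H\<rparr>) = monoid.mult A"
    "\<one>\<^bsub>A\<lparr>hcomp := H\<rparr>\<^esub> = \<one>\<^bsub>A\<^esub>" "\<zero>\<^bsub>A\<lparr>hcomp := H\<rparr>\<^esub> = \<zero>\<^bsub>A\<^esub>" "add (A\<lparr>hcomp := H\<rparr>) = add A"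
    "smult (A\<lparr>hcomp := H\<rparr>) = smult A"
    by simp_all
  have group: "abelian_group (A\<lparr>hcomp := H\<rparr>) = abelian_group A"
    by (simp add: abelian_group_def abelian_monoid_def abelian_group_axioms_def)
  show "finsum (A\<lparr>hcomp := H\<rparr>) = finsum A" "a_inv (A\<lparr>hcomp := H\<rparr>) = a_inv A"
    by (simp_all add: fun_eq_iff finsum_def a_inv_def)
  have "Group.monoid (A\<lparr>hcomp := H\<rparr>) = Group.monoid A"
    unfolding Group.monoid_def fields ..
  then show "ring (A\<lparr>hcomp := H\<rparr>) = ring A"
    unfolding ring_def group ring_axioms_def fields by simp
  show "module K (A\<lparr>hcomp := H\<rparr>) = module K A"
    unfolding module_def group module_axioms_def fields ..
  show "submodule S K (A\<lparr>hcomp := H\<rparr>) = submodule S K A"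
    unfolding submodule_def submodule_axioms_def fields ..
qed

lemma regrade_structure [simp]:
  "carrier (regrade A e) = carrier A" "monoid.mult (regrade A e) = monoid.mult A"
  "\<one>\<^bsub>regrade A e\<^esub> = \<one>\<^bsub>A\<^esub>" "\<zero>\<^bsub>regrade A e\<^esub> = \<zero>\<^bsub>A\<^esub>" "add (regrade A e) = add A"
  "smult (regrade A e) = smult A" "finsum (regrade A e) = finsum A" "a_inv (regrade A e) = a_inv A"
  "ring (regrade A e) = ring A" "module K (regrade A e) = module K A"
  "submodule S K (regrade A e) = submodule S K A"
  by (simp_all add: regrade_def Let_def hcomp_update_structure)

lemma hcomp_regrade:
  "hcomp (regrade A e) n = {x \<in> carrier A.
    (\<one>\<^bsub>A\<^esub> \<ominus>\<^bsub>A\<^esub> e) \<otimes>\<^bsub>A\<^esub> x \<otimes>\<^bsub>A\<^esub> (\<one>\<^bsub>A\<^esub> \<ominus>\<^bsub>A\<^esub> e) \<in> hcomp A n \<and>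
    (\<one>\<^bsub>A\<^esub> \<ominus>\<^bsub>A\<^esub> e) \<otimes>\<^bsub>A\<^esub> x \<otimes>\<^bsub>A\<^esub> e \<in> hcomp A (n - 1) \<and>
    e \<otimes>\<^bsub>A\<^esub> x \<otimes>\<^bsub>A\<^esub> (\<one>\<^bsub>A\<^esub> \<ominus>\<^bsub>A\<^esub> e) \<in> hcomp A (n + 1) \<and> e \<otimes>\<^bsub>A\<^esub> x \<otimes>\<^bsub>A\<^esub> e \<in> hcomp A n}"
  by (simp add: regrade_def Let_def)

context graded_algebra_idempotent
begin

text \<open>The part of degree \<open>n\<close> of \<open>x\<close> in the new grading is put together from the corners of its parts of
  degrees \<open>n\<close>, \<open>n - 1\<close> and \<open>n + 1\<close> in the old one; taking corners commutes with taking parts, as \<open>e\<close>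
  has degree \<open>0\<close>.\<close>

lemma graded_vector_space_regrade: "graded_vector_space K (regrade A e)"
proof (rule graded_vector_spaceI)
  let ?p = "\<lambda>x n. (f \<otimes>\<^bsub>A\<^esub> hpart A x n \<otimes>\<^bsub>A\<^esub> f \<oplus>\<^bsub>A\<^esub> f \<otimes>\<^bsub>A\<^esub> hpart A x (n - 1) \<otimes>\<^bsub>A\<^esub> e) \<oplus>\<^bsub>A\<^esub>
    (e \<otimes>\<^bsub>A\<^esub> hpart A x (n + 1) \<otimes>\<^bsub>A\<^esub> f \<oplus>\<^bsub>A\<^esub> e \<otimes>\<^bsub>A\<^esub> hpart A x n \<otimes>\<^bsub>A\<^esub> e)"
  show "field K" by (rule field_axioms)
  show "module K (regrade A e)" by (simp add: module_axioms)
  show "submodule (hcomp (regrade A e) n) K (regrade A e)" for n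
    unfolding regrade_structure
    by (rule submoduleI)
      (auto simp: hcomp_regrade hcomp_zero hcomp_add hcomp_minus hcomp_smult alg.l_distr alg.r_distr
        alg.l_minus alg.r_minus smult_mult_left smult_mult_right)
  show "?p x n \<in> hcomp (regrade A e) n" if "x \<in> carrier (regrade A e)" for x n
  proof -
    have x: "x \<in> carrier A" using that by simp
    have "p \<otimes>\<^bsub>A\<^esub> (hpart A x k \<otimes>\<^bsub>A\<^esub> q) \<in> hcomp A k" if "p \<in> hcomp A 0" "q \<in> hcomp A 0" for p q k
      using hcomp_corner[OF hpart_hcomp[OF x] that] that x hcomp_closed by (simp add: alg.m_assoc)
    then show ?thesis
      using x e_hcomp f_hcomp
      by (simp add: hcomp_regrade alg.l_distr alg.r_distr alg.m_assoc peirce_simps)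
  qed
  show "?p (x \<oplus>\<^bsub>regrade A e\<^esub> y) n = ?p x n \<oplus>\<^bsub>regrade A e\<^esub> ?p y n"
    if "x \<in> carrier (regrade A e)" "y \<in> carrier (regrade A e)" for x y n
    using that by (simp add: hpart_add alg.l_distr alg.r_distr M.a_ac)
  show "?p x k = (if k = n then x else \<zero>\<^bsub>regrade A e\<^esub>)" if "x \<in> hcomp (regrade A e) n" for x n k
  proof -
    have x: "x \<in> carrier A" using that by (simp add: hcomp_regrade)
    have "f \<otimes>\<^bsub>A\<^esub> hpart A x k \<otimes>\<^bsub>A\<^esub> f = (if k = n then f \<otimes>\<^bsub>A\<^esub> x \<otimes>\<^bsub>A\<^esub> f else \<zero>\<^bsub>A\<^esub>)"
      "f \<otimes>\<^bsub>A\<^esub> hpart A x (k - 1) \<otimes>\<^bsub>A\<^esub> e = (if k = n then f \<otimes>\<^bsub>A\<^esub> x \<otimes>\<^bsub>A\<^esub> e else \<zero>\<^bsub>A\<^esub>)"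
      "e \<otimes>\<^bsub>A\<^esub> hpart A x (k + 1) \<otimes>\<^bsub>A\<^esub> f = (if k = n then e \<otimes>\<^bsub>A\<^esub> x \<otimes>\<^bsub>A\<^esub> f else \<zero>\<^bsub>A\<^esub>)"
      "e \<otimes>\<^bsub>A\<^esub> hpart A x k \<otimes>\<^bsub>A\<^esub> e = (if k = n then e \<otimes>\<^bsub>A\<^esub> x \<otimes>\<^bsub>A\<^esub> e else \<zero>\<^bsub>A\<^esub>)"
      using that by (simp_all only: hpart_corner[symmetric, OF x] e_hcomp f_hcomp)
        (auto simp: hcomp_regrade hpart_homogeneous)
    then show ?thesis using peirce_decomposition[OF x] by (simp)
  qed
  show "\<exists>I. finite I \<and> (\<forall>n. n \<notin> I \<longrightarrow> ?p x n = \<zero>\<^bsub>regrade A e\<^esub>) \<and>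
    (\<Oplus>\<^bsub>regrade A e\<^esub>n\<in>I. ?p x n) = x" if "x \<in> carrier (regrade A e)" for x
  proof -
    have x: "x \<in> carrier A" using that by simp
    define S where "S = {n. hpart A x n \<noteq> \<zero>\<^bsub>A\<^esub>}"
    define I where "I = S \<union> (\<lambda>n. n + 1) ` S \<union> (\<lambda>n. n - 1) ` S"
    have fin: "finite I" using hpart_finite[OF x] by (simp add: I_def S_def)
    have off: "hpart A x n = \<zero>\<^bsub>A\<^esub>" "hpart A x (n - 1) = \<zero>\<^bsub>A\<^esub>" "hpart A x (n + 1) = \<zero>\<^bsub>A\<^esub>"
      if "n \<notin> I" for n
    proof -
      have "n \<notin> S" "n - 1 \<notin> S" "n + 1 \<notin> S"
        using that image_eqI[of n "\<lambda>n. n + 1" "n - 1" S] image_eqI[of n "\<lambda>n. n - 1" "n + 1" S]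
        by (auto simp: I_def)
      then show "hpart A x n = \<zero>\<^bsub>A\<^esub>" "hpart A x (n - 1) = \<zero>\<^bsub>A\<^esub>" "hpart A x (n + 1) = \<zero>\<^bsub>A\<^esub>"
        by (simp_all add: S_def)
    qed
    have corner_sum: "(\<Oplus>\<^bsub>A\<^esub>n\<in>I. p \<otimes>\<^bsub>A\<^esub> hpart A x (n - d) \<otimes>\<^bsub>A\<^esub> q) = p \<otimes>\<^bsub>A\<^esub> x \<otimes>\<^bsub>A\<^esub> q"
      if "p \<in> carrier A" "q \<in> carrier A" "\<And>n. n \<notin> I \<Longrightarrow> hpart A x (n - d) = \<zero>\<^bsub>A\<^esub>" for p q d
    proof -
      have "(\<Oplus>\<^bsub>A\<^esub>n\<in>I. p \<otimes>\<^bsub>A\<^esub> hpart A x (n - d) \<otimes>\<^bsub>A\<^esub> q) = p \<otimes>\<^bsub>A\<^esub> (\<Oplus>\<^bsub>A\<^esub>n\<in>I. hpart A x (n - d)) \<otimes>\<^bsub>A\<^esub> q"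
        using x fin that(1,2) by (simp add: alg.finsum_rdistr alg.finsum_ldistr Pi_def)
      then show ?thesis using hpart_sum_shift[OF x fin that(3)] by simp
    qed
    have "(\<Oplus>\<^bsub>A\<^esub>n\<in>I. ?p x n) = (f \<otimes>\<^bsub>A\<^esub> x \<otimes>\<^bsub>A\<^esub> f \<oplus>\<^bsub>A\<^esub> f \<otimes>\<^bsub>A\<^esub> x \<otimes>\<^bsub>A\<^esub> e) \<oplus>\<^bsub>A\<^esub>
        (e \<otimes>\<^bsub>A\<^esub> x \<otimes>\<^bsub>A\<^esub> f \<oplus>\<^bsub>A\<^esub> e \<otimes>\<^bsub>A\<^esub> x \<otimes>\<^bsub>A\<^esub> e)"
      using x corner_sum[of f f 0] corner_sum[of f e 1] corner_sum[of e f "-1"] corner_sum[of e e 0] off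
      by (simp add: M.finsum_addf Pi_def)
    then show ?thesis
      using fin off peirce_decomposition[OF x] by (intro exI[of _ I]) simp
  qed
qed

text \<open>Multiplicativity of the new grading: in a product of corners the inner idempotents agree, so the
  shifts by \<open>1\<close> either cancel or add up to the shift of the outer corner.\<close>

lemma graded_algebra_regrade: "graded_algebra K (regrade A e)"
proof (intro graded_algebra.intro graded_algebra_axioms.intro)
  show "graded_vector_space K (regrade A e)" by (rule graded_vector_space_regrade)
  show "ring (regrade A e)" using alg.ring_axioms by simp
  show "\<one>\<^bsub>regrade A e\<^esub> \<in> hcomp (regrade A e) 0"
    using hcomp_zero e_hcomp f_hcomp
    by (simp add: hcomp_regrade peirce_simps alg.m_assoc)
  show "x \<otimes>\<^bsub>regrade A e\<^esub> y \<in> hcomp (regrade A e) (i + j)"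
    if "x \<in> hcomp (regrade A e) i" "y \<in> hcomp (regrade A e) j" for x y i j
  proof -
    have deg: "u \<otimes>\<^bsub>A\<^esub> v \<oplus>\<^bsub>A\<^esub> u' \<otimes>\<^bsub>A\<^esub> v' \<in> hcomp A n"
      if "u \<in> hcomp A r" "v \<in> hcomp A s" "u' \<in> hcomp A r'" "v' \<in> hcomp A s'"
        "n = r + s" "n = r' + s'" for u v u' v' r s r' s' n
      using that hcomp_add hcomp_mult by metis
    show ?thesis
      using that by (auto simp: hcomp_regrade peirce_mult intro!: deg)
  qed
qed (simp_all add: smult_mult_left smult_mult_right)

end

section \<open>Graded endomorphisms of a module that is free of rank one\<close>

text \<open>Let \<open>\<psi>\<close> identify \<open>A\<close> with the underlying ungraded module of \<open>M\<close>, whatever the grading of \<open>M\<close>.  An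
  \<open>A\<close>-linear endomorphism of \<open>M\<close> is left multiplication by the element that corresponds to the image of
  \<open>\<psi> 1\<close>, and it is homogeneous of degree \<open>l\<close> precisely if this element maps the transported grading
  \<open>l\<close> steps up.  If those elements form a grading \<open>A'\<close> of \<open>A\<close>, every element of \<open>A\<close> is the sum of its
  parts in \<open>A'\<close>, and so the finitely supported families of homogeneous endomorphisms are exactly the
  left multiplications by elements of \<open>A\<close>.

  The zero of the endomorphism algebra is recorded separately because homomorphisms of rings, as
  defined for records, need not say anything about the field \<open>zero\<close> of the target.\<close>

lemma graded_End_free_rank_one:
  fixes A :: "('k, 'a, 'c) graded_space_scheme" and M :: "('k, 'a, 'v) graded_module"
  assumes A': "graded_algebra K A'" "A' = A\<lparr>hcomp := H\<rparr>"
    and bij: "bij_betw \<psi> (carrier A) (carrier M)"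
    and zero: "\<psi> \<zero>\<^bsub>A\<^esub> = \<zero>\<^bsub>M\<^esub>"
    and add: "\<And>x y. \<lbrakk>x \<in> carrier A; y \<in> carrier A\<rbrakk> \<Longrightarrow> \<psi> (x \<oplus>\<^bsub>A\<^esub> y) = \<psi> x \<oplus>\<^bsub>M\<^esub> \<psi> y"
    and smult: "\<And>c x. \<lbrakk>c \<in> carrier K; x \<in> carrier A\<rbrakk> \<Longrightarrow> \<psi> (c \<odot>\<^bsub>A\<^esub> x) = c \<odot>\<^bsub>M\<^esub> \<psi> x"
    and ract: "\<And>x a. \<lbrakk>x \<in> carrier A; a \<in> carrier A\<rbrakk> \<Longrightarrow> \<psi> (x \<otimes>\<^bsub>A\<^esub> a) = \<psi> x \<triangleleft>\<^bsub>M\<^esub> a"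
    and hcomp_M: "\<And>n. hcomp M n \<subseteq> carrier M"
    and hcomp_A': "\<And>l x. x \<in> hcomp A' l \<longleftrightarrow> x \<in> carrier A \<and>
      (\<forall>n. \<forall>w\<in>carrier A. \<psi> w \<in> hcomp M n \<longrightarrow> \<psi> (x \<otimes>\<^bsub>A\<^esub> w) \<in> hcomp M (n + l))"
  shows "\<exists>h. h \<in> graded_algebra_iso K A' (graded_End A M) \<and> h \<zero>\<^bsub>A'\<^esub> = \<zero>\<^bsub>graded_End A M\<^esub>"
proof -
  interpret A': graded_algebra K A' by fact
  have A'_simps: "carrier A' = carrier A" "monoid.mult A' = monoid.mult A" "\<one>\<^bsub>A'\<^esub> = \<one>\<^bsub>A\<^esub>"
    "\<zero>\<^bsub>A'\<^esub> = \<zero>\<^bsub>A\<^esub>" "add A' = add A" "smult A' = smult A"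
    by (simp_all add: A'(2))
  \<comment> \<open>All computations take place in \<open>A'\<close>, whose operations are those of \<open>A\<close>.\<close>
  note [simp] = A'_simps(2-6)[symmetric]
  have carr: "carrier A = carrier A'" by (simp add: A'_simps)
  define \<phi> where "\<phi> = inv_into (carrier A') \<psi>"
  have \<psi>_closed: "\<psi> x \<in> carrier M" if "x \<in> carrier A'" for x
    using bij that by (auto simp: carr bij_betw_def)
  have \<phi>\<psi> [simp]: "\<phi> (\<psi> x) = x" if "x \<in> carrier A'" for x
    using bij that unfolding \<phi>_def carr by (rule bij_betw_inv_into_left)
  have \<psi>\<phi> [simp]: "\<psi> (\<phi> v) = v" if "v \<in> carrier M" for v
    using bij that unfolding \<phi>_def carr by (rule bij_betw_inv_into_right)
  have \<phi>_closed [simp]: "\<phi> v \<in> carrier A'" if "v \<in> carrier M" for v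
    using bij that unfolding \<phi>_def carr bij_betw_def by (metis inv_into_into)
  have \<psi>_add: "\<psi> (x \<oplus>\<^bsub>A'\<^esub> y) = \<psi> x \<oplus>\<^bsub>M\<^esub> \<psi> y" if "x \<in> carrier A'" "y \<in> carrier A'" for x y
    using add[of x y] that by (simp add: carr)
  have \<psi>_ract: "\<psi> (x \<otimes>\<^bsub>A'\<^esub> a) = \<psi> x \<triangleleft>\<^bsub>M\<^esub> a" if "x \<in> carrier A'" "a \<in> carrier A'" for x a
    using ract[of x a] that by (simp add: carr)
  have add_closed: "v \<oplus>\<^bsub>M\<^esub> w \<in> carrier M" if "v \<in> carrier M" "w \<in> carrier M" for v w
    using add[of "\<phi> v" "\<phi> w"] \<psi>_closed[of "\<phi> v \<oplus>\<^bsub>A'\<^esub> \<phi> w"] that by (simp add: carr)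
  have ract_closed: "v \<triangleleft>\<^bsub>M\<^esub> a \<in> carrier M" if "v \<in> carrier M" "a \<in> carrier A'" for v a
    using ract[of "\<phi> v" a] \<psi>_closed[of "\<phi> v \<otimes>\<^bsub>A'\<^esub> a"] that by (simp add: carr)
  have \<phi>_add: "\<phi> (v \<oplus>\<^bsub>M\<^esub> w) = \<phi> v \<oplus>\<^bsub>A'\<^esub> \<phi> w" if "v \<in> carrier M" "w \<in> carrier M" for v w
    using add[of "\<phi> v" "\<phi> w"] \<phi>\<psi>[of "\<phi> v \<oplus>\<^bsub>A'\<^esub> \<phi> w"] that by (simp add: carr)
  have \<phi>_ract: "\<phi> (v \<triangleleft>\<^bsub>M\<^esub> a) = \<phi> v \<otimes>\<^bsub>A'\<^esub> a" if "v \<in> carrier M" "a \<in> carrier A'" for v a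
    using ract[of "\<phi> v" a] \<phi>\<psi>[of "\<phi> v \<otimes>\<^bsub>A'\<^esub> a"] that by (simp add: carr)
  have \<psi>_inj: "x = y" if "\<psi> x = \<psi> y" "x \<in> carrier A'" "y \<in> carrier A'" for x y
    using that \<phi>\<psi> by metis
  have M_group: "abelian_group M"
  proof (rule abelian_groupI)
    show "\<zero>\<^bsub>M\<^esub> \<in> carrier M" using \<psi>_closed[of "\<zero>\<^bsub>A'\<^esub>"] zero by simp
    have transfer: "\<psi> (\<phi> u \<oplus>\<^bsub>A'\<^esub> \<phi> v) = u \<oplus>\<^bsub>M\<^esub> v" if "u \<in> carrier M" "v \<in> carrier M" for u v
      using add[of "\<phi> u" "\<phi> v"] that by (simp add: carr)
    show "v \<oplus>\<^bsub>M\<^esub> w = w \<oplus>\<^bsub>M\<^esub> v" if "v \<in> carrier M" "w \<in> carrier M" for v w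
      using transfer that A'.M.a_comm[of "\<phi> v" "\<phi> w"] by (metis \<phi>_closed)
    show "(u \<oplus>\<^bsub>M\<^esub> v) \<oplus>\<^bsub>M\<^esub> w = u \<oplus>\<^bsub>M\<^esub> (v \<oplus>\<^bsub>M\<^esub> w)"
      if "u \<in> carrier M" "v \<in> carrier M" "w \<in> carrier M" for u v w
      using that by (simp add: transfer[symmetric] A'.M.a_assoc \<psi>_closed)
    show "\<zero>\<^bsub>M\<^esub> \<oplus>\<^bsub>M\<^esub> v = v" if "v \<in> carrier M" for v
      using add[of "\<zero>\<^bsub>A'\<^esub>" "\<phi> v"] that zero by (simp add: carr)
    show "\<exists>w\<in>carrier M. w \<oplus>\<^bsub>M\<^esub> v = \<zero>\<^bsub>M\<^esub>" if "v \<in> carrier M" for v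
      using add[of "\<ominus>\<^bsub>A'\<^esub> \<phi> v" "\<phi> v"] that zero \<psi>_closed[of "\<ominus>\<^bsub>A'\<^esub> \<phi> v"]
      by (intro bexI[of _ "\<psi> (\<ominus>\<^bsub>A'\<^esub> \<phi> v)"]) (simp_all add: carr A'.M.l_neg)
  qed (rule add_closed)
  interpret M: abelian_group M by (rule M_group)
  define L where "L x = (\<lambda>v\<in>carrier M. \<psi> (x \<otimes>\<^bsub>A'\<^esub> \<phi> v))" for x
  have L_apply: "L x v = \<psi> (x \<otimes>\<^bsub>A'\<^esub> \<phi> v)" if "v \<in> carrier M" for x v
    using that by (simp add: L_def)
  have L_closed: "L x v \<in> carrier M" if "x \<in> carrier A'" "v \<in> carrier M" for x v
    using that by (simp add: L_apply \<psi>_closed)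
  have L_hom: "L x \<in> graded_hom A M (shift l M)" if "x \<in> hcomp A' l" for x l
  proof -
    have x: "x \<in> carrier A'" using that A'.hcomp_closed by blast
    have "L x v \<in> hcomp M (n + l)" if "v \<in> hcomp M n" for v n
      using that \<open>x \<in> hcomp A' l\<close> hcomp_M[of n] \<phi>_closed[of v]
      by (subst L_apply) (auto simp: hcomp_A' carr)
    then have "\<forall>n. L x ` hcomp M n \<subseteq> hcomp M (n + l)" by blast
    moreover have "L x \<in> carrier M \<rightarrow>\<^sub>E carrier M"
      unfolding L_def using x by (auto simp: \<psi>_closed)
    ultimately show ?thesis
      using x by (simp add: graded_hom_def shift_def L_apply \<phi>_add \<phi>_ract add_closed ract_closed carr
          A'.alg.r_distr A'.alg.m_assoc[symmetric] \<psi>_add \<psi>_ract)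
  qed
  have hom_L: "\<phi> (F (\<psi> \<one>\<^bsub>A'\<^esub>)) \<in> hcomp A' l" "L (\<phi> (F (\<psi> \<one>\<^bsub>A'\<^esub>))) = F"
    if "F \<in> graded_hom A M (shift l M)" for F l
  proof -
    let ?x = "\<phi> (F (\<psi> \<one>\<^bsub>A'\<^esub>))"
    have F: "F \<in> carrier M \<rightarrow>\<^sub>E carrier M"
      "\<And>v a. \<lbrakk>v \<in> carrier M; a \<in> carrier A'\<rbrakk> \<Longrightarrow> F (v \<triangleleft>\<^bsub>M\<^esub> a) = F v \<triangleleft>\<^bsub>M\<^esub> a"
      "\<And>n v. v \<in> hcomp M n \<Longrightarrow> F v \<in> hcomp M (n + l)"
      using that by (auto simp: graded_hom_def shift_def carr image_subset_iff)
    have gen: "\<psi> \<one>\<^bsub>A'\<^esub> \<in> carrier M" by (simp add: \<psi>_closed)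
    then have Fgen: "F (\<psi> \<one>\<^bsub>A'\<^esub>) \<in> carrier M" using F(1) by blast
    then have x: "?x \<in> carrier A'" by simp
    have F_eq: "F (\<psi> w) = \<psi> (?x \<otimes>\<^bsub>A'\<^esub> w)" if "w \<in> carrier A'" for w
    proof -
      have "F (\<psi> w) = F (\<psi> \<one>\<^bsub>A'\<^esub> \<triangleleft>\<^bsub>M\<^esub> w)"
        using \<psi>_ract[of "\<one>\<^bsub>A'\<^esub>" w] that by simp
      also have "\<dots> = \<psi> ?x \<triangleleft>\<^bsub>M\<^esub> w" using F(2)[OF gen that] Fgen by simp
      also have "\<dots> = \<psi> (?x \<otimes>\<^bsub>A'\<^esub> w)" using \<psi>_ract[OF x that] by simp
      finally show ?thesis .
    qed
    show "?x \<in> hcomp A' l"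
      unfolding hcomp_A' A'_simps(2)[symmetric] carr using x F(3) by (metis F_eq)
    show "L ?x = F"
    proof
      show "L ?x v = F v" for v
        using F_eq[of "\<phi> v"] F(1) by (cases "v \<in> carrier M") (auto simp: L_def)
    qed
  qed
  have L_inj: "x = y" if "L x = L y" "x \<in> carrier A'" "y \<in> carrier A'" for x y
    using fun_cong[OF that(1), of "\<psi> \<one>\<^bsub>A'\<^esub>"] that(2,3) \<psi>_inj by (simp add: L_apply \<psi>_closed)
  have L_zero: "L \<zero>\<^bsub>A'\<^esub> = zero_map M M"
    using zero by (auto simp: L_def zero_map_def)
  have L_zero_iff: "L x = zero_map M M \<longleftrightarrow> x = \<zero>\<^bsub>A'\<^esub>" if "x \<in> carrier A'" for x
    using L_inj[of x "\<zero>\<^bsub>A'\<^esub>"] L_zero that by auto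
  let ?\<theta> = "\<lambda>x l. L (hpart A' x l)"
  let ?E = "graded_End A M"
  have \<theta>_closed: "?\<theta> x \<in> carrier ?E" if "x \<in> carrier A'" for x
    using that L_hom[OF A'.hpart_hcomp[OF that]] A'.hpart_finite[OF that]
    by (simp add: graded_End_def L_zero_iff)
  have \<theta>_homogeneous: "?\<theta> x l = (if l = n then L x else zero_map M M)" if "x \<in> hcomp A' n" for x n l
    using A'.hpart_homogeneous[OF that] L_zero by simp
  have "?\<theta> \<in> ring_iso A' ?E"
  proof (rule ring_iso_memI)
    show "?\<theta> x \<in> carrier ?E" if "x \<in> carrier A'" for x
      by (rule \<theta>_closed[OF that])
    show "?\<theta> (x \<otimes>\<^bsub>A'\<^esub> y) = ?\<theta> x \<otimes>\<^bsub>?E\<^esub> ?\<theta> y" if x: "x \<in> carrier A'" and y: "y \<in> carrier A'" for x y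
    proof
      fix l
      let ?S = "{i. hpart A' x i \<noteq> \<zero>\<^bsub>A'\<^esub>}"
      have S: "finite ?S" by (rule A'.hpart_finite[OF x])
      have "L (hpart A' (x \<otimes>\<^bsub>A'\<^esub> y) l) v = (\<Oplus>\<^bsub>M\<^esub>i\<in>?S. ?\<theta> x i (?\<theta> y (l - i) v))"
        if v: "v \<in> carrier M" for v
      proof -
        have "L (hpart A' (x \<otimes>\<^bsub>A'\<^esub> y) l) v =
            \<psi> ((\<Oplus>\<^bsub>A'\<^esub>i\<in>?S. hpart A' x i \<otimes>\<^bsub>A'\<^esub> hpart A' y (l - i)) \<otimes>\<^bsub>A'\<^esub> \<phi> v)"
          using A'.hpart_mult[OF x y S, of l] v by (simp add: L_apply)
        also have "\<dots> = \<psi> (\<Oplus>\<^bsub>A'\<^esub>i\<in>?S. hpart A' x i \<otimes>\<^bsub>A'\<^esub> hpart A' y (l - i) \<otimes>\<^bsub>A'\<^esub> \<phi> v)"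
          using x y v S by (simp add: A'.alg.finsum_ldistr Pi_def)
        also have "\<dots> = (\<Oplus>\<^bsub>M\<^esub>i\<in>?S. \<psi> (hpart A' x i \<otimes>\<^bsub>A'\<^esub> hpart A' y (l - i) \<otimes>\<^bsub>A'\<^esub> \<phi> v))"
          by (rule finsum_additive_map(2)[OF A'.M.abelian_group_axioms M_group])
            (use x y v S add in \<open>auto simp: \<psi>_closed carr\<close>)
        also have "\<dots> = (\<Oplus>\<^bsub>M\<^esub>i\<in>?S. ?\<theta> x i (?\<theta> y (l - i) v))"
          using x y v by (simp add: L_apply \<psi>_closed A'.alg.m_assoc)
        finally show ?thesis .
      qed
      moreover have "{i. ?\<theta> x i \<noteq> zero_map M M} = ?S" using x by (simp add: L_zero_iff)
      ultimately have "L (hpart A' (x \<otimes>\<^bsub>A'\<^esub> y) l) v = (?\<theta> x \<otimes>\<^bsub>?E\<^esub> ?\<theta> y) l v" for v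
        by (cases "v \<in> carrier M") (simp_all add: graded_End_def, simp add: L_def)
      then show "?\<theta> (x \<otimes>\<^bsub>A'\<^esub> y) l = (?\<theta> x \<otimes>\<^bsub>?E\<^esub> ?\<theta> y) l" by (rule ext)
    qed
    show "?\<theta> (x \<oplus>\<^bsub>A'\<^esub> y) = ?\<theta> x \<oplus>\<^bsub>?E\<^esub> ?\<theta> y" if x: "x \<in> carrier A'" and y: "y \<in> carrier A'" for x y
      using x y add by (auto simp: graded_End_def L_def fun_eq_iff A'.hpart_add A'.alg.l_distr carr)
    show "?\<theta> \<one>\<^bsub>A'\<^esub> = \<one>\<^bsub>?E\<^esub>"
      using \<theta>_homogeneous[OF A'.hcomp_one]
      by (auto simp: graded_End_def fun_eq_iff L_def)
    show "bij_betw ?\<theta> (carrier A') (carrier ?E)"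
    proof (rule bij_betw_imageI)
      show "inj_on ?\<theta> (carrier A')"
      proof (rule inj_onI)
        fix x y assume xy: "x \<in> carrier A'" "y \<in> carrier A'" "?\<theta> x = ?\<theta> y"
        have "hpart A' x n = hpart A' y n" for n
          using L_inj[OF fun_cong[OF xy(3)]] xy(1,2) by simp
        then show "x = y" using A'.hpart_eqI xy(1,2) by blast
      qed
      show "?\<theta> ` carrier A' = carrier ?E"
      proof
        show "?\<theta> ` carrier A' \<subseteq> carrier ?E" using \<theta>_closed by blast
        show "carrier ?E \<subseteq> ?\<theta> ` carrier A'"
        proof
          fix F assume "F \<in> carrier ?E"
          then have F: "F l \<in> graded_hom A M (shift l M)" "finite {l. F l \<noteq> zero_map M M}" for l
            by (auto simp: graded_End_def)
          define p where "p l = \<phi> (F l (\<psi> \<one>\<^bsub>A'\<^esub>))" for l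
          have p: "p l \<in> hcomp A' l" "L (p l) = F l" for l
            using hom_L[OF F(1)] by (simp_all add: p_def)
          have p_closed: "p l \<in> carrier A'" for l using p(1) A'.hcomp_closed by blast
          let ?S = "{l. F l \<noteq> zero_map M M}"
          have off: "p l = \<zero>\<^bsub>A'\<^esub>" if "l \<notin> ?S" for l
            using that p(2)[of l] L_zero_iff[OF p_closed] by simp
          have parts: "hpart A' (\<Oplus>\<^bsub>A'\<^esub>l\<in>?S. p l) = p"
            by (rule A'.hpart_unique[OF p(1) F(2) off refl])
          have eq: "?\<theta> (\<Oplus>\<^bsub>A'\<^esub>l\<in>?S. p l) = F" unfolding parts p(2) ..
          have "(\<Oplus>\<^bsub>A'\<^esub>l\<in>?S. p l) \<in> carrier A'"
            using p_closed by (intro A'.M.finsum_closed) auto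
          then show "F \<in> ?\<theta> ` carrier A'" by (rule image_eqI[where f = ?\<theta>, OF eq[symmetric]])
        qed
      qed
    qed
  qed
  moreover have "?\<theta> (c \<odot>\<^bsub>A'\<^esub> x) = c \<odot>\<^bsub>?E\<^esub> ?\<theta> x" if c: "c \<in> carrier K" and x: "x \<in> carrier A'" for c x
    using c x smult
    by (auto simp: graded_End_def L_def fun_eq_iff A'.hpart_smult A'.smult_mult_left carr)
  moreover have "?\<theta> ` hcomp A' n = hcomp ?E n" for n
  proof
    show "?\<theta> ` hcomp A' n \<subseteq> hcomp ?E n"
      using \<theta>_homogeneous L_hom by (auto simp: graded_End_def)
    show "hcomp ?E n \<subseteq> ?\<theta> ` hcomp A' n"
    proof
      fix F assume "F \<in> hcomp ?E n"
      then have F: "F n \<in> graded_hom A M (shift n M)" "\<And>l. l \<noteq> n \<Longrightarrow> F l = zero_map M M"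
        by (auto simp: graded_End_def)
      have eq: "?\<theta> (\<phi> (F n (\<psi> \<one>\<^bsub>A'\<^esub>))) = F"
        using \<theta>_homogeneous[OF hom_L(1)[OF F(1)]] hom_L(2)[OF F(1)] F(2) by auto
      show "F \<in> ?\<theta> ` hcomp A' n" 
        by (rule image_eqI[where f = ?\<theta>, OF eq[symmetric] hom_L(1)[OF F(1)]])
    qed
  qed
  ultimately have "?\<theta> \<in> graded_algebra_iso K A' ?E"
    unfolding graded_algebra_iso_def by blast
  moreover have "?\<theta> \<zero>\<^bsub>A'\<^esub> = \<zero>\<^bsub>?E\<^esub>"
    unfolding A'.hpart_zero L_zero by (simp add: graded_End_def)
  ultimately show ?thesis by (intro exI[of _ ?\<theta>] conjI)
qed

section \<open>The endomorphism algebra of the quotient plus the shifted ideal\<close>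

context graded_algebra_idempotent
begin

abbreviation N :: "'a set" where "N \<equiv> principal_right_ideal A e"

lemma principal_right_ideal_idempotent: "N = {x \<in> carrier A. e \<otimes>\<^bsub>A\<^esub> x = x}"
  unfolding principal_right_ideal_def by (force simp: peirce_simps)

lemma principal_right_ideal_subgroup: "abelian_subgroup N A"
proof (rule abelian_subgroupI3)
  show "additive_subgroup N A"
    by (intro additive_subgroupI M.add.subgroupI)
      (auto simp: principal_right_ideal_idempotent alg.r_distr alg.r_minus)
qed (rule M.abelian_group_axioms)

text \<open>Since \<open>e A\<close> is the kernel of left multiplication by \<open>f\<close>, a coset is determined by the common value
  \<open>f y\<close> of its members \<open>y\<close>.\<close>

lemma coset_idempotent:
  assumes "w \<in> carrier A"
  shows "N +>\<^bsub>A\<^esub> w = {y \<in> carrier A. f \<otimes>\<^bsub>A\<^esub> y = f \<otimes>\<^bsub>A\<^esub> w}"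
proof
  have "f \<otimes>\<^bsub>A\<^esub> n = \<zero>\<^bsub>A\<^esub>" if "n \<in> N" for n
    using that peirce_cancel(2)[of n] by (simp add: principal_right_ideal_idempotent)
  then show "N +>\<^bsub>A\<^esub> w \<subseteq> {y \<in> carrier A. f \<otimes>\<^bsub>A\<^esub> y = f \<otimes>\<^bsub>A\<^esub> w}"
    using assms by (auto simp: a_r_coset_def' alg.r_distr principal_right_ideal_idempotent)
  show "{y \<in> carrier A. f \<otimes>\<^bsub>A\<^esub> y = f \<otimes>\<^bsub>A\<^esub> w} \<subseteq> N +>\<^bsub>A\<^esub> w"
  proof clarify
    fix y assume y: "y \<in> carrier A" "f \<otimes>\<^bsub>A\<^esub> y = f \<otimes>\<^bsub>A\<^esub> w"
    have "f \<otimes>\<^bsub>A\<^esub> (y \<ominus>\<^bsub>A\<^esub> w) = \<zero>\<^bsub>A\<^esub>"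
      using y assms by (simp add: a_minus_def[of A y] alg.r_distr alg.r_minus M.r_neg)
    then have "y \<ominus>\<^bsub>A\<^esub> w \<in> N"
      using peirce_left[of "y \<ominus>\<^bsub>A\<^esub> w"] y(1) assms by (simp add: principal_right_ideal_idempotent)
    moreover have "y = (y \<ominus>\<^bsub>A\<^esub> w) \<oplus>\<^bsub>A\<^esub> w"
      using y(1) assms by (simp add: a_minus_def M.a_assoc M.l_neg)
    ultimately show "y \<in> N +>\<^bsub>A\<^esub> w"
      unfolding a_r_coset_def' by blast
  qed
qed

lemma coset_eq_iff:
  assumes "v \<in> carrier A" "w \<in> carrier A"
  shows "N +>\<^bsub>A\<^esub> v = N +>\<^bsub>A\<^esub> w \<longleftrightarrow> f \<otimes>\<^bsub>A\<^esub> v = f \<otimes>\<^bsub>A\<^esub> w"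
  using assms by (auto simp: coset_idempotent)

text \<open>The scalar and right actions on cosets are unions over all representatives; a map that commutes
  with left multiplication by \<open>f\<close> respects cosets, so that one representative suffices.\<close>

lemma union_cosets:
  assumes w: "w \<in> carrier A"
    and g: "\<And>x. x \<in> carrier A \<Longrightarrow> g x \<in> carrier A" "\<And>x. x \<in> carrier A \<Longrightarrow> f \<otimes>\<^bsub>A\<^esub> g x = g (f \<otimes>\<^bsub>A\<^esub> x)"
  shows "(\<Union>x\<in>N +>\<^bsub>A\<^esub> w. N +>\<^bsub>A\<^esub> g x) = N +>\<^bsub>A\<^esub> g w"
proof -
  have "N +>\<^bsub>A\<^esub> g x = N +>\<^bsub>A\<^esub> g w" if "x \<in> N +>\<^bsub>A\<^esub> w" for x
    using that w g by (auto simp: coset_idempotent)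
  moreover have "w \<in> N +>\<^bsub>A\<^esub> w" using w by (simp add: coset_idempotent)
  ultimately show ?thesis by blast
qed

lemma regular_module_cosets:
  "a_r_coset (regular_module A) = a_r_coset A" "a_rcosets\<^bsub>regular_module A\<^esub> S = a_rcosets\<^bsub>A\<^esub> S"
  "set_add (regular_module A) = set_add A"
  by (simp_all add: regular_module_def fun_eq_iff a_r_coset_def' A_RCOSETS_def' set_add_def')

abbreviation P where "P \<equiv> quotient_plus_shifted_ideal A e"

lemma quotient_plus_shifted_ideal_structure:
  "carrier P = (a_rcosets\<^bsub>A\<^esub> N) \<times> N"
  "\<zero>\<^bsub>P\<^esub> = (N, \<zero>\<^bsub>A\<^esub>)"
  "p \<oplus>\<^bsub>P\<^esub> q = (fst p <+>\<^bsub>A\<^esub> fst q, snd p \<oplus>\<^bsub>A\<^esub> snd q)"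
  "c \<odot>\<^bsub>P\<^esub> p = (\<Union>x\<in>fst p. N +>\<^bsub>A\<^esub> (c \<odot>\<^bsub>A\<^esub> x), c \<odot>\<^bsub>A\<^esub> snd p)"
  "p \<triangleleft>\<^bsub>P\<^esub> a = (\<Union>x\<in>fst p. N +>\<^bsub>A\<^esub> (x \<otimes>\<^bsub>A\<^esub> a), snd p \<otimes>\<^bsub>A\<^esub> a)"
  "hcomp P n = (\<lambda>x. N +>\<^bsub>A\<^esub> x) ` hcomp A n \<times> (hcomp A (n + 1) \<inter> N)"
  unfolding quotient_plus_shifted_ideal_def graded_direct_sum_def graded_quotient_def shift_def
    graded_submodule_def
  by (simp_all add: regular_module_cosets) (simp_all add: regular_module_def)

text \<open>The map \<open>w \<mapsto> (e A + w, e w)\<close> is the composite of the Peirce decomposition \<open>A = f A \<oplus> e A\<close> with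
  \<open>f A \<cong> A / e A\<close>.  Thus \<open>P\<close> is free of rank one up to its grading, and it only remains to recognise
  the induced grading of \<open>A\<close>.\<close>

lemma graded_End_quotient_plus_shifted_ideal:
  "\<exists>h. h \<in> graded_algebra_iso K (regrade A e) (graded_End A P) \<and>
    h \<zero>\<^bsub>regrade A e\<^esub> = \<zero>\<^bsub>graded_End A P\<^esub>"
proof -
  note rcos_sum = abelian_subgroup.a_rcos_sum[OF principal_right_ideal_subgroup]
  define \<psi> where "\<psi> w = (N +>\<^bsub>A\<^esub> w, e \<otimes>\<^bsub>A\<^esub> w)" for w
  have e_mem: "e \<otimes>\<^bsub>A\<^esub> w \<in> N" if "w \<in> carrier A" for w
    using that by (simp add: principal_right_ideal_idempotent peirce_simps)
  have \<psi>_hcomp: "\<psi> w \<in> hcomp P n \<longleftrightarrow> f \<otimes>\<^bsub>A\<^esub> w \<in> hcomp A n \<and> e \<otimes>\<^bsub>A\<^esub> w \<in> hcomp A (n + 1)"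
    if w: "w \<in> carrier A" for w n
  proof -
    have "N +>\<^bsub>A\<^esub> w \<in> (\<lambda>x. N +>\<^bsub>A\<^esub> x) ` hcomp A n \<longleftrightarrow> f \<otimes>\<^bsub>A\<^esub> w \<in> hcomp A n"
    proof
      assume "N +>\<^bsub>A\<^esub> w \<in> (\<lambda>x. N +>\<^bsub>A\<^esub> x) ` hcomp A n"
      then obtain x where x: "x \<in> hcomp A n" "N +>\<^bsub>A\<^esub> w = N +>\<^bsub>A\<^esub> x" by blast
      then have "f \<otimes>\<^bsub>A\<^esub> w = f \<otimes>\<^bsub>A\<^esub> x" using w hcomp_closed by (simp add: coset_eq_iff)
      then show "f \<otimes>\<^bsub>A\<^esub> w \<in> hcomp A n" using hcomp_mult[OF f_hcomp x(1)] by simp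
    next
      assume *: "f \<otimes>\<^bsub>A\<^esub> w \<in> hcomp A n"
      have "N +>\<^bsub>A\<^esub> w = N +>\<^bsub>A\<^esub> (f \<otimes>\<^bsub>A\<^esub> w)" using w by (simp add: coset_eq_iff peirce_simps)
      then show "N +>\<^bsub>A\<^esub> w \<in> (\<lambda>x. N +>\<^bsub>A\<^esub> x) ` hcomp A n" using * by blast
    qed
    then show ?thesis using e_mem[OF w] by (simp add: \<psi>_def quotient_plus_shifted_ideal_structure)
  qed
  show ?thesis
  proof (rule graded_End_free_rank_one)
    show "graded_algebra K (regrade A e)" by (rule graded_algebra_regrade)
    show "regrade A e = A\<lparr>hcomp := hcomp (regrade A e)\<rparr>" by (simp add: regrade_def Let_def)
    show "bij_betw \<psi> (carrier A) (carrier P)"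
    proof (rule bij_betw_imageI)
      show "inj_on \<psi> (carrier A)"
      proof (rule inj_onI)
        fix v w assume vw: "v \<in> carrier A" "w \<in> carrier A" "\<psi> v = \<psi> w"
        then have "f \<otimes>\<^bsub>A\<^esub> v = f \<otimes>\<^bsub>A\<^esub> w" "e \<otimes>\<^bsub>A\<^esub> v = e \<otimes>\<^bsub>A\<^esub> w"
          by (simp_all add: \<psi>_def coset_eq_iff)
        then show "v = w"
          using peirce_left[OF vw(1)] peirce_left[OF vw(2)] by metis
      qed
      show "\<psi> ` carrier A = carrier P"
      proof
        show "\<psi> ` carrier A \<subseteq> carrier P"
          using e_mem by (auto simp: \<psi>_def quotient_plus_shifted_ideal_structure A_RCOSETS_def')
        show "carrier P \<subseteq> \<psi> ` carrier A"
        proof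
          fix q assume "q \<in> carrier P"
          then obtain u v where uv: "q = (N +>\<^bsub>A\<^esub> u, v)" "u \<in> carrier A" "v \<in> carrier A" "e \<otimes>\<^bsub>A\<^esub> v = v"
            by (auto simp: quotient_plus_shifted_ideal_structure A_RCOSETS_def'
                principal_right_ideal_idempotent)
          have fv: "f \<otimes>\<^bsub>A\<^esub> v = \<zero>\<^bsub>A\<^esub>" using peirce_cancel(2)[OF uv(3)] uv(4) by simp
          let ?w = "f \<otimes>\<^bsub>A\<^esub> u \<oplus>\<^bsub>A\<^esub> v"
          have w: "?w \<in> carrier A" using uv(2,3) by simp
          have "f \<otimes>\<^bsub>A\<^esub> ?w = f \<otimes>\<^bsub>A\<^esub> u" "e \<otimes>\<^bsub>A\<^esub> ?w = v"
            by (simp_all add: alg.r_distr uv(2-4) fv peirce_cancel)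
          then have "\<psi> ?w = q"
            unfolding \<psi>_def uv(1) prod.inject coset_eq_iff[OF w uv(2)] by blast
          then show "q \<in> \<psi> ` carrier A" using w by blast
        qed
      qed
    qed
    show "\<psi> \<zero>\<^bsub>A\<^esub> = \<zero>\<^bsub>P\<^esub>"
      using M.a_coset_add_zero[of N, OF additive_subgroup.a_subset[OF
          abelian_subgroup.axioms(1)[OF principal_right_ideal_subgroup]]]
      by (simp add: \<psi>_def quotient_plus_shifted_ideal_structure)
    show "\<psi> (x \<oplus>\<^bsub>A\<^esub> y) = \<psi> x \<oplus>\<^bsub>P\<^esub> \<psi> y" if "x \<in> carrier A" "y \<in> carrier A" for x y
      using that rcos_sum[of x y]
      by (simp add: \<psi>_def quotient_plus_shifted_ideal_structure alg.r_distr)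
    show "\<psi> (c \<odot>\<^bsub>A\<^esub> x) = c \<odot>\<^bsub>P\<^esub> \<psi> x" if "c \<in> carrier K" "x \<in> carrier A" for c x
      using that union_cosets[of x "\<lambda>x. c \<odot>\<^bsub>A\<^esub> x"]
      by (simp add: \<psi>_def quotient_plus_shifted_ideal_structure smult_mult_right)
    show "\<psi> (x \<otimes>\<^bsub>A\<^esub> a) = \<psi> x \<triangleleft>\<^bsub>P\<^esub> a" if "x \<in> carrier A" "a \<in> carrier A" for x a
      using that union_cosets[of x "\<lambda>x. x \<otimes>\<^bsub>A\<^esub> a"]
      by (simp add: \<psi>_def quotient_plus_shifted_ideal_structure alg.m_assoc)
    show "hcomp P n \<subseteq> carrier P" for n
      using hcomp_closed by (auto simp: quotient_plus_shifted_ideal_structure A_RCOSETS_def')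
    show "x \<in> hcomp (regrade A e) l \<longleftrightarrow> x \<in> carrier A \<and>
        (\<forall>n. \<forall>w\<in>carrier A. \<psi> w \<in> hcomp P n \<longrightarrow> \<psi> (x \<otimes>\<^bsub>A\<^esub> w) \<in> hcomp P (n + l))" for l x
    proof (cases "x \<in> carrier A")
      case x: True
      show ?thesis
      proof
        assume "x \<in> hcomp (regrade A e) l"
        then have deg: "f \<otimes>\<^bsub>A\<^esub> x \<otimes>\<^bsub>A\<^esub> f \<in> hcomp A l" "f \<otimes>\<^bsub>A\<^esub> x \<otimes>\<^bsub>A\<^esub> e \<in> hcomp A (l - 1)"
          "e \<otimes>\<^bsub>A\<^esub> x \<otimes>\<^bsub>A\<^esub> f \<in> hcomp A (l + 1)" "e \<otimes>\<^bsub>A\<^esub> x \<otimes>\<^bsub>A\<^esub> e \<in> hcomp A l"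
          by (simp_all add: hcomp_regrade)
        have "\<psi> (x \<otimes>\<^bsub>A\<^esub> w) \<in> hcomp P (n + l)" if w: "w \<in> carrier A" and "\<psi> w \<in> hcomp P n" for n w
        proof -
          have w_deg: "f \<otimes>\<^bsub>A\<^esub> w \<in> hcomp A n" "e \<otimes>\<^bsub>A\<^esub> w \<in> hcomp A (n + 1)"
            using that by (simp_all add: \<psi>_hcomp)
          have split: "p \<otimes>\<^bsub>A\<^esub> (x \<otimes>\<^bsub>A\<^esub> w) = (p \<otimes>\<^bsub>A\<^esub> x \<otimes>\<^bsub>A\<^esub> f) \<otimes>\<^bsub>A\<^esub> (f \<otimes>\<^bsub>A\<^esub> w) \<oplus>\<^bsub>A\<^esub>
            (p \<otimes>\<^bsub>A\<^esub> x \<otimes>\<^bsub>A\<^esub> e) \<otimes>\<^bsub>A\<^esub> (e \<otimes>\<^bsub>A\<^esub> w)" if "p \<in> carrier A" for p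
            using peirce_mult[OF x w that alg.one_closed] that x w by simp
          show ?thesis
            using hcomp_add[OF hcomp_mult[OF deg(1) w_deg(1)], of "(f \<otimes>\<^bsub>A\<^esub> x \<otimes>\<^bsub>A\<^esub> e) \<otimes>\<^bsub>A\<^esub> (e \<otimes>\<^bsub>A\<^esub> w)"]
              hcomp_mult[OF deg(2) w_deg(2)]
              hcomp_add[OF hcomp_mult[OF deg(3) w_deg(1)], of "(e \<otimes>\<^bsub>A\<^esub> x \<otimes>\<^bsub>A\<^esub> e) \<otimes>\<^bsub>A\<^esub> (e \<otimes>\<^bsub>A\<^esub> w)"]
              hcomp_mult[OF deg(4) w_deg(2)] x w
            by (simp add: \<psi>_hcomp split add_ac)
        qed
        with x show "x \<in> carrier A \<and>
          (\<forall>n. \<forall>w\<in>carrier A. \<psi> w \<in> hcomp P n \<longrightarrow> \<psi> (x \<otimes>\<^bsub>A\<^esub> w) \<in> hcomp P (n + l))" by blast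
      next
        assume *: "x \<in> carrier A \<and>
          (\<forall>n. \<forall>w\<in>carrier A. \<psi> w \<in> hcomp P n \<longrightarrow> \<psi> (x \<otimes>\<^bsub>A\<^esub> w) \<in> hcomp P (n + l))"
        \<comment> \<open>The generators \<open>f\<close> and \<open>e\<close>, of degrees \<open>0\<close> and \<open>-1\<close>, test all four corners of \<open>x\<close>.\<close>
        have "\<psi> f \<in> hcomp P 0" "\<psi> e \<in> hcomp P (-1)"
          using e_hcomp f_hcomp hcomp_zero by (simp_all add: \<psi>_hcomp peirce_simps)
        then have "\<psi> (x \<otimes>\<^bsub>A\<^esub> f) \<in> hcomp P (0 + l)" "\<psi> (x \<otimes>\<^bsub>A\<^esub> e) \<in> hcomp P (-1 + l)"
          using * e_closed f_closed by blast+
        then show "x \<in> hcomp (regrade A e) l"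
          using x by (simp add: \<psi>_hcomp hcomp_regrade alg.m_assoc add.commute)
      qed
    qed (simp add: hcomp_regrade)
  qed
qed

end

section \<open>Coverings are graded algebras\<close>

text \<open>All \<open>m \<times> m\<close> matrices over \<open>A\<close>, without the degree conditions on the entries.  Coverings are
  subrings of it, and it contains the conjugating matrices below, which in general do not lie in
  the covering.\<close>

definition matrix_algebra ::
  "nat \<Rightarrow> ('k, 'a, 'c) graded_space_scheme \<Rightarrow> ('k, 'a mat) graded_space" where
  "matrix_algebra m A = (covering m A)\<lparr>carrier :=
     {X \<in> carrier_mat m m. \<forall>a<m. \<forall>b<m. X $$ (a, b) \<in> carrier A}\<rparr>"

lemma covering_eq_subalgebra:
  "covering m A = (matrix_algebra m A)\<lparr>carrier := carrier (covering m A)\<rparr>"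
  by (simp add: matrix_algebra_def)

lemma matrix_algebra_structure [simp]:
  "monoid.mult (matrix_algebra m A) = monoid.mult (covering m A)"
  "\<one>\<^bsub>matrix_algebra m A\<^esub> = \<one>\<^bsub>covering m A\<^esub>" "\<zero>\<^bsub>matrix_algebra m A\<^esub> = \<zero>\<^bsub>covering m A\<^esub>"
  "add (matrix_algebra m A) = add (covering m A)" "smult (matrix_algebra m A) = smult (covering m A)"
  by (simp_all add: matrix_algebra_def)

lemma matrix_algebra_dim:
  "X \<in> carrier (matrix_algebra m A) \<Longrightarrow> dim_row X = m"
  "X \<in> carrier (matrix_algebra m A) \<Longrightarrow> dim_col X = m"
  by (auto simp: matrix_algebra_def)

lemma matrix_algebra_entry:
  "\<lbrakk>X \<in> carrier (matrix_algebra m A); a < m; b < m\<rbrakk> \<Longrightarrow> X $$ (a, b) \<in> carrier A"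
  by (simp add: matrix_algebra_def)

lemma covering_entries:
  assumes "a < m" "b < m"
  shows "(X \<otimes>\<^bsub>covering m A\<^esub> Y) $$ (a, b) = (\<Oplus>\<^bsub>A\<^esub>c\<in>{..<m}. X $$ (a, c) \<otimes>\<^bsub>A\<^esub> Y $$ (c, b))"
    "\<one>\<^bsub>covering m A\<^esub> $$ (a, b) = (if a = b then \<one>\<^bsub>A\<^esub> else \<zero>\<^bsub>A\<^esub>)"
    "\<zero>\<^bsub>covering m A\<^esub> $$ (a, b) = \<zero>\<^bsub>A\<^esub>"
    "(X \<oplus>\<^bsub>covering m A\<^esub> Y) $$ (a, b) = X $$ (a, b) \<oplus>\<^bsub>A\<^esub> Y $$ (a, b)"
    "(c \<odot>\<^bsub>covering m A\<^esub> X) $$ (a, b) = c \<odot>\<^bsub>A\<^esub> X $$ (a, b)"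
  using assms by (simp_all add: covering_def)

lemma covering_dims:
  "dim_row (X \<otimes>\<^bsub>covering m A\<^esub> Y) = m" "dim_col (X \<otimes>\<^bsub>covering m A\<^esub> Y) = m"
  "dim_row \<one>\<^bsub>covering m A\<^esub> = m" "dim_col \<one>\<^bsub>covering m A\<^esub> = m"
  "dim_row \<zero>\<^bsub>covering m A\<^esub> = m" "dim_col \<zero>\<^bsub>covering m A\<^esub> = m"
  "dim_row (X \<oplus>\<^bsub>covering m A\<^esub> Y) = m" "dim_col (X \<oplus>\<^bsub>covering m A\<^esub> Y) = m"
  "dim_row (c \<odot>\<^bsub>covering m A\<^esub> X) = m" "dim_col (c \<odot>\<^bsub>covering m A\<^esub> X) = m"
  by (simp_all add: covering_def)

lemma matrix_algebraI:
  "\<lbrakk>dim_row X = m; dim_col X = m; \<And>a b. \<lbrakk>a < m; b < m\<rbrakk> \<Longrightarrow> X $$ (a, b) \<in> carrier A\<rbrakk>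
    \<Longrightarrow> X \<in> carrier (matrix_algebra m A)"
  by (auto simp: matrix_algebra_def)

lemma square_mat_eqI:
  "\<lbrakk>dim_row X = m; dim_col X = m; dim_row Y = m; dim_col Y = m;
    \<And>a b. \<lbrakk>a < m; b < m\<rbrakk> \<Longrightarrow> X $$ (a, b) = Y $$ (a, b)\<rbrakk> \<Longrightarrow> X = Y"
  by (rule eq_matI) auto

lemma (in abelian_monoid) finsum_delta:
  assumes "finite S" "a \<in> S" "x \<in> carrier G"
  shows "(\<Oplus>c\<in>S. if c = a then x else \<zero>) = x"
  using add.finprod_singleton[OF assms(2,1), of "\<lambda>_. x"] assms(3) by (simp add: eq_commute)

context graded_algebra
begin

lemmas mat_simps = covering_entries covering_dims matrix_algebra_entry matrix_algebra_dim

lemma matrix_mult_closed: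
  assumes "X \<in> carrier (matrix_algebra m A)" "Y \<in> carrier (matrix_algebra m A)"
  shows "X \<otimes>\<^bsub>covering m A\<^esub> Y \<in> carrier (matrix_algebra m A)"
  using assms by (intro matrix_algebraI) (auto simp: mat_simps intro!: M.finsum_closed)

lemma matrix_mult_assoc:
  assumes X: "X \<in> carrier (matrix_algebra m A)" and Y: "Y \<in> carrier (matrix_algebra m A)"
    and Z: "Z \<in> carrier (matrix_algebra m A)"
  shows "(X \<otimes>\<^bsub>covering m A\<^esub> Y) \<otimes>\<^bsub>covering m A\<^esub> Z = X \<otimes>\<^bsub>covering m A\<^esub> (Y \<otimes>\<^bsub>covering m A\<^esub> Z)"
proof (rule square_mat_eqI[where m = m])
  fix a b assume ab: "a < m" "b < m"
  let ?t = "\<lambda>c d. X $$ (a, d) \<otimes>\<^bsub>A\<^esub> Y $$ (d, c) \<otimes>\<^bsub>A\<^esub> Z $$ (c, b)"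
  have t: "?t c d \<in> carrier A" if "c < m" "d < m" for c d
    using that ab X Y Z by (simp add: mat_simps)
  have "((X \<otimes>\<^bsub>covering m A\<^esub> Y) \<otimes>\<^bsub>covering m A\<^esub> Z) $$ (a, b) =
      (\<Oplus>\<^bsub>A\<^esub>c\<in>{..<m}. (\<Oplus>\<^bsub>A\<^esub>d\<in>{..<m}. X $$ (a, d) \<otimes>\<^bsub>A\<^esub> Y $$ (d, c)) \<otimes>\<^bsub>A\<^esub> Z $$ (c, b))"
    unfolding covering_entries(1)[OF ab]
    by (rule M.finsum_cong') (use ab X Y Z in \<open>auto simp: mat_simps\<close>)
  also have "\<dots> = (\<Oplus>\<^bsub>A\<^esub>c\<in>{..<m}. \<Oplus>\<^bsub>A\<^esub>d\<in>{..<m}. ?t c d)"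
    using ab X Y Z t by (intro M.finsum_cong') (auto simp: mat_simps alg.finsum_ldistr Pi_def)
  also have "\<dots> = (\<Oplus>\<^bsub>A\<^esub>d\<in>{..<m}. \<Oplus>\<^bsub>A\<^esub>c\<in>{..<m}. ?t c d)"
    by (rule alg.finsum_finsum_swap) (use t in auto)
  also have "\<dots> = (\<Oplus>\<^bsub>A\<^esub>d\<in>{..<m}. \<Oplus>\<^bsub>A\<^esub>c\<in>{..<m}. X $$ (a, d) \<otimes>\<^bsub>A\<^esub> (Y $$ (d, c) \<otimes>\<^bsub>A\<^esub> Z $$ (c, b)))"
    using ab X Y Z by (intro M.finsum_cong') (auto simp: mat_simps alg.m_assoc intro!: M.finsum_cong')
  also have "\<dots> = (\<Oplus>\<^bsub>A\<^esub>d\<in>{..<m}. X $$ (a, d) \<otimes>\<^bsub>A\<^esub> (\<Oplus>\<^bsub>A\<^esub>c\<in>{..<m}. Y $$ (d, c) \<otimes>\<^bsub>A\<^esub> Z $$ (c, b)))"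
    using ab X Y Z by (intro M.finsum_cong') (auto simp: mat_simps alg.finsum_rdistr Pi_def)
  also have "\<dots> = (X \<otimes>\<^bsub>covering m A\<^esub> (Y \<otimes>\<^bsub>covering m A\<^esub> Z)) $$ (a, b)"
    unfolding covering_entries(1)[OF ab]
    by (rule M.finsum_cong') (use ab X Y Z in \<open>auto simp: mat_simps\<close>)
  finally show "((X \<otimes>\<^bsub>covering m A\<^esub> Y) \<otimes>\<^bsub>covering m A\<^esub> Z) $$ (a, b) =
      (X \<otimes>\<^bsub>covering m A\<^esub> (Y \<otimes>\<^bsub>covering m A\<^esub> Z)) $$ (a, b)" .
qed (simp_all add: mat_simps)

definition diag :: "nat \<Rightarrow> (nat \<Rightarrow> 'a) \<Rightarrow> 'a mat" where
  "diag m d = mat m m (\<lambda>(a, b). if a = b then d a else \<zero>\<^bsub>A\<^esub>)"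

lemma diag_closed:
  "(\<And>a. a < m \<Longrightarrow> d a \<in> carrier A) \<Longrightarrow> diag m d \<in> carrier (matrix_algebra m A)"
  by (rule matrix_algebraI) (auto simp: diag_def)

lemma diag_mult_left:
  assumes "X \<in> carrier (matrix_algebra m A)" "\<And>a. a < m \<Longrightarrow> d a \<in> carrier A" "a < m" "b < m"
  shows "(diag m d \<otimes>\<^bsub>covering m A\<^esub> X) $$ (a, b) = d a \<otimes>\<^bsub>A\<^esub> X $$ (a, b)"
proof -
  have "(diag m d \<otimes>\<^bsub>covering m A\<^esub> X) $$ (a, b) =
      (\<Oplus>\<^bsub>A\<^esub>c\<in>{..<m}. if c = a then d a \<otimes>\<^bsub>A\<^esub> X $$ (a, b) else \<zero>\<^bsub>A\<^esub>)"
    using assms by (simp add: covering_entries diag_def)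
      (intro M.finsum_cong', auto simp: mat_simps)
  then show ?thesis using assms by (simp add: M.finsum_delta mat_simps)
qed

lemma diag_mult_right:
  assumes "X \<in> carrier (matrix_algebra m A)" "\<And>a. a < m \<Longrightarrow> d a \<in> carrier A" "a < m" "b < m"
  shows "(X \<otimes>\<^bsub>covering m A\<^esub> diag m d) $$ (a, b) = X $$ (a, b) \<otimes>\<^bsub>A\<^esub> d b"
proof -
  have "(X \<otimes>\<^bsub>covering m A\<^esub> diag m d) $$ (a, b) =
      (\<Oplus>\<^bsub>A\<^esub>c\<in>{..<m}. if c = b then X $$ (a, b) \<otimes>\<^bsub>A\<^esub> d b else \<zero>\<^bsub>A\<^esub>)"
    using assms by (simp add: covering_entries diag_def)
      (intro M.finsum_cong', auto simp: mat_simps)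
  then show ?thesis using assms by (simp add: M.finsum_delta mat_simps)
qed

lemma one_eq_diag: "\<one>\<^bsub>covering m A\<^esub> = diag m (\<lambda>_. \<one>\<^bsub>A\<^esub>)"
  by (simp add: covering_def diag_def)

lemma abelian_group_matrix_algebra: "abelian_group (matrix_algebra m A)"
proof (rule abelian_groupI)
  fix X assume X: "X \<in> carrier (matrix_algebra m A)"
  show "\<exists>Y\<in>carrier (matrix_algebra m A). Y \<oplus>\<^bsub>matrix_algebra m A\<^esub> X = \<zero>\<^bsub>matrix_algebra m A\<^esub>"
  proof (rule bexI)
    let ?Y = "mat m m (\<lambda>(a, b). \<ominus>\<^bsub>A\<^esub> X $$ (a, b))"
    show "?Y \<oplus>\<^bsub>matrix_algebra m A\<^esub> X = \<zero>\<^bsub>matrix_algebra m A\<^esub>"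
      using X by (intro square_mat_eqI[where m = m]) (simp_all add: mat_simps M.l_neg)
    show "?Y \<in> carrier (matrix_algebra m A)"
      using X by (intro matrix_algebraI) (simp_all add: mat_simps)
  qed
qed (auto intro!: matrix_algebraI square_mat_eqI[where m = m] simp: mat_simps M.a_ac)

lemma ring_matrix_algebra: "ring (matrix_algebra m A)"
proof (rule ringI)
  show "abelian_group (matrix_algebra m A)" by (rule abelian_group_matrix_algebra)
  show "Group.monoid (matrix_algebra m A)"
  proof (rule monoidI)
    show one: "\<one>\<^bsub>matrix_algebra m A\<^esub> \<in> carrier (matrix_algebra m A)"
      by (simp add: one_eq_diag diag_closed)
    show "\<one>\<^bsub>matrix_algebra m A\<^esub> \<otimes>\<^bsub>matrix_algebra m A\<^esub> X = X"
      "X \<otimes>\<^bsub>matrix_algebra m A\<^esub> \<one>\<^bsub>matrix_algebra m A\<^esub> = X" if "X \<in> carrier (matrix_algebra m A)" for X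
      using that by (auto intro!: square_mat_eqI[where m = m]
          simp: one_eq_diag diag_mult_left diag_mult_right covering_dims matrix_algebra_dim
            matrix_algebra_entry)
  qed (simp_all add: matrix_mult_closed matrix_mult_assoc)
  show "(X \<oplus>\<^bsub>matrix_algebra m A\<^esub> Y) \<otimes>\<^bsub>matrix_algebra m A\<^esub> Z =
      X \<otimes>\<^bsub>matrix_algebra m A\<^esub> Z \<oplus>\<^bsub>matrix_algebra m A\<^esub> Y \<otimes>\<^bsub>matrix_algebra m A\<^esub> Z"
    "Z \<otimes>\<^bsub>matrix_algebra m A\<^esub> (X \<oplus>\<^bsub>matrix_algebra m A\<^esub> Y) =
      Z \<otimes>\<^bsub>matrix_algebra m A\<^esub> X \<oplus>\<^bsub>matrix_algebra m A\<^esub> Z \<otimes>\<^bsub>matrix_algebra m A\<^esub> Y"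
    if XYZ: "X \<in> carrier (matrix_algebra m A)" "Y \<in> carrier (matrix_algebra m A)"
      "Z \<in> carrier (matrix_algebra m A)" for X Y Z
  proof -
    have 1: "(\<Oplus>\<^bsub>A\<^esub>c\<in>{..<m}. (X \<oplus>\<^bsub>covering m A\<^esub> Y) $$ (a, c) \<otimes>\<^bsub>A\<^esub> Z $$ (c, b)) =
        (\<Oplus>\<^bsub>A\<^esub>c\<in>{..<m}. X $$ (a, c) \<otimes>\<^bsub>A\<^esub> Z $$ (c, b) \<oplus>\<^bsub>A\<^esub> Y $$ (a, c) \<otimes>\<^bsub>A\<^esub> Z $$ (c, b))"
      "(\<Oplus>\<^bsub>A\<^esub>c\<in>{..<m}. Z $$ (a, c) \<otimes>\<^bsub>A\<^esub> (X \<oplus>\<^bsub>covering m A\<^esub> Y) $$ (c, b)) =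
        (\<Oplus>\<^bsub>A\<^esub>c\<in>{..<m}. Z $$ (a, c) \<otimes>\<^bsub>A\<^esub> X $$ (c, b) \<oplus>\<^bsub>A\<^esub> Z $$ (a, c) \<otimes>\<^bsub>A\<^esub> Y $$ (c, b))"
      if "a < m" "b < m" for a b
      by (rule M.finsum_cong'; use that XYZ in \<open>auto simp: mat_simps alg.l_distr alg.r_distr\<close>)+
    show "(X \<oplus>\<^bsub>matrix_algebra m A\<^esub> Y) \<otimes>\<^bsub>matrix_algebra m A\<^esub> Z =
      X \<otimes>\<^bsub>matrix_algebra m A\<^esub> Z \<oplus>\<^bsub>matrix_algebra m A\<^esub> Y \<otimes>\<^bsub>matrix_algebra m A\<^esub> Z"
      "Z \<otimes>\<^bsub>matrix_algebra m A\<^esub> (X \<oplus>\<^bsub>matrix_algebra m A\<^esub> Y) =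
      Z \<otimes>\<^bsub>matrix_algebra m A\<^esub> X \<oplus>\<^bsub>matrix_algebra m A\<^esub> Z \<otimes>\<^bsub>matrix_algebra m A\<^esub> Y"
      using XYZ by (auto intro!: square_mat_eqI[where m = m]
          simp: mat_simps(1,4,6-) 1 M.finsum_addf Pi_def)
  qed
qed

lemma covering_carrier_iff:
  "X \<in> carrier (covering m A) \<longleftrightarrow> X \<in> carrier_mat m m \<and>
    (\<forall>a<m. \<forall>b<m. X $$ (a, b) \<in> hcomp_sum A {int m * l + int b - int a | l. True})"
  by (simp add: covering_def)

lemma covering_carrierI:
  assumes "dim_row X = m" "dim_col X = m"
    "\<And>a b. \<lbrakk>a < m; b < m\<rbrakk> \<Longrightarrow> X $$ (a, b) \<in> hcomp_sum A {int m * l + int b - int a | l. True}"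
  shows "X \<in> carrier (covering m A)"
  unfolding covering_carrier_iff using assms by blast

lemma covering_carrierD:
  assumes "X \<in> carrier (covering m A)"
  shows "dim_row X = m" "dim_col X = m"
    "\<lbrakk>a < m; b < m\<rbrakk> \<Longrightarrow> X $$ (a, b) \<in> hcomp_sum A {int m * l + int b - int a | l. True}"
    "\<lbrakk>a < m; b < m\<rbrakk> \<Longrightarrow> X $$ (a, b) \<in> carrier A"
  using assms hcomp_sum_closed unfolding covering_carrier_iff by blast+

lemma hcomp_coveringI:
  assumes "dim_row X = m" "dim_col X = m"
    "\<And>a b. \<lbrakk>a < m; b < m\<rbrakk> \<Longrightarrow> X $$ (a, b) \<in> hcomp A (int m * l + int b - int a)"
  shows "X \<in> hcomp (covering m A) l"
  using assms by (auto simp: covering_def)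

lemma hcomp_covering_iff:
  "X \<in> hcomp (covering m A) l \<longleftrightarrow> X \<in> carrier_mat m m \<and>
    (\<forall>a<m. \<forall>b<m. X $$ (a, b) \<in> hcomp A (int m * l + int b - int a))"
  by (simp add: covering_def)

lemma covering_carrier_subset: "carrier (covering m A) \<subseteq> carrier (matrix_algebra m A)"
  by (auto intro!: matrix_algebraI dest: covering_carrierD)

lemma matrix_minus_entry:
  assumes "X \<in> carrier (matrix_algebra m A)"
  shows "\<ominus>\<^bsub>matrix_algebra m A\<^esub> X = mat m m (\<lambda>(a, b). \<ominus>\<^bsub>A\<^esub> X $$ (a, b))"
proof -
  interpret Mat: ring "matrix_algebra m A" by (rule ring_matrix_algebra)
  show ?thesis
  proof (rule Mat.minus_equality)
    show "mat m m (\<lambda>(a, b). \<ominus>\<^bsub>A\<^esub> X $$ (a, b)) \<oplus>\<^bsub>matrix_algebra m A\<^esub> X = \<zero>\<^bsub>matrix_algebra m A\<^esub>"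
      using assms by (intro square_mat_eqI[where m = m]) (simp_all add: mat_simps M.l_neg)
    show "mat m m (\<lambda>(a, b). \<ominus>\<^bsub>A\<^esub> X $$ (a, b)) \<in> carrier (matrix_algebra m A)"
      using assms by (intro matrix_algebraI) (simp_all add: mat_simps)
  qed (rule assms)
qed

text \<open>Closure under products holds because the degrees \<open>m l + c - a\<close> and \<open>m l' + b - c\<close> of the factors
  add up to a degree of the form required at \<open>(a, b)\<close>.\<close>

lemma subring_covering: "subring (carrier (covering m A)) (matrix_algebra m A)"
proof -
  interpret Mat: ring "matrix_algebra m A" by (rule ring_matrix_algebra)
  let ?D = "\<lambda>a b. {int m * l + int b - int a | l. True}"
  show ?thesis
  proof (rule Mat.subringI)
    show "carrier (covering m A) \<subseteq> carrier (matrix_algebra m A)" by (rule covering_carrier_subset)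
    have "0 \<in> ?D a a" for a by (auto intro: exI[of _ 0])
    then show "\<one>\<^bsub>matrix_algebra m A\<^esub> \<in> carrier (covering m A)"
      using hcomp_subset_hcomp_sum[OF hcomp_one]
      by (intro covering_carrierI)
        (simp_all add: covering_entries covering_dims hcomp_sum_zero)
    show "\<ominus>\<^bsub>matrix_algebra m A\<^esub> X \<in> carrier (covering m A)" if "X \<in> carrier (covering m A)" for X
      using subsetD[OF covering_carrier_subset that] covering_carrierD[OF that]
      by (intro covering_carrierI) (simp_all add: matrix_minus_entry hcomp_sum_minus)
    show "X \<otimes>\<^bsub>matrix_algebra m A\<^esub> Y \<in> carrier (covering m A)"
      if XY: "X \<in> carrier (covering m A)" "Y \<in> carrier (covering m A)" for X Y
    proof -
      have "X $$ (a, c) \<otimes>\<^bsub>A\<^esub> Y $$ (c, b) \<in> hcomp_sum A (?D a b)" if "a < m" "b < m" "c < m" for a b c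
      proof (rule hcomp_sum_mult)
        show "X $$ (a, c) \<in> hcomp_sum A (?D a c)" "Y $$ (c, b) \<in> hcomp_sum A (?D c b)"
          using XY that by (simp_all add: covering_carrier_iff)
        fix i j assume "i \<in> ?D a c" "j \<in> ?D c b"
        then obtain l l' where "i = int m * l + int c - int a" "j = int m * l' + int b - int c" by blast
        then have "i + j = int m * (l + l') + int b - int a" by (simp add: algebra_simps)
        then show "i + j \<in> ?D a b" by blast
      qed
      then show ?thesis
        by (intro covering_carrierI) (auto simp: covering_entries covering_dims intro!: hcomp_sum_finsum)
    qed
    show "X \<oplus>\<^bsub>matrix_algebra m A\<^esub> Y \<in> carrier (covering m A)"
      if "X \<in> carrier (covering m A)" "Y \<in> carrier (covering m A)" for X Y
      using covering_carrierD[OF that(1)] covering_carrierD[OF that(2)]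
      by (intro covering_carrierI) (simp_all add: covering_entries covering_dims hcomp_sum_add)
  qed
qed

lemma ring_covering: "ring (covering m A)"
  by (subst covering_eq_subalgebra)
    (rule ring.subring_is_ring[OF ring_matrix_algebra subring_covering])

lemma hcomp_covering_carrier: "hcomp (covering m A) l \<subseteq> carrier (covering m A)"
proof
  fix X assume X: "X \<in> hcomp (covering m A) l"
  show "X \<in> carrier (covering m A)"
  proof (rule covering_carrierI)
    fix a b assume "a < m" "b < m"
    then have "X $$ (a, b) \<in> hcomp A (int m * l + int b - int a)"
      using X by (simp add: hcomp_covering_iff)
    then show "X $$ (a, b) \<in> hcomp_sum A {int m * l + int b - int a | l. True}"
      by (rule hcomp_subset_hcomp_sum) blast
  qed (use X in \<open>auto simp: hcomp_covering_iff\<close>)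
qed

lemma covering_minus:
  assumes "X \<in> carrier (covering m A)"
  shows "\<ominus>\<^bsub>covering m A\<^esub> X = mat m m (\<lambda>(a, b). \<ominus>\<^bsub>A\<^esub> X $$ (a, b))"
proof -
  interpret C: ring "covering m A" by (rule ring_covering)
  have X: "X \<in> carrier (matrix_algebra m A)" using assms covering_carrier_subset by blast
  show ?thesis
  proof (rule C.minus_equality)
    show "mat m m (\<lambda>(a, b). \<ominus>\<^bsub>A\<^esub> X $$ (a, b)) \<oplus>\<^bsub>covering m A\<^esub> X = \<zero>\<^bsub>covering m A\<^esub>"
      using X by (intro square_mat_eqI[where m = m]) (simp_all add: mat_simps M.l_neg)
    show "mat m m (\<lambda>(a, b). \<ominus>\<^bsub>A\<^esub> X $$ (a, b)) \<in> carrier (covering m A)"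
      using covering_carrierD[OF assms] by (intro covering_carrierI) (simp_all add: hcomp_sum_minus)
  qed (rule assms)
qed

lemma module_covering: "module K (covering m A)"
proof -
  interpret C: ring "covering m A" by (rule ring_covering)
  show ?thesis
  proof (rule moduleI)
    show "c \<odot>\<^bsub>covering m A\<^esub> X \<in> carrier (covering m A)"
      if "c \<in> carrier K" "X \<in> carrier (covering m A)" for c X
      using that(1) covering_carrierD[OF that(2)]
      by (intro covering_carrierI) (simp_all add: covering_entries covering_dims hcomp_sum_smult)
  qed (auto intro!: square_mat_eqI[where m = m] C.abelian_group_axioms is_cring
      simp: covering_entries covering_dims covering_carrierD smult_l_distr smult_r_distr smult_assoc1)
qed

lemma covering_entry_finsum:
  assumes "finite I" "\<And>i. i \<in> I \<Longrightarrow> F i \<in> carrier (covering m A)" "a < m" "b < m"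
  shows "(\<Oplus>\<^bsub>covering m A\<^esub>i\<in>I. F i) $$ (a, b) = (\<Oplus>\<^bsub>A\<^esub>i\<in>I. F i $$ (a, b))"
proof -
  interpret C: ring "covering m A" by (rule ring_covering)
  show ?thesis
    by (rule finsum_additive_map(2)[OF C.abelian_group_axioms M.abelian_group_axioms])
      (use assms covering_carrier_subset in \<open>auto simp: covering_entries intro: matrix_algebra_entry\<close>)
qed

text \<open>The part of degree \<open>n\<close> of a matrix has as its \<open>(a, b)\<close> entry the part of degree \<open>m n + b - a\<close> of the
  entry.  As \<open>m > 0\<close>, the index \<open>n\<close> can be read off from this degree; for \<open>m = 0\<close> it could not.\<close>

lemma graded_vector_space_covering:
  assumes m: "m > 0"
  shows "graded_vector_space K (covering m A)"
proof -
  interpret C: ring "covering m A" by (rule ring_covering)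
  interpret Cmod: module K "covering m A" by (rule module_covering)
  define p where "p X n = mat m m (\<lambda>(a, b). hpart A (X $$ (a, b)) (int m * n + int b - int a))"
    for X :: "'a mat" and n
  have entry: "X $$ (a, b) \<in> carrier A" if "X \<in> carrier (covering m A)" "a < m" "b < m" for X a b
    using covering_carrierD(4)[OF that] .
  have p_hcomp: "p X n \<in> hcomp (covering m A) n" if "X \<in> carrier (covering m A)" for X n
    using entry[OF that] by (intro hcomp_coveringI) (simp_all add: p_def hpart_hcomp)
  show ?thesis
  proof (rule graded_vector_spaceI)
    show "field K" by (rule field_axioms)
    show "module K (covering m A)" by (rule module_covering)
    show "submodule (hcomp (covering m A) n) K (covering m A)" for n
    proof (rule Cmod.submoduleI)
      show sub: "hcomp (covering m A) n \<subseteq> carrier (covering m A)" by (rule hcomp_covering_carrier)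
      show "\<ominus>\<^bsub>covering m A\<^esub> X \<in> hcomp (covering m A) n" if "X \<in> hcomp (covering m A) n" for X
        using subsetD[OF sub that] that
        by (intro hcomp_coveringI) (simp_all add: covering_minus hcomp_covering_iff hcomp_minus)
    qed (auto intro!: hcomp_coveringI simp: covering_entries covering_dims hcomp_covering_iff
        hcomp_zero hcomp_add hcomp_smult)
    show "p X n \<in> hcomp (covering m A) n" if "X \<in> carrier (covering m A)" for X n
      by (rule p_hcomp[OF that])
    show "p (X \<oplus>\<^bsub>covering m A\<^esub> Y) n = p X n \<oplus>\<^bsub>covering m A\<^esub> p Y n"
      if "X \<in> carrier (covering m A)" "Y \<in> carrier (covering m A)" for X Y n
      using that by (intro square_mat_eqI[where m = m])
        (simp_all add: p_def covering_entries covering_dims hpart_add entry)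
    show "p X k = (if k = n then X else \<zero>\<^bsub>covering m A\<^esub>)" if "X \<in> hcomp (covering m A) n" for X n k
    proof (rule square_mat_eqI[where m = m])
      fix a b assume "a < m" "b < m"
      then show "p X k $$ (a, b) = (if k = n then X else \<zero>\<^bsub>covering m A\<^esub>) $$ (a, b)"
        using that hpart_homogeneous[of "X $$ (a, b)" "int m * n + int b - int a"] m
        by (simp add: p_def covering_entries hcomp_covering_iff)
    qed (use that in \<open>auto simp: p_def covering_dims hcomp_covering_iff\<close>)
    show "\<exists>I. finite I \<and> (\<forall>n. n \<notin> I \<longrightarrow> p X n = \<zero>\<^bsub>covering m A\<^esub>) \<and>
      (\<Oplus>\<^bsub>covering m A\<^esub>n\<in>I. p X n) = X" if X: "X \<in> carrier (covering m A)" for X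
    proof (intro exI conjI allI impI)
      define g where "g a b l = int m * l + int b - int a" for a b l
      have inj: "inj (g a b)" for a b using m by (auto simp: g_def inj_def)
      define I where "I = (\<Union>a<m. \<Union>b<m. g a b -` {n. hpart A (X $$ (a, b)) n \<noteq> \<zero>\<^bsub>A\<^esub>})"
      show fin: "finite I"
        unfolding I_def using inj entry[OF X] hpart_finite by (intro finite_UN_I finite_vimageI) auto
      show "p X n = \<zero>\<^bsub>covering m A\<^esub>" if "n \<notin> I" for n
        using that by (intro square_mat_eqI[where m = m])
          (auto simp: p_def covering_entries covering_dims I_def g_def)
      have p_closed: "p X n \<in> carrier (covering m A)" for n
        using p_hcomp[OF X] hcomp_covering_carrier by blast
      then have sum_closed: "(\<Oplus>\<^bsub>covering m A\<^esub>n\<in>I. p X n) \<in> carrier (covering m A)" by auto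
      show "(\<Oplus>\<^bsub>covering m A\<^esub>n\<in>I. p X n) = X"
      proof (rule square_mat_eqI[where m = m])
        fix a b assume ab: "a < m" "b < m"
        have "(\<Oplus>\<^bsub>covering m A\<^esub>n\<in>I. p X n) $$ (a, b) = (\<Oplus>\<^bsub>A\<^esub>n\<in>I. hpart A (X $$ (a, b)) (g a b n))"
          using ab fin p_closed by (simp add: covering_entry_finsum) (simp add: p_def g_def)
        also have "\<dots> = (\<Oplus>\<^bsub>A\<^esub>n\<in>g a b ` I. hpart A (X $$ (a, b)) n)"
          using inj entry[OF X ab] by (subst M.finsum_reindex) (auto intro: inj_on_subset)
        also have "\<dots> = X $$ (a, b)"
        proof (rule hpart_sum_superset[OF entry[OF X ab]])
          show "hpart A (X $$ (a, b)) n = \<zero>\<^bsub>A\<^esub>" if "n \<notin> g a b ` I" for n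
          proof (cases "n \<in> range (g a b)")
            case True
            then show ?thesis using that ab by (auto simp: I_def)
          next
            case False
            then have "n \<notin> {int m * l + int b - int a | l. True}" by (auto simp: g_def)
            then show ?thesis using covering_carrierD(3)[OF X ab] by (simp add: hcomp_sum_iff_hpart)
          qed
        qed (use fin in simp)
        finally show "(\<Oplus>\<^bsub>covering m A\<^esub>n\<in>I. p X n) $$ (a, b) = X $$ (a, b)" .
      qed (use covering_carrierD[OF X] covering_carrierD[OF sum_closed] in simp_all)
    qed
  qed
qed

lemma graded_algebra_covering:
  assumes m: "m > 0"
  shows "graded_algebra K (covering m A)"
proof (intro graded_algebra.intro graded_algebra_axioms.intro)
  show "graded_vector_space K (covering m A)" by (rule graded_vector_space_covering[OF m])
  show "ring (covering m A)" by (rule ring_covering)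
  have smult_finsum: "c \<odot>\<^bsub>A\<^esub> (\<Oplus>\<^bsub>A\<^esub>i\<in>{..<m}. g i) = (\<Oplus>\<^bsub>A\<^esub>i\<in>{..<m}. c \<odot>\<^bsub>A\<^esub> g i)"
    if "c \<in> carrier K" "\<And>i. i < m \<Longrightarrow> g i \<in> carrier A" for c g
    by (rule finsum_additive_map(2)[OF M.abelian_group_axioms M.abelian_group_axioms])
      (use that in \<open>auto simp: smult_r_distr\<close>)
  show "(c \<odot>\<^bsub>covering m A\<^esub> X) \<otimes>\<^bsub>covering m A\<^esub> Y = c \<odot>\<^bsub>covering m A\<^esub> (X \<otimes>\<^bsub>covering m A\<^esub> Y)"
    "X \<otimes>\<^bsub>covering m A\<^esub> (c \<odot>\<^bsub>covering m A\<^esub> Y) = c \<odot>\<^bsub>covering m A\<^esub> (X \<otimes>\<^bsub>covering m A\<^esub> Y)"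
    if "c \<in> carrier K" "X \<in> carrier (covering m A)" "Y \<in> carrier (covering m A)" for c X Y
    using that covering_carrierD(4)
    by (auto intro!: square_mat_eqI[where m = m] M.finsum_cong'
        simp: covering_entries covering_dims smult_finsum smult_mult_left smult_mult_right)
  show "\<one>\<^bsub>covering m A\<^esub> \<in> hcomp (covering m A) 0"
    by (intro hcomp_coveringI) (simp_all add: covering_entries covering_dims hcomp_one hcomp_zero)
  show "X \<otimes>\<^bsub>covering m A\<^esub> Y \<in> hcomp (covering m A) (i + j)"
    if XY: "X \<in> hcomp (covering m A) i" "Y \<in> hcomp (covering m A) j" for X Y i j
  proof -
    have "X $$ (a, c) \<otimes>\<^bsub>A\<^esub> Y $$ (c, b) \<in> hcomp A (int m * (i + j) + int b - int a)"
      if "a < m" "b < m" "c < m" for a b c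
      using hcomp_mult[of "X $$ (a, c)" "int m * i + int c - int a" "Y $$ (c, b)"
          "int m * j + int b - int c"] XY that
      by (simp add: hcomp_covering_iff algebra_simps)
    then show ?thesis
      by (intro hcomp_coveringI) (auto simp: covering_entries covering_dims intro!: hcomp_finsum)
  qed
qed

end

section \<open>Isomorphisms of graded algebras\<close>

text \<open>Surjectivity and the range need only be checked on homogeneous elements, since these span both
  algebras.\<close>

lemma graded_algebra_isoI:
  assumes V: "graded_algebra K V" and W: "graded_algebra K W"
    and add: "\<And>x y. \<lbrakk>x \<in> carrier V; y \<in> carrier V\<rbrakk> \<Longrightarrow> h (x \<oplus>\<^bsub>V\<^esub> y) = h x \<oplus>\<^bsub>W\<^esub> h y"
    and mult: "\<And>x y. \<lbrakk>x \<in> carrier V; y \<in> carrier V\<rbrakk> \<Longrightarrow> h (x \<otimes>\<^bsub>V\<^esub> y) = h x \<otimes>\<^bsub>W\<^esub> h y"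
    and one: "h \<one>\<^bsub>V\<^esub> = \<one>\<^bsub>W\<^esub>"
    and smult: "\<And>c x. \<lbrakk>c \<in> carrier K; x \<in> carrier V\<rbrakk> \<Longrightarrow> h (c \<odot>\<^bsub>V\<^esub> x) = c \<odot>\<^bsub>W\<^esub> h x"
    and inj: "inj_on h (carrier V)"
    and hcomp: "\<And>n. h ` hcomp V n = hcomp W n"
  shows "h \<in> graded_algebra_iso K V W"
proof -
  interpret V: graded_algebra K V by fact
  interpret W: graded_algebra K W by fact
  have h_hcomp: "h x \<in> hcomp W n" if "x \<in> hcomp V n" for x n
    using hcomp that by blast
  have h_closed: "h x \<in> carrier W" if "x \<in> hcomp V n" for x n
    using h_hcomp[OF that] W.hcomp_closed by blast
  have h_zero: "h \<zero>\<^bsub>V\<^esub> = \<zero>\<^bsub>W\<^esub>"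
  proof -
    have "h \<zero>\<^bsub>V\<^esub> \<oplus>\<^bsub>W\<^esub> h \<zero>\<^bsub>V\<^esub> = h \<zero>\<^bsub>V\<^esub>" using add[of "\<zero>\<^bsub>V\<^esub>" "\<zero>\<^bsub>V\<^esub>"] by simp
    then show ?thesis using h_closed[OF V.hcomp_zero] by (metis W.M.add.r_cancel_one')
  qed
  have sum: "h (\<Oplus>\<^bsub>V\<^esub>n\<in>I. g n) = (\<Oplus>\<^bsub>W\<^esub>n\<in>I. h (g n))"
    if "finite I" "\<And>n. n \<in> I \<Longrightarrow> g n \<in> hcomp V n" for I g
    using that
  proof (induction I rule: finite_induct)
    case empty
    then show ?case by (simp add: h_zero)
  next
    case (insert i I)
    then have "g j \<in> carrier V" "h (g j) \<in> carrier W" if "j \<in> insert i I" for j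
      using V.hcomp_closed h_closed that by blast+
    with insert show ?case by (simp add: add Pi_def)
  qed
  have "h ` carrier V = carrier W"
  proof
    have "h x \<in> carrier W" if x: "x \<in> carrier V" for x
    proof -
      have "h x = (\<Oplus>\<^bsub>W\<^esub>n\<in>{n. hpart V x n \<noteq> \<zero>\<^bsub>V\<^esub>}. h (hpart V x n))"
        using sum[OF V.hpart_finite[OF x] V.hpart_hcomp[OF x]] V.hpart_sum[OF x] by simp
      then show ?thesis
        using h_closed[OF V.hpart_hcomp[OF x]] by (simp add: Pi_def)
    qed
    then show "h ` carrier V \<subseteq> carrier W" by blast
    show "carrier W \<subseteq> h ` carrier V"
    proof
      fix y assume y: "y \<in> carrier W"
      have "\<exists>x. x \<in> hcomp V n \<and> h x = hpart W y n" for n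
        using W.hpart_hcomp[OF y, of n] hcomp[of n] by (metis imageE)
      then obtain g where g: "\<And>n. g n \<in> hcomp V n" "\<And>n. h (g n) = hpart W y n" by metis
      let ?I = "{n. hpart W y n \<noteq> \<zero>\<^bsub>W\<^esub>}"
      have "h (\<Oplus>\<^bsub>V\<^esub>n\<in>?I. g n) = y"
        using sum[OF W.hpart_finite[OF y] g(1)] W.hpart_sum[OF y] by (simp add: g(2))
      moreover have "(\<Oplus>\<^bsub>V\<^esub>n\<in>?I. g n) \<in> carrier V"
        using g(1) V.hcomp_closed by (intro V.M.finsum_closed) auto
      ultimately show "y \<in> h ` carrier V" by (metis image_eqI)
    qed
  qed
  then have "h \<in> ring_iso V W"
    using inj add mult one by (intro ring_iso_memI) (auto intro: bij_betw_imageI)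
  then show ?thesis
    unfolding graded_algebra_iso_def using smult hcomp by blast
qed

lemma graded_algebra_isoD:
  assumes "h \<in> graded_algebra_iso K V W"
  shows "h \<in> ring_iso V W"
    "\<lbrakk>c \<in> carrier K; x \<in> carrier V\<rbrakk> \<Longrightarrow> h (c \<odot>\<^bsub>V\<^esub> x) = c \<odot>\<^bsub>W\<^esub> h x"
    "h ` hcomp V n = hcomp W n"
  using assms by (auto simp: graded_algebra_iso_def)

lemma graded_algebra_iso_trans:
  assumes g: "g \<in> graded_algebra_iso K U V" and h: "h \<in> graded_algebra_iso K V W"
  shows "h \<circ> g \<in> graded_algebra_iso K U W"
proof -
  have "(h \<circ> g) ` hcomp U n = hcomp W n" for n
    by (simp only: image_comp[symmetric] graded_algebra_isoD(3)[OF g] graded_algebra_isoD(3)[OF h])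
  then show ?thesis
    using ring_iso_set_trans[OF graded_algebra_isoD(1)[OF g] graded_algebra_isoD(1)[OF h]]
      ring_iso_memE(1)[OF graded_algebra_isoD(1)[OF g]]
      graded_algebra_isoD(2)[OF g] graded_algebra_isoD(2)[OF h]
    unfolding graded_algebra_iso_def by (simp del: image_comp)
qed

lemma graded_algebra_iso_sym:
  assumes V: "graded_algebra K V" and h: "h \<in> graded_algebra_iso K V W"
  shows "inv_into (carrier V) h \<in> graded_algebra_iso K W V"
proof -
  interpret V: graded_algebra K V by fact
  let ?g = "inv_into (carrier V) h"
  note ring = graded_algebra_isoD(1)[OF h]
  have bij: "bij_betw h (carrier V) (carrier W)" by (rule ring_iso_memE(5)[OF ring])
  have inv: "?g (h x) = x" if "x \<in> carrier V" for x
    by (rule bij_betw_inv_into_left[OF bij that])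
  have g: "?g y \<in> carrier V" "h (?g y) = y" if "y \<in> carrier W" for y
    using that bij bij_betw_inv_into_right[OF bij that] by (auto simp: bij_betw_def inv_into_into)
  have "?g (c \<odot>\<^bsub>W\<^esub> y) = c \<odot>\<^bsub>V\<^esub> ?g y" if "c \<in> carrier K" "y \<in> carrier W" for c y
    using graded_algebra_isoD(2)[OF h that(1) g(1)[OF that(2)]] g(2)[OF that(2)]
      inv[of "c \<odot>\<^bsub>V\<^esub> ?g y"] g(1)[OF that(2)] that(1) by simp
  moreover have "?g ` hcomp W n = hcomp V n" for n
  proof -
    have "(\<lambda>x. ?g (h x)) ` hcomp V n = (\<lambda>x. x) ` hcomp V n"
      by (rule image_cong[OF refl]) (rule inv[OF V.hcomp_closed])
    then show ?thesis unfolding graded_algebra_isoD(3)[OF h, symmetric] image_image by simp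
  qed
  moreover have "?g \<in> ring_iso W V"
    by (rule ring_iso_set_sym[OF V.alg.ring_axioms ring])
  ultimately show ?thesis by (simp add: graded_algebra_iso_def)
qed

text \<open>Coverings are functorial for isomorphisms.  The ring axioms of the target are transported along
  \<open>h\<close>; as isomorphisms of records may disregard the field \<open>zero\<close>, this uses that \<open>h\<close> preserves it.\<close>

lemma covering_iso:
  assumes V: "graded_algebra K V" and h: "h \<in> graded_algebra_iso K V W"
    and zero: "h \<zero>\<^bsub>V\<^esub> = \<zero>\<^bsub>W\<^esub>"
  shows "map_mat h \<in> graded_algebra_iso K (covering m V) (covering m W)"
proof -
  interpret V: graded_algebra K V by fact
  note ring = graded_algebra_isoD(1)[OF h]
  note hom = ring_iso_memE[OF ring]
  have "ring (W\<lparr>zero := h \<zero>\<^bsub>V\<^esub>\<rparr>)" by (rule V.alg.ring_iso_imp_img_ring[OF ring])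
  then interpret W: ring W by (simp add: zero)
  have inj: "inj_on h (carrier V)" using hom(5) by (simp add: bij_betw_def)
  have sum: "h (\<Oplus>\<^bsub>V\<^esub>i\<in>I. f i) = (\<Oplus>\<^bsub>W\<^esub>i\<in>I. h (f i))"
    if "finite I" "\<And>i. i \<in> I \<Longrightarrow> f i \<in> carrier V" for I :: "'i set" and f
    by (rule finsum_additive_map(2)[OF V.M.abelian_group_axioms W.abelian_group_axioms])
      (use that hom in auto)
  have hcomp_h: "h x \<in> hcomp W n" if "x \<in> hcomp V n" for x n
    using graded_algebra_isoD(3)[OF h] that by blast
  have hcomp_sum_h: "h ` hcomp_sum V D = hcomp_sum W D" for D
  proof
    show "h ` hcomp_sum V D \<subseteq> hcomp_sum W D"
    proof
      fix y assume "y \<in> h ` hcomp_sum V D"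
      then obtain I f where I: "finite I" "I \<subseteq> D" "\<forall>n\<in>I. f n \<in> hcomp V n"
        and y: "y = h (\<Oplus>\<^bsub>V\<^esub>n\<in>I. f n)"
        unfolding hcomp_sum_def by blast
      have "y = (\<Oplus>\<^bsub>W\<^esub>n\<in>I. h (f n))"
        unfolding y by (rule sum[OF I(1)]) (use I(3) V.hcomp_closed in blast)
      moreover have "\<forall>n\<in>I. h (f n) \<in> hcomp W n" using I(3) hcomp_h by blast
      ultimately show "y \<in> hcomp_sum W D"
        unfolding hcomp_sum_def mem_Collect_eq using I(1,2)
        by (intro exI[of _ I] exI[of _ "\<lambda>n. h (f n)"] conjI)
    qed
    show "hcomp_sum W D \<subseteq> h ` hcomp_sum V D"
    proof
      fix y assume "y \<in> hcomp_sum W D"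
      then obtain I f where I: "finite I" "I \<subseteq> D" "\<forall>n\<in>I. f n \<in> hcomp W n"
        and y: "y = (\<Oplus>\<^bsub>W\<^esub>n\<in>I. f n)"
        unfolding hcomp_sum_def by blast
      define g where "g n = inv_into (hcomp V n) h (f n)" for n
      have f: "f n \<in> h ` hcomp V n" if "n \<in> I" for n
        using I(3) that unfolding graded_algebra_isoD(3)[OF h] by (rule bspec)
      have g: "\<forall>n\<in>I. g n \<in> hcomp V n \<and> h (g n) = f n"
        unfolding g_def using inv_into_into[OF f] f_inv_into_f[OF f] by blast
      have "f n \<in> carrier W" if "n \<in> I" for n
        using g that hom(1) V.hcomp_closed by metis
      then have "y = (\<Oplus>\<^bsub>W\<^esub>n\<in>I. h (g n))"
        unfolding y using g by (intro W.finsum_cong') auto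
      also have "\<dots> = h (\<Oplus>\<^bsub>V\<^esub>n\<in>I. g n)"
        by (rule sum[OF I(1), symmetric]) (use g V.hcomp_closed in blast)
      finally have "y = h (\<Oplus>\<^bsub>V\<^esub>n\<in>I. g n)" .
      moreover have "(\<Oplus>\<^bsub>V\<^esub>n\<in>I. g n) \<in> hcomp_sum V D"
        unfolding hcomp_sum_def using I(1,2) g by blast
      ultimately show "y \<in> h ` hcomp_sum V D" by (rule image_eqI)
    qed
  qed
  let ?h = "map_mat h"
  let ?inv = "map_mat (inv_into (carrier V) h)"
  note entry = V.covering_carrierD(4) and dims = V.covering_carrierD(1,2)
  have closed: "?h X \<in> carrier (covering m W)" if "X \<in> carrier (covering m V)" for X
  proof -
    have "h x \<in> hcomp_sum W D" if "x \<in> hcomp_sum V D" for x D using hcomp_sum_h that by blast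
    with that show ?thesis by (auto simp: covering_def)
  qed
  have hcomp: "?h X \<in> hcomp (covering m W) l" if "X \<in> hcomp (covering m V) l" for X l
    using that hcomp_h by (auto simp: covering_def)
  have inverse: "inv_into (carrier V) h y \<in> S" "h (inv_into (carrier V) h y) = y"
    if "y \<in> h ` S" "S \<subseteq> carrier V" for y S
    using that inj by (auto simp: inv_into_f_f subset_iff)
  have surj: "?inv Y \<in> carrier (covering m V)" "?h (?inv Y) = Y" if Y: "Y \<in> carrier (covering m W)" for Y
  proof -
    have "Y $$ (a, b) \<in> h ` hcomp_sum V {int m * l + int b - int a | l. True}" if "a < m" "b < m" for a b
      using Y that unfolding hcomp_sum_h by (simp add: covering_def)
    note inv = inverse[OF this]
    have sub: "hcomp_sum V D \<subseteq> carrier V" for D using V.hcomp_sum_closed by blast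
    show "?inv Y \<in> carrier (covering m V)"
      using Y inv(1)[OF _ _ sub] by (intro V.covering_carrierI) (auto simp: covering_def)
    show "?h (?inv Y) = Y"
      using Y inv(2)[OF _ _ sub] by (intro eq_matI) (auto simp: covering_def)
  qed
  have surj_hcomp: "?inv Y \<in> hcomp (covering m V) l" "?h (?inv Y) = Y"
    if Y: "Y \<in> hcomp (covering m W) l" for Y l
  proof -
    have "Y $$ (a, b) \<in> h ` hcomp V (int m * l + int b - int a)" if "a < m" "b < m" for a b
      using Y that unfolding graded_algebra_isoD(3)[OF h] by (simp add: covering_def)
    note inv = inverse[OF this]
    have sub: "hcomp V n \<subseteq> carrier V" for n using V.hcomp_closed by blast
    show "?inv Y \<in> hcomp (covering m V) l"
      using Y inv(1)[OF _ _ sub] by (intro V.hcomp_coveringI) (auto simp: covering_def)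
    show "?h (?inv Y) = Y"
      using Y inv(2)[OF _ _ sub] by (intro eq_matI) (auto simp: covering_def)
  qed
  have "?h \<in> ring_iso (covering m V) (covering m W)"
  proof (rule ring_iso_memI)
    show "?h (X \<otimes>\<^bsub>covering m V\<^esub> Y) = ?h X \<otimes>\<^bsub>covering m W\<^esub> ?h Y"
      if X: "X \<in> carrier (covering m V)" and Y: "Y \<in> carrier (covering m V)" for X Y
    proof (rule square_mat_eqI[where m = m])
      fix a b assume ab: "a < m" "b < m"
      have "?h (X \<otimes>\<^bsub>covering m V\<^esub> Y) $$ (a, b) = h (\<Oplus>\<^bsub>V\<^esub>c\<in>{..<m}. X $$ (a, c) \<otimes>\<^bsub>V\<^esub> Y $$ (c, b))"
        using ab by (simp add: covering_entries covering_dims)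
      also have "\<dots> = (\<Oplus>\<^bsub>W\<^esub>c\<in>{..<m}. h (X $$ (a, c) \<otimes>\<^bsub>V\<^esub> Y $$ (c, b)))"
        using ab X Y by (intro sum) (auto simp: entry)
      also have "\<dots> = (\<Oplus>\<^bsub>W\<^esub>c\<in>{..<m}. ?h X $$ (a, c) \<otimes>\<^bsub>W\<^esub> ?h Y $$ (c, b))"
        using ab X Y by (intro W.finsum_cong') (auto simp: entry dims hom)
      also have "\<dots> = (?h X \<otimes>\<^bsub>covering m W\<^esub> ?h Y) $$ (a, b)"
        using ab by (simp add: covering_entries)
      finally show "?h (X \<otimes>\<^bsub>covering m V\<^esub> Y) $$ (a, b) = (?h X \<otimes>\<^bsub>covering m W\<^esub> ?h Y) $$ (a, b)" .
    qed (simp_all add: covering_dims)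
    show "?h (X \<oplus>\<^bsub>covering m V\<^esub> Y) = ?h X \<oplus>\<^bsub>covering m W\<^esub> ?h Y"
      if X: "X \<in> carrier (covering m V)" and Y: "Y \<in> carrier (covering m V)" for X Y
      using X Y by (intro square_mat_eqI[where m = m])
        (simp_all add: covering_entries covering_dims dims entry hom)
    show "?h \<one>\<^bsub>covering m V\<^esub> = \<one>\<^bsub>covering m W\<^esub>"
      by (intro square_mat_eqI[where m = m]) (simp_all add: covering_entries covering_dims hom zero)
    show "bij_betw ?h (carrier (covering m V)) (carrier (covering m W))"
    proof (rule bij_betw_imageI)
      show "inj_on ?h (carrier (covering m V))"
      proof (rule inj_on_inverseI)
        show "?inv (?h X) = X" if "X \<in> carrier (covering m V)" for X
          using that inj by (intro eq_matI) (auto simp: dims entry)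
      qed
      show "?h ` carrier (covering m V) = carrier (covering m W)"
        using closed surj by (metis (no_types, lifting) image_eqI image_subsetI subsetI subset_antisym)
    qed
  qed (rule closed)
  moreover have "?h (c \<odot>\<^bsub>covering m V\<^esub> X) = c \<odot>\<^bsub>covering m W\<^esub> ?h X"
    if "c \<in> carrier K" "X \<in> carrier (covering m V)" for c X
    using that by (intro square_mat_eqI[where m = m])
      (simp_all add: covering_entries covering_dims dims entry graded_algebra_isoD(2)[OF h])
  moreover have "?h ` hcomp (covering m V) l = hcomp (covering m W) l" for l
    using hcomp surj_hcomp by (metis (no_types, lifting) image_eqI image_subsetI subsetI subset_antisym)
  ultimately show ?thesis by (simp add: graded_algebra_iso_def)
qed

section \<open>Regrading commutes with coverings\<close>

definition cyclic_succ :: "nat \<Rightarrow> nat \<Rightarrow> nat" where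
  "cyclic_succ m a = (if Suc a = m then 0 else Suc a)"

definition cyclic_pred :: "nat \<Rightarrow> nat \<Rightarrow> nat" where
  "cyclic_pred m a = (if a = 0 then m - 1 else a - 1)"

lemma cyclic_less [simp]:
  "a < m \<Longrightarrow> cyclic_succ m a < m" "a < m \<Longrightarrow> cyclic_pred m a < m"
  by (auto simp: cyclic_succ_def cyclic_pred_def)

lemma cyclic_inverse [simp]:
  "a < m \<Longrightarrow> cyclic_succ m (cyclic_pred m a) = a" "a < m \<Longrightarrow> cyclic_pred m (cyclic_succ m a) = a"
  by (auto simp: cyclic_succ_def cyclic_pred_def)

lemma int_cyclic_succ:
  "a < m \<Longrightarrow> int (cyclic_succ m a) = int a + 1 - (if a = m - 1 then int m else 0)"
  by (auto simp: cyclic_succ_def)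

lemma all_cyclic_succ: "(\<forall>a<m. Q (cyclic_succ m a)) \<longleftrightarrow> (\<forall>a<m. Q a)"
  using cyclic_inverse(1) cyclic_less by metis

lemma (in abelian_monoid) finsum_two_deltas:
  assumes "finite S" "a \<in> S" "b \<in> S" "x \<in> carrier G" "y \<in> carrier G"
  shows "(\<Oplus>c\<in>S. (if c = a then x else \<zero>) \<oplus> (if c = b then y else \<zero>)) = x \<oplus> y"
  using assms by (simp add: finsum_addf finsum_delta Pi_def)

lemma covering_regrade_structure [simp]:
  "monoid.mult (covering m (regrade A e)) = monoid.mult (covering m A)"
  "\<one>\<^bsub>covering m (regrade A e)\<^esub> = \<one>\<^bsub>covering m A\<^esub>"
  "add (covering m (regrade A e)) = add (covering m A)"
  "smult (covering m (regrade A e)) = smult (covering m A)"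
  "carrier (matrix_algebra m (regrade A e)) = carrier (matrix_algebra m A)"
  by (simp_all add: covering_def matrix_algebra_def cong: if_cong)

context graded_algebra_idempotent
begin

text \<open>For a permutation \<open>\<sigma>\<close>, the unit \<open>f I + e S\<close> with \<open>S\<close> the permutation matrix of \<open>\<sigma>\<close>: it fixes the
  \<open>f\<close> components of a column vector and permutes the \<open>e\<close> components.\<close>

definition twist :: "nat \<Rightarrow> (nat \<Rightarrow> nat) \<Rightarrow> 'a mat" where
  "twist m \<sigma> = mat m m (\<lambda>(a, c).
     (if c = a then f else \<zero>\<^bsub>A\<^esub>) \<oplus>\<^bsub>A\<^esub> (if c = \<sigma> a then e else \<zero>\<^bsub>A\<^esub>))"

lemma twist_closed: "twist m \<sigma> \<in> carrier (matrix_algebra m A)"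
  by (rule matrix_algebraI) (auto simp: twist_def)

lemma twist_mult_left:
  assumes X: "X \<in> carrier (matrix_algebra m A)" and ab: "a < m" "b < m" "\<sigma> a < m"
  shows "(twist m \<sigma> \<otimes>\<^bsub>covering m A\<^esub> X) $$ (a, b) = f \<otimes>\<^bsub>A\<^esub> X $$ (a, b) \<oplus>\<^bsub>A\<^esub> e \<otimes>\<^bsub>A\<^esub> X $$ (\<sigma> a, b)"
proof -
  have "(twist m \<sigma> \<otimes>\<^bsub>covering m A\<^esub> X) $$ (a, b) =
      (\<Oplus>\<^bsub>A\<^esub>c\<in>{..<m}. (if c = a then f \<otimes>\<^bsub>A\<^esub> X $$ (a, b) else \<zero>\<^bsub>A\<^esub>) \<oplus>\<^bsub>A\<^esub>
        (if c = \<sigma> a then e \<otimes>\<^bsub>A\<^esub> X $$ (\<sigma> a, b) else \<zero>\<^bsub>A\<^esub>))"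
    unfolding covering_entries(1)[OF ab(1,2)]
    by (rule M.finsum_cong') (use ab matrix_algebra_entry[OF X] in \<open>auto simp: twist_def alg.l_distr\<close>)
  also have "\<dots> = f \<otimes>\<^bsub>A\<^esub> X $$ (a, b) \<oplus>\<^bsub>A\<^esub> e \<otimes>\<^bsub>A\<^esub> X $$ (\<sigma> a, b)"
    by (rule M.finsum_two_deltas) (use ab matrix_algebra_entry[OF X] in auto)
  finally show ?thesis .
qed

lemma twist_mult_right:
  assumes X: "X \<in> carrier (matrix_algebra m A)" and ab: "a < m" "b < m" "\<tau> b < m"
    and inv: "\<And>c. c < m \<Longrightarrow> b = \<sigma> c \<longleftrightarrow> c = \<tau> b"
  shows "(X \<otimes>\<^bsub>covering m A\<^esub> twist m \<sigma>) $$ (a, b) = X $$ (a, b) \<otimes>\<^bsub>A\<^esub> f \<oplus>\<^bsub>A\<^esub> X $$ (a, \<tau> b) \<otimes>\<^bsub>A\<^esub> e"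
proof -
  have "(X \<otimes>\<^bsub>covering m A\<^esub> twist m \<sigma>) $$ (a, b) =
      (\<Oplus>\<^bsub>A\<^esub>c\<in>{..<m}. (if c = b then X $$ (a, b) \<otimes>\<^bsub>A\<^esub> f else \<zero>\<^bsub>A\<^esub>) \<oplus>\<^bsub>A\<^esub>
        (if c = \<tau> b then X $$ (a, \<tau> b) \<otimes>\<^bsub>A\<^esub> e else \<zero>\<^bsub>A\<^esub>))"
    unfolding covering_entries(1)[OF ab(1,2)]
    by (rule M.finsum_cong') (use ab matrix_algebra_entry[OF X] in \<open>auto simp: twist_def alg.r_distr inv\<close>)
  also have "\<dots> = X $$ (a, b) \<otimes>\<^bsub>A\<^esub> f \<oplus>\<^bsub>A\<^esub> X $$ (a, \<tau> b) \<otimes>\<^bsub>A\<^esub> e"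
    by (rule M.finsum_two_deltas) (use ab matrix_algebra_entry[OF X] in auto)
  finally show ?thesis .
qed

lemma twist_inverse:
  assumes "\<And>a. a < m \<Longrightarrow> \<sigma> a < m" "\<And>a. a < m \<Longrightarrow> \<tau> (\<sigma> a) = a"
  shows "twist m \<sigma> \<otimes>\<^bsub>covering m A\<^esub> twist m \<tau> = \<one>\<^bsub>covering m A\<^esub>"
proof (rule square_mat_eqI[where m = m])
  fix a b assume "a < m" "b < m"
  then show "(twist m \<sigma> \<otimes>\<^bsub>covering m A\<^esub> twist m \<tau>) $$ (a, b) = \<one>\<^bsub>covering m A\<^esub> $$ (a, b)"
    using assms
    by (auto simp: twist_mult_left[OF twist_closed] covering_entries(2))
      (auto simp: twist_def alg.r_distr peirce_simps peirce_idempotents(4))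
qed (simp_all add: covering_dims)

abbreviation U where "U m \<equiv> twist m (cyclic_succ m)"
abbreviation U' where "U' m \<equiv> twist m (cyclic_pred m)"

text \<open>Position \<open>a\<close> of the matrices over the regraded algebra stands for the module
  \<open>f A(-a) \<oplus> e A(1 - a)\<close>.  The rotation moves the summand \<open>e A(1 - a)\<close> to position \<open>a - 1\<close>, where
  it completes \<open>f A(-(a - 1))\<close> to \<open>A(-(a - 1))\<close>; the summand \<open>e A(1)\<close> of position \<open>0\<close> goes to the last
  position, where it differs by a shift by \<open>m\<close>, that is, by \<open>1\<close> in the covering, from \<open>e A(-(m - 1))\<close>.\<close>

definition twisted_conj :: "nat \<Rightarrow> 'a mat \<Rightarrow> 'a mat" where
  "twisted_conj m X = U m \<otimes>\<^bsub>covering m A\<^esub> X \<otimes>\<^bsub>covering m A\<^esub> U' m"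

lemma twisted_conj_closed:
  "X \<in> carrier (matrix_algebra m A) \<Longrightarrow> twisted_conj m X \<in> carrier (matrix_algebra m A)"
  unfolding twisted_conj_def by (intro matrix_mult_closed twist_closed)

lemma twisted_conj_entry:
  assumes X: "X \<in> carrier (matrix_algebra m A)" and ab: "a < m" "b < m"
  shows "twisted_conj m X $$ (a, b) =
    (f \<otimes>\<^bsub>A\<^esub> X $$ (a, b) \<oplus>\<^bsub>A\<^esub> e \<otimes>\<^bsub>A\<^esub> X $$ (cyclic_succ m a, b)) \<otimes>\<^bsub>A\<^esub> f \<oplus>\<^bsub>A\<^esub>
    (f \<otimes>\<^bsub>A\<^esub> X $$ (a, cyclic_succ m b) \<oplus>\<^bsub>A\<^esub> e \<otimes>\<^bsub>A\<^esub> X $$ (cyclic_succ m a, cyclic_succ m b)) \<otimes>\<^bsub>A\<^esub> e"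
proof -
  have inv: "b = cyclic_pred m c \<longleftrightarrow> c = cyclic_succ m b" if "c < m" for c
    using that ab(2) cyclic_inverse by metis
  show ?thesis
    unfolding twisted_conj_def
    using ab X twist_mult_right[where \<sigma> = "cyclic_pred m" and \<tau> = "cyclic_succ m",
        OF matrix_mult_closed[OF twist_closed X] ab _ inv]
    by (simp add: twist_mult_left)
qed

lemma twisted_conj_corners:
  assumes X: "X \<in> carrier (matrix_algebra m A)" and ab: "a < m" "b < m"
  shows
    "f \<otimes>\<^bsub>A\<^esub> twisted_conj m X $$ (a, b) \<otimes>\<^bsub>A\<^esub> f = f \<otimes>\<^bsub>A\<^esub> X $$ (a, b) \<otimes>\<^bsub>A\<^esub> f"
    "f \<otimes>\<^bsub>A\<^esub> twisted_conj m X $$ (a, b) \<otimes>\<^bsub>A\<^esub> e = f \<otimes>\<^bsub>A\<^esub> X $$ (a, cyclic_succ m b) \<otimes>\<^bsub>A\<^esub> e"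
    "e \<otimes>\<^bsub>A\<^esub> twisted_conj m X $$ (a, b) \<otimes>\<^bsub>A\<^esub> f = e \<otimes>\<^bsub>A\<^esub> X $$ (cyclic_succ m a, b) \<otimes>\<^bsub>A\<^esub> f"
    "e \<otimes>\<^bsub>A\<^esub> twisted_conj m X $$ (a, b) \<otimes>\<^bsub>A\<^esub> e =
      e \<otimes>\<^bsub>A\<^esub> X $$ (cyclic_succ m a, cyclic_succ m b) \<otimes>\<^bsub>A\<^esub> e"
  using ab matrix_algebra_entry[OF X]
  by (simp_all add: twisted_conj_entry[OF X] alg.l_distr alg.r_distr alg.m_assoc peirce_simps)

lemma hcomp_iff_left:
  assumes "x \<in> carrier A"
  shows "x \<in> hcomp A n \<longleftrightarrow> f \<otimes>\<^bsub>A\<^esub> x \<in> hcomp A n \<and> e \<otimes>\<^bsub>A\<^esub> x \<in> hcomp A n"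
  using hcomp_add[of "f \<otimes>\<^bsub>A\<^esub> x" n "e \<otimes>\<^bsub>A\<^esub> x"] peirce_left[OF assms]
    hcomp_mult[OF f_hcomp, of x n] hcomp_mult[OF e_hcomp, of x n] by auto

lemma hcomp_iff_right:
  assumes "x \<in> carrier A"
  shows "x \<in> hcomp A n \<longleftrightarrow> x \<otimes>\<^bsub>A\<^esub> f \<in> hcomp A n \<and> x \<otimes>\<^bsub>A\<^esub> e \<in> hcomp A n"
  using hcomp_add[of "x \<otimes>\<^bsub>A\<^esub> f" n "x \<otimes>\<^bsub>A\<^esub> e"] peirce_right[OF assms]
    hcomp_mult[OF _ f_hcomp, of x n] hcomp_mult[OF _ e_hcomp, of x n] by auto

text \<open>The degree conditions of one entry \<open>x\<close> of a matrix in the regraded covering.  Here \<open>p\<close> and \<open>q\<close> are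
  the diagonal entries of the complementary idempotents of the covering, \<open>u\<close> and \<open>v\<close> tell whether the
  row and the column are the last one, and \<open>k\<close> is the change of degree by one step of the covering.
  Outside the last row and column \<open>p\<close> is \<open>1\<close>, so that no corner is shifted there.\<close>

lemma corner_degrees:
  assumes x: "x \<in> carrier A"
  defines "p \<equiv> \<lambda>u. if u then f else \<one>\<^bsub>A\<^esub>" and "q \<equiv> \<lambda>u. if u then e else \<zero>\<^bsub>A\<^esub>"
  shows "(p u \<otimes>\<^bsub>A\<^esub> x \<otimes>\<^bsub>A\<^esub> p v \<in> hcomp A d \<and> p u \<otimes>\<^bsub>A\<^esub> x \<otimes>\<^bsub>A\<^esub> q v \<in> hcomp A (d - k) \<and>
      q u \<otimes>\<^bsub>A\<^esub> x \<otimes>\<^bsub>A\<^esub> p v \<in> hcomp A (d + k) \<and> q u \<otimes>\<^bsub>A\<^esub> x \<otimes>\<^bsub>A\<^esub> q v \<in> hcomp A d) \<longleftrightarrow>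
    f \<otimes>\<^bsub>A\<^esub> x \<otimes>\<^bsub>A\<^esub> f \<in> hcomp A d \<and> f \<otimes>\<^bsub>A\<^esub> x \<otimes>\<^bsub>A\<^esub> e \<in> hcomp A (d - (if v then k else 0)) \<and>
    e \<otimes>\<^bsub>A\<^esub> x \<otimes>\<^bsub>A\<^esub> f \<in> hcomp A (d + (if u then k else 0)) \<and>
    e \<otimes>\<^bsub>A\<^esub> x \<otimes>\<^bsub>A\<^esub> e \<in> hcomp A (d + (if u then k else 0) - (if v then k else 0))"
proof (cases u; cases v)
  assume "u" "\<not> v"
  then show ?thesis
    using x hcomp_iff_right[of "f \<otimes>\<^bsub>A\<^esub> x" d] hcomp_iff_right[of "e \<otimes>\<^bsub>A\<^esub> x" "d + k"]
    by (auto simp: p_def q_def hcomp_zero)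
next
  assume "\<not> u" "v"
  then show ?thesis
    using x hcomp_iff_left[of "x \<otimes>\<^bsub>A\<^esub> f" d] hcomp_iff_left[of "x \<otimes>\<^bsub>A\<^esub> e" "d - k"]
    by (auto simp: p_def q_def hcomp_zero alg.m_assoc)
qed (use x hcomp_iff_corners[OF x, of d] in \<open>auto simp: p_def q_def hcomp_zero\<close>)

lemma diagonal_entry_eq_diag:
  "diagonal_entry A m j e = diag m (\<lambda>a. if a = j then e else \<zero>\<^bsub>A\<^esub>)"
  unfolding diagonal_entry_def diag_def by (rule eq_matI) auto

lemma covering_idempotent:
  assumes m: "m > 0"
  shows "graded_algebra_idempotent K (covering m A) (diagonal_entry A m j e)"
proof (intro graded_algebra_idempotent.intro graded_algebra_idempotent_axioms.intro)
  show "graded_algebra K (covering m A)" by (rule graded_algebra_covering[OF m])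
  show "diagonal_entry A m j e \<in> hcomp (covering m A) 0"
    by (intro hcomp_coveringI) (auto simp: diagonal_entry_def e_hcomp hcomp_zero)
  show "diagonal_entry A m j e \<otimes>\<^bsub>covering m A\<^esub> diagonal_entry A m j e = diagonal_entry A m j e"
    unfolding diagonal_entry_eq_diag
    by (rule square_mat_eqI[where m = m])
      (auto simp: diag_mult_left[OF diag_closed] covering_dims, auto simp: diag_def e_idem)
qed

text \<open>Membership is first reduced to the corners of the entries at \<open>e\<close>; this also covers the requirement
  that the matrix lie in the covering, because its corners then have admissible degrees.\<close>

lemma hcomp_regrade_covering:
  assumes m: "m > 0" and Y: "Y \<in> carrier (matrix_algebra m A)"
  shows "Y \<in> hcomp (regrade (covering m A) (diagonal_entry A m (m - 1) e)) l \<longleftrightarrow>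
    (\<forall>a<m. \<forall>b<m. let y = Y $$ (a, b); d = int m * l + int b - int a;
        r = (if a = m - 1 then int m else 0); s = (if b = m - 1 then int m else 0) in
      f \<otimes>\<^bsub>A\<^esub> y \<otimes>\<^bsub>A\<^esub> f \<in> hcomp A d \<and> f \<otimes>\<^bsub>A\<^esub> y \<otimes>\<^bsub>A\<^esub> e \<in> hcomp A (d - s) \<and>
      e \<otimes>\<^bsub>A\<^esub> y \<otimes>\<^bsub>A\<^esub> f \<in> hcomp A (d + r) \<and> e \<otimes>\<^bsub>A\<^esub> y \<otimes>\<^bsub>A\<^esub> e \<in> hcomp A (d + r - s))"
    (is "?L \<longleftrightarrow> ?R")
proof -
  let ?C = "covering m A" and ?\<epsilon> = "diagonal_entry A m (m - 1) e"
  interpret C: graded_algebra_idempotent K ?C ?\<epsilon> by (rule covering_idempotent[OF m])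
  define p where "p a = (if a = m - 1 then f else \<one>\<^bsub>A\<^esub>)" for a
  define q where "q a = (if a = m - 1 then e else \<zero>\<^bsub>A\<^esub>)" for a
  have pq: "p a \<in> carrier A" "q a \<in> carrier A" for a by (simp_all add: p_def q_def)
  have \<epsilon>: "?\<epsilon> = diag m q" unfolding diagonal_entry_eq_diag q_def ..
  have \<phi>: "C.f = diag m p"
  proof (rule square_mat_eqI[where m = m])
    fix a b assume ab: "a < m" "b < m"
    have "C.f $$ (a, b) = \<one>\<^bsub>?C\<^esub> $$ (a, b) \<ominus>\<^bsub>A\<^esub> ?\<epsilon> $$ (a, b)"
      using ab unfolding a_minus_def covering_minus[OF C.e_closed] by (simp add: covering_entries)
    also have "\<dots> = diag m p $$ (a, b)"
      using ab unfolding \<epsilon> by (auto simp: diag_def covering_entries(2) p_def q_def a_minus_def)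
    finally show "C.f $$ (a, b) = diag m p $$ (a, b)" .
  qed (simp_all add: a_minus_def covering_dims diag_def)
  have corner: "(diag m r \<otimes>\<^bsub>?C\<^esub> Y \<otimes>\<^bsub>?C\<^esub> diag m s) \<in> hcomp ?C n \<longleftrightarrow>
      (\<forall>a<m. \<forall>b<m. r a \<otimes>\<^bsub>A\<^esub> Y $$ (a, b) \<otimes>\<^bsub>A\<^esub> s b \<in> hcomp A (int m * n + int b - int a))"
    if "\<And>a. r a \<in> carrier A" "\<And>a. s a \<in> carrier A" for r s n
  proof -
    have closed: "diag m r \<in> carrier (matrix_algebra m A)" by (rule diag_closed[OF that(1)])
    have "(diag m r \<otimes>\<^bsub>?C\<^esub> Y \<otimes>\<^bsub>?C\<^esub> diag m s) $$ (a, b) = r a \<otimes>\<^bsub>A\<^esub> Y $$ (a, b) \<otimes>\<^bsub>A\<^esub> s b"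
      if ab: "a < m" "b < m" for a b
      unfolding diag_mult_right[OF matrix_mult_closed[OF closed Y] \<open>\<And>a. s a \<in> carrier A\<close> ab]
        diag_mult_left[OF Y \<open>\<And>a. r a \<in> carrier A\<close> ab] ..
    then show ?thesis
      unfolding hcomp_covering_iff carrier_mat_def by (simp only: mem_Collect_eq covering_dims) auto
  qed
  have degrees: "(diag m p \<otimes>\<^bsub>?C\<^esub> Y \<otimes>\<^bsub>?C\<^esub> diag m p \<in> hcomp ?C l \<and>
      diag m p \<otimes>\<^bsub>?C\<^esub> Y \<otimes>\<^bsub>?C\<^esub> diag m q \<in> hcomp ?C (l - 1) \<and>
      diag m q \<otimes>\<^bsub>?C\<^esub> Y \<otimes>\<^bsub>?C\<^esub> diag m p \<in> hcomp ?C (l + 1) \<and>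
      diag m q \<otimes>\<^bsub>?C\<^esub> Y \<otimes>\<^bsub>?C\<^esub> diag m q \<in> hcomp ?C l) \<longleftrightarrow> ?R"
  proof -
    have d: "int m * (l - 1) + int b - int a = int m * l + int b - int a - int m"
      "int m * (l + 1) + int b - int a = int m * l + int b - int a + int m" for a b
      by (simp_all add: algebra_simps)
    have R: "?R \<longleftrightarrow> (\<forall>a<m. \<forall>b<m. let d = int m * l + int b - int a in
        p a \<otimes>\<^bsub>A\<^esub> Y $$ (a, b) \<otimes>\<^bsub>A\<^esub> p b \<in> hcomp A d \<and> p a \<otimes>\<^bsub>A\<^esub> Y $$ (a, b) \<otimes>\<^bsub>A\<^esub> q b \<in> hcomp A (d - int m) \<and>
        q a \<otimes>\<^bsub>A\<^esub> Y $$ (a, b) \<otimes>\<^bsub>A\<^esub> p b \<in> hcomp A (d + int m) \<and> q a \<otimes>\<^bsub>A\<^esub> Y $$ (a, b) \<otimes>\<^bsub>A\<^esub> q b \<in> hcomp A d)"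
      unfolding Let_def p_def q_def
      by (intro all_cong) (rule corner_degrees[symmetric, OF matrix_algebra_entry[OF Y]])
    show ?thesis
      unfolding R
      unfolding corner[OF pq(1) pq(1)] corner[OF pq(1) pq(2)] corner[OF pq(2) pq(1)]
        corner[OF pq(2) pq(2)] d Let_def
      by (simp only: all_conj_distrib imp_conjR)
  qed
  have "Y \<in> carrier ?C" if R: ?R
  proof (rule covering_carrierI)
    fix a b assume ab: "a < m" "b < m"
    let ?D = "{int m * l + int b - int a | l. True}"
    define d where "d = int m * l + int b - int a"
    define r where "r = (if a = m - 1 then int m else 0)"
    define s where "s = (if b = m - 1 then int m else 0)"
    have D: "d + int m * k \<in> ?D" for k
      by (rule CollectI, rule exI[of _ "l + k"]) (simp add: d_def algebra_simps)
    have deg: "d \<in> ?D" "d - s \<in> ?D" "d + r \<in> ?D" "d + r - s \<in> ?D"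
    proof -
      define u :: int where "u = (if a = m - 1 then 1 else 0)"
      define v :: int where "v = (if b = m - 1 then 1 else 0)"
      have rs: "r = int m * u" "s = int m * v" by (simp_all add: r_def s_def u_def v_def)
      show "d \<in> ?D" "d - s \<in> ?D" "d + r \<in> ?D" "d + r - s \<in> ?D"
        using D[of 0] D[of "- v"] D[of u] D[of "u - v"]
        by (simp_all only: rs mult_zero_right add_0_right mult_minus_right add_uminus_conv_diff
            right_diff_distrib add_diff_eq)
    qed
    note y = matrix_algebra_entry[OF Y ab]
    have corners: "f \<otimes>\<^bsub>A\<^esub> Y $$ (a, b) \<otimes>\<^bsub>A\<^esub> f \<in> hcomp A d" "f \<otimes>\<^bsub>A\<^esub> Y $$ (a, b) \<otimes>\<^bsub>A\<^esub> e \<in> hcomp A (d - s)"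
      "e \<otimes>\<^bsub>A\<^esub> Y $$ (a, b) \<otimes>\<^bsub>A\<^esub> f \<in> hcomp A (d + r)" "e \<otimes>\<^bsub>A\<^esub> Y $$ (a, b) \<otimes>\<^bsub>A\<^esub> e \<in> hcomp A (d + r - s)"
      using R ab unfolding Let_def d_def r_def s_def by blast+
    note mem = hcomp_subset_hcomp_sum[OF corners(1) deg(1)] hcomp_subset_hcomp_sum[OF corners(2) deg(2)]
      hcomp_subset_hcomp_sum[OF corners(3) deg(3)] hcomp_subset_hcomp_sum[OF corners(4) deg(4)]
    show "Y $$ (a, b) \<in> hcomp_sum A ?D"
      using hcomp_sum_add[OF hcomp_sum_add[OF mem(1,2)] hcomp_sum_add[OF mem(3,4)]]
      unfolding peirce_decomposition[OF y] .
  qed (use Y in \<open>simp_all add: matrix_algebra_dim\<close>)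
  note carrier = this
  show ?thesis
    unfolding hcomp_regrade mem_Collect_eq \<phi>
    unfolding \<epsilon>
    unfolding degrees
    by (intro iffI conjI) (erule conjunct2, erule carrier, assumption)
qed

text \<open>Conjugation by a unit is a ring automorphism of the full matrix ring, so only the gradings have to
  be compared.  The corner \<open>f y e\<close> of the entry at \<open>(a, b)\<close> after conjugation is that of the entry at
  \<open>(a, b + 1)\<close> before, and likewise for \<open>e y f\<close> and \<open>e y e\<close>.  Hence the shifts by \<open>1\<close> in the regraded
  algebra are absorbed by the indices, and the wrap-around of the indices produces the shifts by
  \<open>m\<close> in the last row and column.\<close>

lemma covering_regrade_iso:
  assumes m: "m > 0"
  shows "twisted_conj m \<in> graded_algebra_iso K (covering m (regrade A e))
    (regrade (covering m A) (diagonal_entry A m (m - 1) e))"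
proof (rule graded_algebra_isoI)
  let ?C = "covering m A" and ?M = "matrix_algebra m A" and ?\<epsilon> = "diagonal_entry A m (m - 1) e"
  interpret A': graded_algebra K "regrade A e" by (rule graded_algebra_regrade)
  interpret C: graded_algebra_idempotent K ?C ?\<epsilon> by (rule covering_idempotent[OF m])
  interpret Mat: ring ?M by (rule ring_matrix_algebra)
  show "graded_algebra K (covering m (regrade A e))" by (rule A'.graded_algebra_covering[OF m])
  show "graded_algebra K (regrade ?C ?\<epsilon>)" by (rule C.graded_algebra_regrade)
  have mat: "X \<in> carrier ?M" if "X \<in> carrier (covering m (regrade A e))" for X
    using A'.covering_carrier_subset that by auto
  have inverse: "U m \<otimes>\<^bsub>?C\<^esub> U' m = \<one>\<^bsub>?C\<^esub>" "U' m \<otimes>\<^bsub>?C\<^esub> U m = \<one>\<^bsub>?C\<^esub>"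
    by (rule twist_inverse; simp)+
  note one = Mat.l_one[simplified] Mat.r_one[simplified]
  have cancel: "U m \<otimes>\<^bsub>?C\<^esub> (U' m \<otimes>\<^bsub>?C\<^esub> X) = X" "U' m \<otimes>\<^bsub>?C\<^esub> (U m \<otimes>\<^bsub>?C\<^esub> X) = X" if "X \<in> carrier ?M" for X
    using that by (simp_all add: matrix_mult_assoc[symmetric] twist_closed inverse one)
  note mat_rules = twisted_conj_def matrix_mult_assoc matrix_mult_closed twist_closed cancel inverse one
  show "twisted_conj m (X \<oplus>\<^bsub>covering m (regrade A e)\<^esub> Y) =
      twisted_conj m X \<oplus>\<^bsub>regrade ?C ?\<epsilon>\<^esub> twisted_conj m Y"
    if "X \<in> carrier (covering m (regrade A e))" "Y \<in> carrier (covering m (regrade A e))" for X Y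
    using mat[OF that(1)] mat[OF that(2)]
    by (simp add: mat_rules Mat.l_distr[simplified] Mat.r_distr[simplified] Mat.a_closed[simplified])
  show "twisted_conj m (X \<otimes>\<^bsub>covering m (regrade A e)\<^esub> Y) =
      twisted_conj m X \<otimes>\<^bsub>regrade ?C ?\<epsilon>\<^esub> twisted_conj m Y"
    if "X \<in> carrier (covering m (regrade A e))" "Y \<in> carrier (covering m (regrade A e))" for X Y
    using mat[OF that(1)] mat[OF that(2)] by (simp add: mat_rules)
  show "twisted_conj m \<one>\<^bsub>covering m (regrade A e)\<^esub> = \<one>\<^bsub>regrade ?C ?\<epsilon>\<^esub>"
    by (simp add: mat_rules Mat.one_closed[simplified])
  show "twisted_conj m (c \<odot>\<^bsub>covering m (regrade A e)\<^esub> X) = c \<odot>\<^bsub>regrade ?C ?\<epsilon>\<^esub> twisted_conj m X"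
    if c: "c \<in> carrier K" and "X \<in> carrier (covering m (regrade A e))" for c X
  proof (rule square_mat_eqI[where m = m])
    note X = mat[OF that(2)]
    have cX: "c \<odot>\<^bsub>?C\<^esub> X \<in> carrier ?M"
      using c matrix_algebra_entry[OF X] by (intro matrix_algebraI) (simp_all add: covering_entries covering_dims)
    fix a b assume ab: "a < m" "b < m"
    then show "twisted_conj m (c \<odot>\<^bsub>covering m (regrade A e)\<^esub> X) $$ (a, b) =
        (c \<odot>\<^bsub>regrade ?C ?\<epsilon>\<^esub> twisted_conj m X) $$ (a, b)"
      using c matrix_algebra_entry[OF X]
      by (simp add: twisted_conj_entry[OF X] twisted_conj_entry[OF cX] covering_entries
          smult_mult_left smult_mult_right smult_r_distr alg.l_distr)
  qed (simp_all add: twisted_conj_def covering_dims)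
  show "inj_on (twisted_conj m) (carrier (covering m (regrade A e)))"
  proof (rule inj_on_inverseI)
    show "U' m \<otimes>\<^bsub>?C\<^esub> twisted_conj m X \<otimes>\<^bsub>?C\<^esub> U m = X" if "X \<in> carrier (covering m (regrade A e))" for X
      using mat[OF that] by (simp add: mat_rules)
  qed
  \<comment> \<open>Each corner condition ranges over all positions, so rotating the indices does not change it.\<close>
  have hcomp_iff: "twisted_conj m X \<in> hcomp (regrade ?C ?\<epsilon>) l \<longleftrightarrow>
      X \<in> hcomp (covering m (regrade A e)) l" if X: "X \<in> carrier ?M" for X l
  proof -
    let ?s = "cyclic_succ m"
    let ?d = "\<lambda>a b. int m * l + int b - int a"
    let ?H = "\<lambda>p q i a b. p \<otimes>\<^bsub>A\<^esub> X $$ (a, b) \<otimes>\<^bsub>A\<^esub> q \<in> hcomp A (?d a b + i)"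
    have deg: "?d a b - (if b = m - 1 then int m else 0) = ?d a (?s b) + -1"
      "?d a b + (if a = m - 1 then int m else 0) = ?d (?s a) b + 1"
      "?d a b + (if a = m - 1 then int m else 0) - (if b = m - 1 then int m else 0) = ?d (?s a) (?s b) + 0"
      "?d a b = ?d a b + 0"
      if "a < m" "b < m" for a b
      using that by (simp_all add: int_cyclic_succ)
    have "twisted_conj m X \<in> hcomp (regrade ?C ?\<epsilon>) l \<longleftrightarrow> (\<forall>a<m. \<forall>b<m.
        ?H f f 0 a b \<and> ?H f e (-1) a (?s b) \<and> ?H e f 1 (?s a) b \<and> ?H e e 0 (?s a) (?s b))"
      unfolding hcomp_regrade_covering[OF m twisted_conj_closed[OF X]] Let_def
      by (intro all_cong) (simp only: twisted_conj_corners[OF X] deg(3), simp only: deg(1,2), simp)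
    also have "\<dots> \<longleftrightarrow> (\<forall>a<m. \<forall>b<m. ?H f f 0 a b) \<and> (\<forall>a<m. \<forall>b<m. ?H f e (-1) a (?s b)) \<and>
        (\<forall>a<m. \<forall>b<m. ?H e f 1 (?s a) b) \<and> (\<forall>a<m. \<forall>b<m. ?H e e 0 (?s a) (?s b))"
      by (simp only: all_conj_distrib imp_conjR)
    also have "\<dots> \<longleftrightarrow> (\<forall>a<m. \<forall>b<m. ?H f f 0 a b) \<and> (\<forall>a<m. \<forall>b<m. ?H f e (-1) a b) \<and>
        (\<forall>a<m. \<forall>b<m. ?H e f 1 a b) \<and> (\<forall>a<m. \<forall>b<m. ?H e e 0 a b)"
      using all_cyclic_succ[of m "?H f e (-1) a" for a] all_cyclic_succ[of m "\<lambda>a. \<forall>b<m. ?H e f 1 a b"]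
        all_cyclic_succ[of m "?H e e 0 a" for a] all_cyclic_succ[of m "\<lambda>a. \<forall>b<m. ?H e e 0 a b"]
      by (simp only:)
    also have "\<dots> \<longleftrightarrow> (\<forall>a<m. \<forall>b<m. ?H f f 0 a b \<and> ?H f e (-1) a b \<and> ?H e f 1 a b \<and> ?H e e 0 a b)"
      by (simp only: all_conj_distrib imp_conjR)
    also have "\<dots> \<longleftrightarrow> (\<forall>a<m. \<forall>b<m. X $$ (a, b) \<in> hcomp (regrade A e) (?d a b))"
      by (intro all_cong) (simp add: hcomp_regrade matrix_algebra_entry[OF X])
    also have "\<dots> \<longleftrightarrow> X \<in> hcomp (covering m (regrade A e)) l"
      using carrier_matI[OF matrix_algebra_dim[OF X]] unfolding A'.hcomp_covering_iff by blast
    finally show ?thesis .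
  qed
  show "twisted_conj m ` hcomp (covering m (regrade A e)) l = hcomp (regrade ?C ?\<epsilon>) l" for l
  proof
    show "twisted_conj m ` hcomp (covering m (regrade A e)) l \<subseteq> hcomp (regrade ?C ?\<epsilon>) l"
      using hcomp_iff mat A'.hcomp_covering_carrier by blast
    show "hcomp (regrade ?C ?\<epsilon>) l \<subseteq> twisted_conj m ` hcomp (covering m (regrade A e)) l"
    proof
      fix Y assume Y: "Y \<in> hcomp (regrade ?C ?\<epsilon>) l"
      then have Y_mat: "Y \<in> carrier ?M"
        using covering_carrier_subset by (auto simp: hcomp_regrade)
      let ?X = "U' m \<otimes>\<^bsub>?C\<^esub> Y \<otimes>\<^bsub>?C\<^esub> U m"
      have X: "?X \<in> carrier ?M" by (intro matrix_mult_closed twist_closed Y_mat)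
      have "twisted_conj m ?X = Y" using Y_mat by (simp add: mat_rules)
      then show "Y \<in> twisted_conj m ` hcomp (covering m (regrade A e)) l"
        using hcomp_iff[OF X, of l] Y by (metis image_eqI)
    qed
  qed
qed

end

section \<open>Coverings of the endomorphism algebra\<close>

theorem proposition3p8:
  fixes K :: "'k ring"
    and A :: "('k, 'a) graded_space"
    and e :: "nat \<Rightarrow> 'a"
    and n i0 m :: nat
  assumes "graded_algebra K A"
    and "complete_primitive_orthogonal_idempotents (degree_zero_part A) n e"
    and "1 \<le> i0" and "i0 \<le> n"
    and "m > 0"
  defines "B \<equiv> graded_End A (quotient_plus_shifted_ideal A (e i0))"
  shows "\<exists>h. h \<in> graded_algebra_iso K (covering m B)
           (graded_End (covering m A)
             (quotient_plus_shifted_ideal (covering m A) (diagonal_entry A m (m - 1) (e i0))))"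
proof -
  have "idempotent_elem (degree_zero_part A) (e i0)"
    using assms(2-4) by (simp add: complete_primitive_orthogonal_idempotents_def primitive_idempotent_def)
  then have "e i0 \<in> hcomp A 0" "e i0 \<otimes>\<^bsub>A\<^esub> e i0 = e i0"
    by (simp_all add: idempotent_elem_def degree_zero_part_def)
  then interpret A: graded_algebra_idempotent K A "e i0"
    using assms(1) by (simp add: graded_algebra_idempotent_def graded_algebra_idempotent_axioms_def)
  \<comment> \<open>Both endomorphism algebras are regradings, of \<open>A\<close> and of its covering; conjugation joins them.\<close>
  let ?A' = "regrade A (e i0)" and ?C = "covering m A" and ?\<epsilon> = "diagonal_entry A m (m - 1) (e i0)"
  interpret A': graded_algebra K ?A' by (rule A.graded_algebra_regrade)
  interpret C: graded_algebra_idempotent K ?C ?\<epsilon> by (rule A.covering_idempotent[OF assms(5)])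
  obtain \<theta> where \<theta>: "\<theta> \<in> graded_algebra_iso K ?A' B" "\<theta> \<zero>\<^bsub>?A'\<^esub> = \<zero>\<^bsub>B\<^esub>"
    using A.graded_End_quotient_plus_shifted_ideal unfolding B_def by blast
  obtain \<theta>' where \<theta>': "\<theta>' \<in> graded_algebra_iso K (regrade ?C ?\<epsilon>)
      (graded_End ?C (quotient_plus_shifted_ideal ?C ?\<epsilon>))"
    using C.graded_End_quotient_plus_shifted_ideal by blast
  show ?thesis
    using graded_algebra_iso_trans[OF graded_algebra_iso_trans[OF
        graded_algebra_iso_sym[OF A'.graded_algebra_covering[OF assms(5)]
          covering_iso[OF A'.graded_algebra_axioms \<theta>]]
        A.covering_regrade_iso[OF assms(5)]] \<theta>']
    by blast
qed

end
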